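(* Let $f:[0,1]^2\to\mathbb{R}$, $f(\alpha,\beta)=\frac{1}{1+\alpha\beta}$. Then $f$ (a Perron function with no integral parameters) satisfies the good continuity condition and is the Perron formula for the Dirichlet spectrum $\mathrm{D}$ and the Mordell-Gruber spectrum $\mathrm{MG}_2$, i.e. $\mathrm{D}=\sigma'_{f,\limsup}$ and $\mathrm{MG}_2=\sigma_{f,\sup}$. Consequently $\mathrm{D}\subset\mathrm{MG}_2$, and both $\mathrm{D}$ and $\mathrm{MG}_2$ are closed.
   Context: Dirichlet spectrum: $\mathrm{D}=\{\mu(\alpha):\alpha\in\mathbb{R}\setminus\mathbb{Q}\}$, where $\mu(\alpha)=\limsup_{t\in\mathbb{N},\,t\to\infty}\; t\cdot\min\{|q\alpha-p| : p,q\in\mathbb{Z},\ 0<q\le t\}$. Mordell-Gruber spectrum: a unimodular lattice in $\mathbb{R}^2$ is $\Lambda=\mathbb{Z}A+\mathbb{Z}B$ with $|\det(A;B)|=1$; a rectangle $[-x,x]\times[-y,y]$ ($x,y>0$) is admissible in $\Lambda$ if its only point in $\Lambda$ is $(0,0)$; $\kappa(\Lambda)=\sup xy$ over admissible rectangles; $\mathrm{MG}_2=\{\kappa(\Lambda):\Lambda\text{ unimodular}\}$. Good continuity for a function $f$ of the two fractional parameters $(\alpha,\beta)\in[0,1]^2$ only (no integral parameters) means that $f$ is continuous on $[0,1]^2$. For a two-sided sequence $a$ put $\alpha^{[a]}_n=[0;a_{n+1},a_{n+2},\dots]$, $\beta^{[a]}_n=[0;a_{n-1},a_{n-2},\dots]$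 (continued fractions, $[0;s_1,s_2,\dots]=1/(s_1+1/(s_2+\cdots))$, with $1/\infty=0$) and $P^{[a]}_k=f(\alpha^{[a]}_{k-1},\beta^{[a]}_k)$. $\sigma'_{f,\limsup}$ is the set of all $\limsup_{|k|\to\infty}P^{[a]}_k$ over sequences $a:\mathbb{Z}\to\mathbb{N}^+=\{1,2,\dots\}$. $\sigma_{f,\sup}$ is the set of all $\sup_k P^{[a]}_k$ (over all $k$ for which $P^{[a]}_k$ is defined) over sequences $a$ with values in $\mathbb{N}^+\cup\{\infty\}$ such that each of $(a_0,a_1,\dots)$ and $(a_{-1},a_{-2},\dots)$ either has all terms finite or has a first term equal to $\infty$ with no terms defined beyond it. *)

theory Defs
  imports "HOL-Analysis.Analysis"
begin

(* All suprema and limits superior below are taken in the extended reals, and a spectrum is the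
   set of real numbers occurring as such values. For the spectra considered here the values are
   always finite (by the theorems of Dirichlet and Minkowski, and since f is bounded), so no
   value is lost. *)

subsection \<open>Dirichlet spectrum\<close>

(* For t \<ge> 1 the infimum over p, q is attained, so it is the minimum; the value at t = 0 does
   not influence the limit superior. *)
definition dirichlet_const :: "real \<Rightarrow> ereal" where
  "dirichlet_const \<alpha> =
     limsup (\<lambda>t::nat. ereal (real t *
       Inf {\<bar>of_int q * \<alpha> - of_int p\<bar> | p q :: int. 0 < q \<and> q \<le> int t}))"

definition dirichlet_spectrum :: "real set" where
  "dirichlet_spectrum = {m. \<exists>\<alpha>. \<alpha> \<notin> \<rat> \<and> dirichlet_const \<alpha> = ereal m}"

subsection \<open>Mordell-Gruber spectrum\<close>

definition unimodular_lattice :: "(real^2) set \<Rightarrow> bool" where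
  "unimodular_lattice \<Lambda> \<longleftrightarrow>
     (\<exists>A B :: real^2. \<bar>det (vector [A, B] :: real^2^2)\<bar> = 1 \<and>
        \<Lambda> = {of_int m *\<^sub>R A + of_int n *\<^sub>R B | m n :: int. True})"

definition admissible_rectangle :: "(real^2) set \<Rightarrow> real \<Rightarrow> real \<Rightarrow> bool" where
  "admissible_rectangle \<Lambda> x y \<longleftrightarrow>
     0 < x \<and> 0 < y \<and> cbox (vector [-x, -y]) (vector [x, y]) \<inter> \<Lambda> = {0}"

definition mordell_gruber_const :: "(real^2) set \<Rightarrow> ereal" where
  "mordell_gruber_const \<Lambda> = Sup {ereal (x * y) | x y. admissible_rectangle \<Lambda> x y}"

definition mordell_gruber_spectrum :: "real set" where
  "mordell_gruber_spectrum =
     {m. \<exists>\<Lambda>. unimodular_lattice \<Lambda> \<and> mordell_gruber_const \<Lambda> = ereal m}"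

subsection \<open>Continued fractions\<close>

(* cfrac_trunc n s = [0; s 0, \<dots>, s (n - 1)]. Since 1/\<infinity> = 0, terms of s after an infinite term
   are never inspected. *)
primrec cfrac_trunc :: "nat \<Rightarrow> (nat \<Rightarrow> enat) \<Rightarrow> real" where
  "cfrac_trunc 0 s = 0"
| "cfrac_trunc (Suc n) s =
     (case s 0 of enat m \<Rightarrow> 1 / (real m + cfrac_trunc n (\<lambda>i. s (Suc i))) | \<infinity> \<Rightarrow> 0)"

definition cfrac :: "(nat \<Rightarrow> enat) \<Rightarrow> real" where
  "cfrac s = lim (\<lambda>n. cfrac_trunc n s)"

subsection \<open>Perron spectra of a function of two fractional parameters\<close>

definition good_continuity :: "(real \<times> real \<Rightarrow> real) \<Rightarrow> bool" where
  "good_continuity f \<longleftrightarrow> continuous_on ({0..1} \<times> {0..1}) f"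

(* A two-sided sequence that may terminate is a partial map on the integers:
   None marks terms that are not defined. *)

definition alpha :: "(int \<rightharpoonup> enat) \<Rightarrow> int \<Rightarrow> real" where
  "alpha a n = cfrac (\<lambda>i. the (a (n + 1 + int i)))"

definition beta :: "(int \<rightharpoonup> enat) \<Rightarrow> int \<Rightarrow> real" where
  "beta a n = cfrac (\<lambda>i. the (a (n - 1 - int i)))"

definition perron :: "(real \<times> real \<Rightarrow> real) \<Rightarrow> (int \<rightharpoonup> enat) \<Rightarrow> int \<Rightarrow> real" where
  "perron f a k = f (alpha a (k - 1), beta a k)"

(* The k for which perron f a k is defined: alpha a (k - 1) starts with the term a k, and
   beta a k starts with the term a (k - 1). *)
definition perron_dom :: "(int \<rightharpoonup> enat) \<Rightarrow> int set" where
  "perron_dom a = {k. k \<in> dom a \<and> k - 1 \<in> dom a}"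

definition perron_half :: "(nat \<rightharpoonup> enat) \<Rightarrow> bool" where
  "perron_half s \<longleftrightarrow>
     (\<forall>i. \<exists>m\<ge>1. s i = Some (enat m)) \<or>
     (\<exists>N. (\<forall>i<N. \<exists>m\<ge>1. s i = Some (enat m)) \<and> s N = Some \<infinity> \<and> (\<forall>i>N. s i = None))"

definition perron_seq :: "(int \<rightharpoonup> enat) \<Rightarrow> bool" where
  "perron_seq a \<longleftrightarrow>
     perron_half (\<lambda>i. a (int i)) \<and> perron_half (\<lambda>i. a (- 1 - int i))"

definition sigma_sup :: "(real \<times> real \<Rightarrow> real) \<Rightarrow> real set" where
  "sigma_sup f =
     {m. \<exists>a. perron_seq a \<and> (SUP k\<in>perron_dom a. ereal (perron f a k)) = ereal m}"

(* The filter is the one of \<bar>k\<bar> \<rightarrow> \<infinity>. *)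
definition sigma_limsup' :: "(real \<times> real \<Rightarrow> real) \<Rightarrow> real set" where
  "sigma_limsup' f =
     {m. \<exists>a :: int \<Rightarrow> nat. (\<forall>i. a i \<ge> 1) \<and>
        Limsup (filtercomap abs at_top) (\<lambda>k::int. ereal (perron f (\<lambda>i. Some (enat (a i))) k))
          = ereal m}"

end

theory Submission
  imports Defs "HOL-Library.Diagonal_Subsequence"
begin

text \<open>
Both spectra are read off from the same staircase.  Let a lattice have a basis
\<open>(X1, Y1)\<close>, \<open>(- X2, Y2)\<close> with nonnegative \<open>X1, X2, Y1, Y2\<close>.  In a nontrivial integer combination
of the two vectors either the abscissas or the ordinates add up without cancellation, so no
nonzero lattice point lies strictly inside the box with corner \<open>(X1, Y2)\<close> (\<open>abs_pts_reduced\<close>).  If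
the determinant \<open>X1 * Y2 + X2 * Y1\<close> is 1, then \<open>X1 * Y2 = 1 / (1 + \<alpha> * \<beta>)\<close> for \<open>\<alpha> = X2 / X1\<close> and
\<open>\<beta> = Y1 / Y2\<close>.  A step of the Euclidean algorithm replaces the basis by
\<open>(- X2, Y2)\<close>, \<open>(X1 - k * X2, Y1 + k * Y2)\<close>, which turns \<open>1 / \<alpha>\<close> into \<open>1 / \<alpha> - k\<close> and \<open>\<beta>\<close> into
\<open>1 / (k + \<beta>)\<close>: on the two-sided sequence that consists of the partial quotients of \<open>\<alpha>\<close> and \<open>\<beta>\<close> this
is a shift.  Hence the products of the coordinates of the corners, along the staircase of empty
boxes, are exactly the values of the Perron formula along the sequence.

For the Mordell-Gruber constant every empty box lies below some corner of the staircase, so the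
constant is the supremum of the Perron values (\<open>kappa_eq_SUP\<close>).  A lattice without nonzero points on
the coordinate axes has a basis of the above form (\<open>reduced_basis_exists\<close>), and \<open>\<alpha>\<close> and \<open>\<beta>\<close> are then
irrational, so they do determine a sequence.  For the other lattices the constant is 1, which is also
the supremum for every sequence that contains \<open>\<infinity>\<close>.

For the Dirichlet constant of \<open>\<alpha>\<close> one uses the lattice of the points \<open>(q * \<alpha> - p, q)\<close>, whose
staircase starts at the axis point \<open>(1, 0)\<close> and continues with the convergents.  The quantity
whose limit superior is taken is, up to a null sequence, largest just before \<open>t\<close> passes the next
denominator, so its limit superior is that of the corners.  The left fraction \<open>\<beta>\<close> is a finite
continued fraction here, but prolonging it changes it only by an exponentially small amount
(\<open>cf_contraction\<close>), which a limit superior does not see.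

The inclusion and the closedness are compactness arguments.  A large term of a sequence pushes the
Perron value close to 1, so below 1 only bounded sequences matter, and these have pointwise
convergent subsequences.  Shifting a sequence along positions at which its limit superior \<open>m\<close> is
approached yields a limit sequence whose values are at most \<open>m\<close> and equal to \<open>m\<close> at the origin
(\<open>limsup_attained_by_recurring\<close>), whence the inclusion; closedness of the set of suprema is the same
argument for a sequence of sequences.  For limits superior, a limit of limits superior must be
realised by a single sequence.  It is built by concatenation of blocks of the given
sequences, each block running from one occurrence to another of a central word of the common limit
sequence; since the words at the junctions agree, no junction creates a value that was not there
before (locale \<open>block_concatenation\<close>).
\<close>

section \<open>Limits superior of real-valued families\<close>

text \<open>
The suprema and limits superior of the spectra are extended reals, but all values involved are
bounded.  Working with the \<open>\<epsilon>\<close>-characterisation keeps the arguments within the reals.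
\<close>

definition limsup_is :: "'a filter \<Rightarrow> ('a \<Rightarrow> real) \<Rightarrow> real \<Rightarrow> bool" where
  "limsup_is F g m \<longleftrightarrow>
     (\<forall>e>0. (\<forall>\<^sub>F x in F. g x < m + e) \<and> (\<exists>\<^sub>F x in F. m - e < g x))"

lemma Limsup_ereal_eq_iff:
  "Limsup F (\<lambda>x. ereal (g x)) = ereal m \<longleftrightarrow> limsup_is F g m"
proof -
  have up: "Limsup F (\<lambda>x. ereal (g x)) \<le> ereal m \<longleftrightarrow> (\<forall>e>0. \<forall>\<^sub>F x in F. g x < m + e)"
  proof
    assume "Limsup F (\<lambda>x. ereal (g x)) \<le> ereal m"
    then have *: "\<forall>\<^sub>F x in F. ereal (g x) < y" if "y > ereal m" for y
      using that by (simp add: Limsup_le_iff)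
    show "\<forall>e>0. \<forall>\<^sub>F x in F. g x < m + e"
      using *[of "ereal (m + e)" for e] by auto
  next
    assume R: "\<forall>e>0. \<forall>\<^sub>F x in F. g x < m + e"
    show "Limsup F (\<lambda>x. ereal (g x)) \<le> ereal m"
    proof (rule ereal_le_epsilon2)
      fix e :: real assume "0 < e"
      then have "\<forall>\<^sub>F x in F. ereal (g x) \<le> ereal (m + e)"
        using R by (auto elim!: eventually_mono)
      then show "Limsup F (\<lambda>x. ereal (g x)) \<le> ereal m + ereal e"
        by (simp add: Limsup_bounded)
    qed
  qed
  have low: "ereal m \<le> Limsup F (\<lambda>x. ereal (g x)) \<longleftrightarrow> (\<forall>e>0. \<exists>\<^sub>F x in F. m - e < g x)"
  proof
    assume L: "ereal m \<le> Limsup F (\<lambda>x. ereal (g x))"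
    show "\<forall>e>0. \<exists>\<^sub>F x in F. m - e < g x"
    proof (intro allI impI, rule ccontr)
      fix e :: real assume "0 < e" and "\<not> (\<exists>\<^sub>F x in F. m - e < g x)"
      then have "\<forall>\<^sub>F x in F. ereal (g x) \<le> ereal (m - e)"
        by (simp add: not_frequently not_less)
      then have "Limsup F (\<lambda>x. ereal (g x)) \<le> ereal (m - e)" by (rule Limsup_bounded)
      with L have "ereal m \<le> ereal (m - e)" by (rule order_trans)
      then show False using \<open>0 < e\<close> by simp
    qed
  next
    assume R: "\<forall>e>0. \<exists>\<^sub>F x in F. m - e < g x"
    show "ereal m \<le> Limsup F (\<lambda>x. ereal (g x))"
    proof (rule ccontr)
      assume "\<not> ereal m \<le> Limsup F (\<lambda>x. ereal (g x))"
      then obtain z where z: "Limsup F (\<lambda>x. ereal (g x)) < ereal z" "ereal z < ereal m"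
        by (metis not_le ereal_dense2)
      have "\<forall>\<^sub>F x in F. ereal (g x) < ereal z"
        using z(1) by (rule Limsup_lessD)
      moreover have "\<exists>\<^sub>F x in F. m - (m - z) < g x" using R z(2) by (metis diff_gt_0_iff_gt less_ereal.simps(1))
      ultimately have "\<exists>\<^sub>F x in F. z < g x \<and> g x < z"
        using frequently_eventually_conj[of "\<lambda>x. m - (m - z) < g x" F "\<lambda>x. ereal (g x) < ereal z"]
        by (simp add: conj_commute)
      then show False by (auto dest: frequently_ex)
    qed
  qed
  have "Limsup F (\<lambda>x. ereal (g x)) = ereal m \<longleftrightarrow>
    Limsup F (\<lambda>x. ereal (g x)) \<le> ereal m \<and> ereal m \<le> Limsup F (\<lambda>x. ereal (g x))" by auto
  then show ?thesis unfolding limsup_is_def using up low by blast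
qed

text \<open>
The upper half of a limit superior.  It determines the whole, the limit superior being the least
eventual bound, and it is easy to transfer between families over different index sets.
\<close>

definition eventual_bound :: "'a filter \<Rightarrow> ('a \<Rightarrow> real) \<Rightarrow> real \<Rightarrow> bool" where
  "eventual_bound F g m \<longleftrightarrow> (\<forall>e>0. \<forall>\<^sub>F x in F. g x < m + e)"

lemma limsup_is_iff_least_eventual_bound:
  "limsup_is F g m \<longleftrightarrow> eventual_bound F g m \<and> (\<forall>m'<m. \<not> eventual_bound F g m')"
proof
  assume l: "limsup_is F g m"
  have "\<not> eventual_bound F g m'" if "m' < m" for m'
  proof
    define e where "e = (m - m') / 2"
    have e: "0 < e" "m' + e = m - e" using that by (auto simp: e_def field_simps)
    assume "eventual_bound F g m'"
    then have "\<forall>\<^sub>F x in F. g x < m' + e" using e(1) unfolding eventual_bound_def by blast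
    moreover have "\<exists>\<^sub>F x in F. m - e < g x" using l e(1) unfolding limsup_is_def by blast
    ultimately have "\<exists>\<^sub>F x in F. g x < m' + e \<and> m - e < g x" by (intro frequently_eventually_conj)
    then show False using e(2) by (auto dest: frequently_ex)
  qed
  then show "eventual_bound F g m \<and> (\<forall>m'<m. \<not> eventual_bound F g m')"
    using l unfolding limsup_is_def eventual_bound_def by blast
next
  assume r: "eventual_bound F g m \<and> (\<forall>m'<m. \<not> eventual_bound F g m')"
  have "\<exists>\<^sub>F x in F. m - e < g x" if "e > 0" for e
  proof (rule ccontr)
    assume "\<not> (\<exists>\<^sub>F x in F. m - e < g x)"
    then have "\<forall>\<^sub>F x in F. g x \<le> m - e" by (simp add: not_frequently not_less)
    then have "eventual_bound F g (m - e)"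
      unfolding eventual_bound_def by (auto elim!: eventually_mono)
    then show False using r that by auto
  qed
  then show "limsup_is F g m" using r unfolding limsup_is_def eventual_bound_def by blast
qed

lemma limsup_is_cong:
  assumes "\<And>m. eventual_bound F g m \<longleftrightarrow> eventual_bound G h m"
  shows "limsup_is F g m \<longleftrightarrow> limsup_is G h m"
  unfolding limsup_is_iff_least_eventual_bound using assms by simp

lemma eventual_bound_tendsto:
  assumes "((\<lambda>x. h x - g x) \<longlongrightarrow> 0) F" "eventual_bound F g m"
  shows "eventual_bound F h m"
  unfolding eventual_bound_def
proof (intro allI impI)
  fix e :: real assume e: "0 < e"
  have "\<forall>\<^sub>F x in F. h x - g x < e/2" using assms(1) e by (intro order_tendstoD(2)) auto
  moreover have "\<forall>\<^sub>F x in F. g x < m + e/2" using assms(2) e unfolding eventual_bound_def by auto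
  ultimately show "\<forall>\<^sub>F x in F. h x < m + e" by eventually_elim linarith
qed

lemma limsup_is_cong_tendsto:
  assumes "((\<lambda>x. h x - g x) \<longlongrightarrow> 0) F"
  shows "limsup_is F g m \<longleftrightarrow> limsup_is F h m"
proof (rule limsup_is_cong)
  have "((\<lambda>x. g x - h x) \<longlongrightarrow> 0) F" using tendsto_minus[OF assms] by simp
  then show "eventual_bound F g m = eventual_bound F h m" for m
    using eventual_bound_tendsto assms by blast
qed

lemma eventually_abs_at_top_int:
  "eventually P (filtercomap abs at_top) \<longleftrightarrow>
     (\<forall>\<^sub>F n in sequentially. P (int n)) \<and> (\<forall>\<^sub>F n in sequentially. P (- int n))" (is "?l \<longleftrightarrow> ?r")
proof
  assume ?l
  then obtain N where N: "\<And>k. \<bar>k\<bar> \<ge> N \<Longrightarrow> P k"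
    unfolding eventually_filtercomap eventually_at_top_linorder by blast
  then show ?r unfolding eventually_sequentially by (intro conjI exI[of _ "nat N"]) auto
next
  assume ?r
  then obtain M N where M: "\<And>n. n \<ge> M \<Longrightarrow> P (int n)" and N: "\<And>n. n \<ge> N \<Longrightarrow> P (- int n)"
    unfolding eventually_sequentially by blast
  have "P k" if "\<bar>k\<bar> \<ge> int (max M N)" for k
    using M[of "nat k"] N[of "nat (- k)"] that by (cases "k \<ge> 0") auto
  then show ?l unfolding eventually_filtercomap eventually_at_top_linorder
    by (intro exI[of _ "\<lambda>x. x \<ge> int (max M N)"]) auto
qed

lemma eventual_bound_abs_at_top:
  "eventual_bound (filtercomap abs at_top) g m \<longleftrightarrow>
     eventual_bound sequentially (\<lambda>n. g (int n)) m \<and> eventual_bound sequentially (\<lambda>n. g (- int n)) m"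
  unfolding eventual_bound_def eventually_abs_at_top_int by blast

lemma eventual_bound_mono: "eventual_bound F g m \<Longrightarrow> m \<le> m' \<Longrightarrow> eventual_bound F g m'"
  unfolding eventual_bound_def by (meson add_right_mono eventually_mono order_less_le_trans)

text \<open>
A limit superior for \<open>\<bar>k\<bar> \<rightarrow> \<infinity>\<close> is the larger one of the limits superior in the two directions.
\<close>

lemma limsup_is_abs_at_top_cases:
  assumes "limsup_is (filtercomap abs at_top) g m"
  shows "limsup_is sequentially (\<lambda>n. g (int n)) m \<or> limsup_is sequentially (\<lambda>n. g (- int n)) m"
proof (rule ccontr)
  assume no: "\<not> ?thesis"
  have b: "eventual_bound sequentially (\<lambda>n. g (int n)) m" "eventual_bound sequentially (\<lambda>n. g (- int n)) m"
    using assms unfolding limsup_is_iff_least_eventual_bound eventual_bound_abs_at_top by auto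
  then obtain m1 m2 where "m1 < m" "eventual_bound sequentially (\<lambda>n. g (int n)) m1"
      "m2 < m" "eventual_bound sequentially (\<lambda>n. g (- int n)) m2"
    using no unfolding limsup_is_iff_least_eventual_bound by blast
  then have "eventual_bound (filtercomap abs at_top) g (max m1 m2)" "max m1 m2 < m"
    unfolding eventual_bound_abs_at_top
    by (auto intro: eventual_bound_mono[OF _ max.cobounded1] eventual_bound_mono[OF _ max.cobounded2])
  then show False using assms unfolding limsup_is_iff_least_eventual_bound by blast
qed

section \<open>Continued fractions\<close>

text \<open>
One continued fraction step \<open>p \<mapsto> 1 / (a + p)\<close> is merely nonexpansive: its derivative is -1 at
\<open>a = 1\<close>, \<open>p = 0\<close>.  Two consecutive steps contract by the factor 1/4, because a product of two
consecutive tails is at most 1/2: \<open>x * p = p / (a + p) \<le> 1 / 2\<close>.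
\<close>

lemma cf_two_step:
  fixes a b x y p q p' q' :: real
  assumes "a \<ge> 1" "b \<ge> 1" "0 \<le> p'" "0 \<le> q'"
    and x: "x = 1 / (a + p)" and p: "p = 1 / (b + p')"
    and y: "y = 1 / (a + q)" and q: "q = 1 / (b + q')"
  shows "\<bar>x - y\<bar> \<le> \<bar>p' - q'\<bar> / 4"
proof -
  have pos: "0 < p" "0 < q" "p \<le> 1" "q \<le> 1"
    using assms(2-4) unfolding p q by (simp_all add: divide_le_eq)
  have xy: "0 < x" "0 < y" using assms(1) pos unfolding x y by simp_all
  have 1: "x - y = (q - p) * (x * y)"
    using assms(1) pos unfolding x y by (simp add: field_simps)
  have 2: "q - p = (p' - q') * (p * q)"
    using assms(2-4) unfolding p q by (simp add: field_simps)
  have "x * p \<le> 1/2" "y * q \<le> 1/2"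
    using assms(1) pos unfolding x y by (auto simp: field_simps)
  then have "(x * p) * (y * q) \<le> 1/2 * (1/2)"
    using xy pos by (intro mult_mono) auto
  then have 3: "\<bar>p' - q'\<bar> * ((x * p) * (y * q)) \<le> \<bar>p' - q'\<bar> * (1/4)"
    by (intro mult_left_mono) auto
  have "x - y = (p' - q') * ((x * p) * (y * q))" by (simp add: 1 2)
  then have "\<bar>x - y\<bar> = \<bar>p' - q'\<bar> * ((x * p) * (y * q))"
    using xy pos by (simp add: abs_mult)
  with 3 show ?thesis by simp
qed

text \<open>
The form in which all convergence and continuity properties of continued fractions are used:
\<open>x\<close> and \<open>y\<close> list the successive tails of two expansions whose first \<open>2 * N\<close> terms are equal.  It applies
to truncations, to infinite continued fractions and to the reversed finite ones that arise from
quotients of convergent denominators.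
\<close>

lemma cf_contraction:
  fixes s :: "nat \<Rightarrow> nat" and x y :: "nat \<Rightarrow> real"
  assumes "\<And>i. i < 2 * N \<Longrightarrow> s i \<ge> 1"
    and "\<And>i. i \<le> 2 * N \<Longrightarrow> x i \<in> {0..1}" "\<And>i. i \<le> 2 * N \<Longrightarrow> y i \<in> {0..1}"
    and "\<And>i. i < 2 * N \<Longrightarrow> x i = 1 / (real (s i) + x (Suc i))"
    and "\<And>i. i < 2 * N \<Longrightarrow> y i = 1 / (real (s i) + y (Suc i))"
  shows "\<bar>x 0 - y 0\<bar> \<le> (1/4) ^ N"
  using assms
proof (induction N arbitrary: s x y)
  case 0
  then show ?case by (auto simp: abs_le_iff intro: order_trans[of _ 1])
next
  case (Suc N)
  have "\<bar>x (0 + 2) - y (0 + 2)\<bar> \<le> (1/4) ^ N"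
    by (rule Suc.IH[of "\<lambda>i. s (i + 2)" "\<lambda>i. x (i + 2)" "\<lambda>i. y (i + 2)"])
       (use Suc.prems(1,2,3) Suc.prems(4,5)[of "_ + 2"] in auto)
  then have "\<bar>x 2 - y 2\<bar> \<le> (1/4) ^ N" by (simp only: add_0_left)
  moreover have "\<bar>x 0 - y 0\<bar> \<le> \<bar>x 2 - y 2\<bar> / 4"
  proof (rule cf_two_step)
    show "1 \<le> real (s 0)" "1 \<le> real (s 1)" using Suc.prems(1)[of 0] Suc.prems(1)[of 1] by auto
    show "0 \<le> x 2" "0 \<le> y 2" using Suc.prems(2)[of 2] Suc.prems(3)[of 2] by auto
    show "x 0 = 1 / (real (s 0) + x 1)" "x 1 = 1 / (real (s 1) + x 2)"
      using Suc.prems(4)[of 0] Suc.prems(4)[of 1] by (auto simp: numeral_2_eq_2)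
    show "y 0 = 1 / (real (s 0) + y 1)" "y 1 = 1 / (real (s 1) + y 2)"
      using Suc.prems(5)[of 0] Suc.prems(5)[of 1] by (auto simp: numeral_2_eq_2)
  qed
  ultimately have "\<bar>x 0 - y 0\<bar> \<le> (1/4) ^ N / 4" by (meson divide_right_mono order_trans zero_le_numeral)
  then show ?case by simp
qed

text \<open>
The hypothesis asks for positive terms only up to the first infinite one, as later terms of a
terminating sequence are arbitrary.
\<close>

lemma cfrac_trunc_bounds:
  assumes "\<And>i. (\<And>j. j < i \<Longrightarrow> s j \<noteq> \<infinity>) \<Longrightarrow> s i \<ge> 1"
  shows "cfrac_trunc n s \<in> {0..1}"
  using assms
proof (induction n arbitrary: s)
  case (Suc n)
  show ?case
  proof (cases "s 0")
    case (enat m)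
    have "m \<ge> 1" using Suc.prems[of 0] enat by (simp add: one_enat_def)
    moreover have "cfrac_trunc n (\<lambda>i. s (Suc i)) \<in> {0..1}"
    proof (rule Suc.IH)
      fix i assume "\<And>j. j < i \<Longrightarrow> s (Suc j) \<noteq> \<infinity>"
      then have "s j \<noteq> \<infinity>" if "j < Suc i" for j using that enat by (cases j) auto
      then show "1 \<le> s (Suc i)" by (rule Suc.prems)
    qed
    ultimately show ?thesis using enat by (auto simp: field_simps)
  qed simp
qed simp

lemma cfrac_trunc_enat_bounds:
  assumes "\<And>i. s i \<ge> (1::nat)"
  shows "cfrac_trunc n (\<lambda>i. enat (s i)) \<in> {0..1}"
  by (rule cfrac_trunc_bounds) (use assms in \<open>auto simp: one_enat_def\<close>)

lemma cfrac_trunc_close: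
  assumes s: "\<And>i. s i \<ge> (1::nat)" and t: "\<And>i. t i \<ge> (1::nat)"
    and eq: "\<And>i. i < 2 * N \<Longrightarrow> s i = t i" and mn: "m \<ge> 2 * N" "n \<ge> 2 * N"
  shows "\<bar>cfrac_trunc m (\<lambda>i. enat (s i)) - cfrac_trunc n (\<lambda>i. enat (t i))\<bar> \<le> (1/4) ^ N"
proof -
  define x where "x = (\<lambda>i. cfrac_trunc (m - i) (\<lambda>j. enat (s (i + j))))"
  define y where "y = (\<lambda>i. cfrac_trunc (n - i) (\<lambda>j. enat (t (i + j))))"
  have "\<bar>x 0 - y 0\<bar> \<le> (1/4) ^ N"
  proof (rule cf_contraction[of N s])
    fix i
    show "x i \<in> {0..1}" "y i \<in> {0..1}" unfolding x_def y_def using s t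
      by (auto intro!: cfrac_trunc_enat_bounds simp del: atLeastAtMost_iff)
    assume i: "i < 2 * N"
    then have "m - i = Suc (m - Suc i)" "n - i = Suc (n - Suc i)" using mn by auto
    then show "x i = 1 / (real (s i) + x (Suc i))" "y i = 1 / (real (s i) + y (Suc i))"
      using eq[OF i] unfolding x_def y_def by simp_all
  qed (use s in auto)
  then show ?thesis by (simp add: x_def y_def)
qed

definition cf :: "(nat \<Rightarrow> nat) \<Rightarrow> real" where
  "cf s = cfrac (\<lambda>i. enat (s i))"

lemma cf_LIMSEQ:
  assumes s: "\<And>i. s i \<ge> (1::nat)"
  shows "(\<lambda>n. cfrac_trunc n (\<lambda>i. enat (s i))) \<longlonglongrightarrow> cf s"
proof -
  have "Cauchy (\<lambda>n. cfrac_trunc n (\<lambda>i. enat (s i)))"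
    unfolding Cauchy_def
  proof (intro allI impI)
    fix e :: real assume "0 < e"
    then obtain N where N: "(1/4::real) ^ N < e" using real_arch_pow_inv[of e "1/4"] by auto
    have "dist (cfrac_trunc m (\<lambda>i. enat (s i))) (cfrac_trunc n (\<lambda>i. enat (s i))) < e"
      if "m \<ge> 2 * N" "n \<ge> 2 * N" for m n
      using cfrac_trunc_close[of s s N m n] that s N by (auto simp: dist_real_def)
    then show "\<exists>M. \<forall>m\<ge>M. \<forall>n\<ge>M. dist (cfrac_trunc m (\<lambda>i. enat (s i)))
        (cfrac_trunc n (\<lambda>i. enat (s i))) < e" by blast
  qed
  then show ?thesis
    unfolding cf_def cfrac_def by (metis Cauchy_convergent convergent_LIMSEQ_iff)
qed

lemma cf_rec:
  assumes s: "\<And>i. s i \<ge> (1::nat)"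
  shows "cf s = 1 / (real (s 0) + cf (\<lambda>i. s (Suc i)))"
    and "cf s > 0" and "cf s < 1"
proof -
  have ge0: "cf t \<ge> 0" if "\<And>i. t i \<ge> (1::nat)" for t
    using cf_LIMSEQ[OF that]
    by (rule LIMSEQ_le_const) (use cfrac_trunc_enat_bounds[of t] that in auto)
  have rec: "cf t = 1 / (real (t 0) + cf (\<lambda>i. t (Suc i)))" if t: "\<And>i. t i \<ge> (1::nat)" for t
  proof (rule LIMSEQ_unique)
    show "(\<lambda>n. cfrac_trunc (Suc n) (\<lambda>i. enat (t i))) \<longlonglongrightarrow> cf t"
      using cf_LIMSEQ[OF t] by (rule LIMSEQ_Suc)
    have "real (t 0) + cf (\<lambda>i. t (Suc i)) \<noteq> 0"
      using ge0[of "\<lambda>i. t (Suc i)", OF t] t[of 0] by linarith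
    then show "(\<lambda>n. cfrac_trunc (Suc n) (\<lambda>i. enat (t i))) \<longlonglongrightarrow> 1 / (real (t 0) + cf (\<lambda>i. t (Suc i)))"
      using cf_LIMSEQ[of "\<lambda>i. t (Suc i)"] t by (auto intro!: tendsto_intros)
  qed
  have pos: "cf t > 0" if "\<And>i. t i \<ge> (1::nat)" for t
  proof -
    have "0 < real (t 0) + cf (\<lambda>i. t (Suc i))"
      using ge0[of "\<lambda>i. t (Suc i)", OF that] that[of 0] by linarith
    then show ?thesis by (subst rec[of t, OF that]) auto
  qed
  show "cf s = 1 / (real (s 0) + cf (\<lambda>i. s (Suc i)))" "cf s > 0" using rec[of s, OF s] pos[of s, OF s] by auto
  have "1 < real (s 0) + cf (\<lambda>i. s (Suc i))" using pos[of "\<lambda>i. s (Suc i)", OF s] s[of 0] by linarith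
  then show "cf s < 1" by (subst rec[of s, OF s]) auto
qed

lemma cf_in_unit:
  assumes "\<And>i. s i \<ge> (1::nat)"
  shows "cf s \<in> {0..1}"
  using cf_rec(2,3)[of s] assms by (auto intro: less_imp_le)

text \<open>
Recovers the continued fraction from its tails; this identifies the limit of an expansion without
a separate convergence proof.
\<close>

lemma cf_unique:
  assumes s: "\<And>i. s i \<ge> (1::nat)" and x: "\<And>i. x i \<in> {0..1}"
    and rec: "\<And>i. x i = 1 / (real (s i) + x (Suc i))"
  shows "x 0 = cf s"
proof -
  have "\<bar>x 0 - cf (\<lambda>i. s (0 + i))\<bar> \<le> (1/4) ^ N" for N
  proof (rule cf_contraction[of N s x "\<lambda>k. cf (\<lambda>i. s (k + i))"])
    fix i show "cf (\<lambda>j. s (i + j)) \<in> {0..1}"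
      using cf_rec(2,3)[of "\<lambda>j. s (i + j)"] s by (auto intro: less_imp_le)
    show "cf (\<lambda>j. s (i + j)) = 1 / (real (s i) + cf (\<lambda>j. s (Suc i + j)))"
      using cf_rec(1)[of "\<lambda>j. s (i + j)"] s by simp
  qed (rule s x rec)+
  moreover have "(\<lambda>N. (1/4::real) ^ N) \<longlonglongrightarrow> 0" by (rule LIMSEQ_realpow_zero) auto
  ultimately have "\<bar>x 0 - cf s\<bar> \<le> 0" by (intro LIMSEQ_le_const) auto
  then show ?thesis by simp
qed

lemma cf_close:
  assumes s: "\<And>i. s i \<ge> (1::nat)" and t: "\<And>i. t i \<ge> (1::nat)"
    and eq: "\<And>i. i < 2 * N \<Longrightarrow> s i = t i"
  shows "\<bar>cf s - cf t\<bar> \<le> (1/4) ^ N"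
proof -
  have "\<bar>cf (\<lambda>i. s (0 + i)) - cf (\<lambda>i. t (0 + i))\<bar> \<le> (1/4) ^ N"
  proof (rule cf_contraction[of N s "\<lambda>k. cf (\<lambda>i. s (k + i))" "\<lambda>k. cf (\<lambda>i. t (k + i))"])
    fix i show "cf (\<lambda>j. s (i + j)) \<in> {0..1}" "cf (\<lambda>j. t (i + j)) \<in> {0..1}"
      using cf_rec(2,3)[of "\<lambda>j. s (i + j)"] cf_rec(2,3)[of "\<lambda>j. t (i + j)"] s t
      by (auto intro: less_imp_le)
    show "cf (\<lambda>j. s (i + j)) = 1 / (real (s i) + cf (\<lambda>j. s (Suc i + j)))"
      using cf_rec(1)[of "\<lambda>j. s (i + j)"] s by simp
    assume "i < 2 * N"
    then show "cf (\<lambda>j. t (i + j)) = 1 / (real (s i) + cf (\<lambda>j. t (Suc i + j)))"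
      using cf_rec(1)[of "\<lambda>j. t (i + j)"] t eq by simp
  qed (use s in auto)
  then show ?thesis by simp
qed

text \<open>
The partial quotients come from the orbit of the Gauss map \<open>x \<mapsto> frac (1 / x)\<close>, which never reaches
0 from an irrational point.
\<close>

lemma irrational_eq_cf:
  assumes th: "\<theta> \<notin> \<rat>" "0 < \<theta>" "\<theta> < (1::real)"
  obtains s where "\<And>i. s i \<ge> (1::nat)" "cf s = \<theta>"
proof -
  define x where "x = rec_nat \<theta> (\<lambda>_ z. frac (1 / z))"
  have x0: "x 0 = \<theta>" and xS: "x (Suc i) = frac (1 / x i)" for i by (simp_all add: x_def)
  have inv: "x i \<notin> \<rat> \<and> 0 < x i \<and> x i < 1" for i
  proof (induction i)
    case (Suc i)
    have "1 / x i \<notin> \<rat>"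
      using Suc Rats_divide[of 1 "1 / x i"] by auto
    then have "x (Suc i) \<notin> \<rat>"
      unfolding xS frac_def using Rats_add[of "1 / x i - of_int \<lfloor>1 / x i\<rfloor>" "of_int \<lfloor>1 / x i\<rfloor>"] by auto
    moreover from this have "x (Suc i) \<noteq> 0" by auto
    ultimately show ?case using frac_lt_1[of "1 / x i"] frac_ge_0[of "1 / x i"] unfolding xS by linarith
  qed (use th x0 in auto)
  define s where "s = (\<lambda>i. nat \<lfloor>1 / x i\<rfloor>)"
  have s1: "s i \<ge> 1" for i using inv[of i] unfolding s_def by (simp add: le_nat_iff le_floor_iff)
  have "x i = 1 / (real (s i) + x (Suc i))" for i
  proof -
    have "real (s i) = of_int \<lfloor>1 / x i\<rfloor>" using inv[of i] by (simp add: s_def)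
    then have "real (s i) + x (Suc i) = 1 / x i" unfolding xS frac_def by simp
    then show ?thesis by simp
  qed
  moreover have "x i \<in> {0..1}" for i using inv[of i] by auto
  ultimately have "x 0 = cf s" by (intro cf_unique s1)
  with s1 x0 that show ?thesis by auto
qed

lemma cfrac_in_unit:
  assumes t: "\<And>i. (\<And>j. j < i \<Longrightarrow> t j \<noteq> \<infinity>) \<Longrightarrow> t i \<ge> (1 :: enat)"
  shows "cfrac t \<in> {0..1}"
proof (cases "\<exists>N. t N = \<infinity>")
  case True
  then obtain N where N: "t N = \<infinity>" by blast
  have const: "cfrac_trunc n u = cfrac_trunc (Suc N) u" if "u N = \<infinity>" "n > N" for n N u
    using that
  proof (induction N arbitrary: n u)
    case 0
    then show ?case by (cases n) auto
  next
    case (Suc N)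
    then obtain n' where n': "n = Suc n'" by (cases n) auto
    then have "cfrac_trunc n' (\<lambda>i. u (Suc i)) = cfrac_trunc (Suc N) (\<lambda>i. u (Suc i))"
      using Suc.prems by (intro Suc.IH) auto
    then show ?case unfolding n' by (simp only: cfrac_trunc.simps)
  qed
  have "(\<lambda>n. cfrac_trunc n t) \<longlonglongrightarrow> cfrac_trunc (Suc N) t"
    by (rule tendsto_eventually) (use const[of t N, OF N] in \<open>auto simp: eventually_sequentially intro!: exI[of _ "Suc N"]\<close>)
  then have "cfrac t = cfrac_trunc (Suc N) t" unfolding cfrac_def by (rule limI)
  then show ?thesis using cfrac_trunc_bounds[of t "Suc N"] t by simp
next
  case False
  have "\<exists>m. t i = enat m \<and> m \<ge> 1" for i
  proof -
    obtain m where m: "t i = enat m" using False not_infinity_eq by metis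
    have "t i \<ge> 1" by (rule t) (use False in metis)
    with m show ?thesis by (auto simp: one_enat_def)
  qed
  then obtain s where s: "\<And>i. t i = enat (s i)" "\<And>i. s i \<ge> 1" by metis
  then have "t = (\<lambda>i. enat (s i))" by blast
  then have "cfrac t = cf s" unfolding cf_def by simp
  then show ?thesis using cf_in_unit[of s] s by simp
qed

lemma cfrac_infinity_first: "t 0 = \<infinity> \<Longrightarrow> cfrac t = 0"
proof -
  assume "t 0 = \<infinity>"
  then have "cfrac_trunc n t = 0" for n by (cases n) auto
  then show ?thesis unfolding cfrac_def by (simp add: limI)
qed

section \<open>Values of the Perron formula\<close>

lemma recip_lipschitz:
  assumes "0 \<le> u" "0 \<le> (v::real)"
  shows "\<bar>1 / (1 + u) - 1 / (1 + v)\<bar> \<le> \<bar>u - v\<bar>"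
proof -
  have "1 / (1 + u) - 1 / (1 + v) = (v - u) / ((1 + u) * (1 + v))"
    using assms by (simp add: field_simps)
  then have "\<bar>1 / (1 + u) - 1 / (1 + v)\<bar> = \<bar>u - v\<bar> / ((1 + u) * (1 + v))"
    using assms by (simp add: abs_mult abs_minus_commute)
  also have "\<dots> \<le> \<bar>u - v\<bar> / 1"
  proof (rule divide_left_mono)
    show "1 \<le> (1 + u) * (1 + v)" using assms by (simp add: algebra_simps)
    then show "0 < (1 + u) * (1 + v) * 1" by linarith
  qed simp
  finally show ?thesis by simp
qed

lemma recip_product_lipschitz:
  assumes "\<alpha> \<in> {0..1}" "\<beta> \<in> {0..1}" "\<alpha>' \<in> {0..1}" "\<beta>' \<in> {0..1::real}"
  shows "\<bar>1 / (1 + \<alpha> * \<beta>) - 1 / (1 + \<alpha>' * \<beta>')\<bar> \<le> \<bar>\<alpha> - \<alpha>'\<bar> + \<bar>\<beta> - \<beta>'\<bar>"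
proof -
  have "\<bar>1 / (1 + \<alpha> * \<beta>) - 1 / (1 + \<alpha>' * \<beta>')\<bar> \<le> \<bar>\<alpha> * \<beta> - \<alpha>' * \<beta>'\<bar>"
    using assms by (intro recip_lipschitz) auto
  also have "\<alpha> * \<beta> - \<alpha>' * \<beta>' = (\<alpha> - \<alpha>') * \<beta> + \<alpha>' * (\<beta> - \<beta>')" by algebra
  also have "\<bar>\<dots>\<bar> \<le> \<bar>\<alpha> - \<alpha>'\<bar> * \<beta> + \<alpha>' * \<bar>\<beta> - \<beta>'\<bar>"
    using assms abs_triangle_ineq[of "(\<alpha> - \<alpha>') * \<beta>" "\<alpha>' * (\<beta> - \<beta>')"] by (simp add: abs_mult)
  also have "\<dots> \<le> \<bar>\<alpha> - \<alpha>'\<bar> + \<bar>\<beta> - \<beta>'\<bar>"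
    using assms by (intro add_mono mult_left_le mult_left_le_one_le) auto
  finally show ?thesis .
qed

text \<open>
The Perron formula on sequences without infinite terms, where neither partial maps nor extended
natural numbers are called for.
\<close>

definition perron_value :: "(int \<Rightarrow> nat) \<Rightarrow> int \<Rightarrow> real" where
  "perron_value a k = 1 / (1 + cf (\<lambda>i. a (k + int i)) * cf (\<lambda>i. a (k - 1 - int i)))"

text \<open>
Reading a sequence backwards exchanges \<open>\<alpha>\<close> and \<open>\<beta>\<close>, in which the formula is symmetric.  This allows
left halves of sequences and staircases to be treated as right halves.
\<close>

lemma perron_value_reverse: "perron_value (\<lambda>i. a (- 1 - i)) k = perron_value a (- k)"
proof -
  have "- 1 - (k + int i) = - k - 1 - int i" "- 1 - (k - 1 - int i) = - k + int i" for i by auto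
  then show ?thesis unfolding perron_value_def by (simp only: mult.commute)
qed

lemma perron_value_shift: "perron_value (\<lambda>i. a (n + i)) k = perron_value a (n + k)"
  unfolding perron_value_def by (simp add: algebra_simps)

text \<open>
Continuity in the product topology, with a rate: Perron values are determined up to an
exponentially small error by a window of the sequence around the position.
\<close>

lemma perron_value_close:
  assumes a: "\<And>i. a i \<ge> (1::nat)" and b: "\<And>i. b i \<ge> (1::nat)"
    and eq: "\<And>i. - int (2 * N) \<le> i \<Longrightarrow> i < int (2 * N) \<Longrightarrow> a (k + i) = b (l + i)"
  shows "\<bar>perron_value a k - perron_value b l\<bar> \<le> 2 * (1/4) ^ N"
proof -
  have "\<bar>cf (\<lambda>i. a (k + int i)) - cf (\<lambda>i. b (l + int i))\<bar> \<le> (1/4) ^ N"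
    by (rule cf_close[of "\<lambda>i. a (k + int i)" "\<lambda>i. b (l + int i)"]) (use a b eq in auto)
  moreover have "a (k - 1 - int i) = b (l - 1 - int i)" if "i < 2 * N" for i
    using eq[of "- 1 - int i"] that by (simp add: algebra_simps)
  then have "\<bar>cf (\<lambda>i. a (k - 1 - int i)) - cf (\<lambda>i. b (l - 1 - int i))\<bar> \<le> (1/4) ^ N"
    using cf_close[of "\<lambda>i. a (k - 1 - int i)" "\<lambda>i. b (l - 1 - int i)" N] a b by blast
  moreover have "\<bar>perron_value a k - perron_value b l\<bar> \<le> \<bar>cf (\<lambda>i. a (k + int i)) - cf (\<lambda>i. b (l + int i))\<bar>
      + \<bar>cf (\<lambda>i. a (k - 1 - int i)) - cf (\<lambda>i. b (l - 1 - int i))\<bar>"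
    unfolding perron_value_def by (rule recip_product_lipschitz) (rule cf_in_unit, rule a b)+
  ultimately show ?thesis by linarith
qed

lemma geometric_rate: "(\<lambda>n. 2 * (1/4::real) ^ (n div 2)) \<longlonglongrightarrow> 0"
proof -
  have "filterlim (\<lambda>n::nat. n div 2) sequentially sequentially"
    unfolding filterlim_at_top eventually_sequentially
  proof (intro allI)
    fix Z :: nat
    show "\<exists>N. \<forall>n\<ge>N. Z \<le> n div 2" by (intro exI[of _ "2 * Z"]) auto
  qed
  then have "(\<lambda>n. (1/4::real) ^ (n div 2)) \<longlonglongrightarrow> 0"
    by (intro filterlim_compose[OF LIMSEQ_realpow_zero]) auto
  then show ?thesis by (rule tendsto_mult_right_zero)
qed

text \<open>
Large terms force values close to 1, since \<open>\<alpha>\<close> is at most the reciprocal of its first term.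
\<close>

lemma perron_value_bounds:
  assumes "\<And>i. a i \<ge> (1::nat)"
  shows "1 - 1 / real (a k) \<le> perron_value a k" "perron_value a k \<le> 1"
proof -
  let ?\<alpha> = "cf (\<lambda>i. a (k + int i))" and ?\<beta> = "cf (\<lambda>i. a (k - 1 - int i))"
  have \<beta>: "?\<beta> \<in> {0..1}" and \<alpha>: "?\<alpha> \<in> {0..1}" and rest: "cf (\<lambda>i. a (k + int (Suc i))) \<in> {0..1}"
    by (rule cf_in_unit, rule assms)+
  have a1: "1 \<le> real (a k)" using assms[of k] by simp
  have "?\<alpha> = 1 / (real (a k) + cf (\<lambda>i. a (k + int (Suc i))))"
    using cf_rec(1)[of "\<lambda>i. a (k + int i)"] assms by simp
  also have "\<dots> \<le> 1 / real (a k)" using rest a1 by (intro divide_left_mono) auto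
  finally have "?\<alpha> * ?\<beta> \<le> 1 / real (a k)" using \<alpha> \<beta> mult_left_le[of ?\<beta> ?\<alpha>] by simp
  moreover have nn: "0 \<le> ?\<alpha> * ?\<beta>" using \<alpha> \<beta> by simp
  moreover have "1 - ?\<alpha> * ?\<beta> \<le> 1 / (1 + ?\<alpha> * ?\<beta>)"
  proof -
    have "(1 - x) * (1 + x) \<le> 1" for x :: real by (simp add: algebra_simps)
    then show ?thesis using nn by (simp add: pos_le_divide_eq)
  qed
  ultimately show "1 - 1 / real (a k) \<le> perron_value a k" unfolding perron_value_def by linarith
  show "perron_value a k \<le> 1" unfolding perron_value_def using nn by simp
qed

lemma perron_value_less_imp_bounded:
  assumes "\<And>i. a i \<ge> (1::nat)" "perron_value a k < 1 - 1 / real M" "0 < M"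
  shows "a k \<le> M"
proof (rule ccontr)
  assume "\<not> a k \<le> M"
  then have "1 / real (a k) \<le> 1 / real M" using assms(3) by (intro divide_left_mono) auto
  then show False using perron_value_bounds(1)[of a k, OF assms(1)] assms(2) by linarith
qed

lemma perron_value_tendsto:
  assumes c: "\<And>j i. c j i \<ge> (1::nat)" and d: "\<And>i. d i \<ge> (1::nat)"
    and lim: "\<And>i. \<forall>\<^sub>F j in F. c j i = d i"
  shows "((\<lambda>j. perron_value (c j) k) \<longlongrightarrow> perron_value d k) F"
proof (rule tendstoI)
  fix e :: real assume "0 < e"
  then obtain N where N: "(1/4::real) ^ N < e / 2" using real_arch_pow_inv[of "e/2" "1/4"] by auto
  have "\<forall>\<^sub>F j in F. \<forall>i\<in>{k - int (2 * N)..k + int (2 * N)}. c j i = d i"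
    by (intro eventually_ball_finite) (auto intro: lim)
  then show "\<forall>\<^sub>F j in F. dist (perron_value (c j) k) (perron_value d k) < e"
  proof eventually_elim
    case (elim j)
    have "\<bar>perron_value (c j) k - perron_value d k\<bar> \<le> 2 * (1/4) ^ N"
      by (rule perron_value_close) (use c d elim in auto)
    then show ?case using N by (simp add: dist_real_def)
  qed
qed

section \<open>Planar lattices and empty boxes\<close>

text \<open>
Whether a centred box is empty depends only on the absolute values of the coordinates of the
nonzero lattice points.  The lattice spanned by \<open>(a, c)\<close> and \<open>(b, d)\<close> is therefore represented by the
set of these pairs, which turns reflections of the lattice into equations.
\<close>

definition abs_pts :: "real \<Rightarrow> real \<Rightarrow> real \<Rightarrow> real \<Rightarrow> (real \<times> real) set" where
  "abs_pts a b c d =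
     {(\<bar>of_int m * a + of_int n * b\<bar>, \<bar>of_int m * c + of_int n * d\<bar>) | m n :: int. (m, n) \<noteq> (0, 0)}"

lemma abs_ptsI:
  fixes m n :: int
  assumes "(m, n) \<noteq> (0, 0)" "p = \<bar>of_int m * a + of_int n * b\<bar>" "q = \<bar>of_int m * c + of_int n * d\<bar>"
  shows "(p, q) \<in> abs_pts a b c d"
  using assms unfolding abs_pts_def by blast

lemma abs_pts_subset:
  fixes p q r t :: int
  assumes "p * t - q * r \<noteq> 0"
  shows "abs_pts (of_int p * a + of_int q * b) (of_int r * a + of_int t * b)
           (of_int p * c + of_int q * d) (of_int r * c + of_int t * d) \<subseteq> abs_pts a b c d"
proof clarify
  fix x y
  assume "(x, y) \<in> abs_pts (of_int p * a + of_int q * b) (of_int r * a + of_int t * b)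
           (of_int p * c + of_int q * d) (of_int r * c + of_int t * d)"
  then obtain m n :: int where mn: "(m, n) \<noteq> (0, 0)"
    and x: "x = \<bar>of_int m * (of_int p * a + of_int q * b) + of_int n * (of_int r * a + of_int t * b)\<bar>"
    and y: "y = \<bar>of_int m * (of_int p * c + of_int q * d) + of_int n * (of_int r * c + of_int t * d)\<bar>"
    unfolding abs_pts_def by blast
  show "(x, y) \<in> abs_pts a b c d"
  proof (rule abs_ptsI[of "m * p + n * r" "m * q + n * t"])
    show "(m * p + n * r, m * q + n * t) \<noteq> (0, 0)"
    proof
      assume "(m * p + n * r, m * q + n * t) = (0, 0)"
      then have "m * p + n * r = 0" "m * q + n * t = 0" by auto
      then have "m * (p * t - q * r) = 0" "n * (p * t - q * r) = 0" by algebra+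
      with assms mn show False by auto
    qed
  qed (simp_all add: x y algebra_simps)
qed

lemma abs_pts_change_basis:
  fixes p q r t :: int
  assumes "\<bar>p * t - q * r\<bar> = 1"
  shows "abs_pts (of_int p * a + of_int q * b) (of_int r * a + of_int t * b)
           (of_int p * c + of_int q * d) (of_int r * c + of_int t * d) = abs_pts a b c d"
    (is "abs_pts ?a ?b ?c ?d = _")
proof
  show "abs_pts ?a ?b ?c ?d \<subseteq> abs_pts a b c d" using assms by (intro abs_pts_subset) auto
  \<comment> \<open>Since the determinant \<open>e\<close> is 1 or -1, the inverse base change is \<open>e\<close> times the adjugate matrix.\<close>
  define e where "e = p * t - q * r"
  have e: "e * (p * t - q * r) = 1"
    using assms unfolding e_def by (metis abs_1 abs_mult_self_eq mult_1)
  have e': "of_int e * (of_int p * of_int t - of_int q * of_int r) = (1::real)"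
    using arg_cong[OF e, of "of_int :: int \<Rightarrow> real"] by simp
  have "abs_pts (of_int (e * t) * ?a + of_int (- e * q) * ?b) (of_int (- e * r) * ?a + of_int (e * p) * ?b)
          (of_int (e * t) * ?c + of_int (- e * q) * ?d) (of_int (- e * r) * ?c + of_int (e * p) * ?d)
        \<subseteq> abs_pts ?a ?b ?c ?d"
  proof (rule abs_pts_subset)
    have "e * t * (e * p) - - e * q * (- e * r) = e * (e * (p * t - q * r))" by algebra
    then show "e * t * (e * p) - - e * q * (- e * r) \<noteq> 0" using e by auto
  qed
  moreover have "of_int (e * t) * ?a + of_int (- e * q) * ?b = a"
    "of_int (- e * r) * ?a + of_int (e * p) * ?b = b"
    "of_int (e * t) * ?c + of_int (- e * q) * ?d = c"
    "of_int (- e * r) * ?c + of_int (e * p) * ?d = d"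
    unfolding of_int_mult of_int_minus using e' by algebra+
  ultimately show "abs_pts a b c d \<subseteq> abs_pts ?a ?b ?c ?d" by simp
qed

lemma abs_pts_reflect:
  "abs_pts (- a) (- b) c d = abs_pts a b c d" "abs_pts a b (- c) (- d) = abs_pts a b c d"
proof -
  have "\<bar>of_int m * (- a) + of_int n * (- b)\<bar> = \<bar>of_int m * a + of_int n * b\<bar>" for m n :: int and a b :: real
    by (metis abs_minus_cancel minus_add_distrib mult_minus_right)
  then show "abs_pts (- a) (- b) c d = abs_pts a b c d" "abs_pts a b (- c) (- d) = abs_pts a b c d"
    by (simp_all only: abs_pts_def)
qed

lemma abs_pts_swap: "(p, q) \<in> abs_pts a b c d \<longleftrightarrow> (q, p) \<in> abs_pts c d a b"
  unfolding abs_pts_def by blast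

text \<open>
The Euclidean step from \<open>u = (X1, Y1)\<close>, \<open>v = (- X2, Y2)\<close> to \<open>v\<close>, \<open>u + k * v\<close>, followed by a reflection
that restores the sign pattern.
\<close>

lemma abs_pts_step:
  "abs_pts X2 (- (X1 - of_int k * X2)) Y2 (Y1 + of_int k * Y2) = abs_pts X1 (- X2) Y1 Y2"
proof -
  have "abs_pts (- X2) (X1 - of_int k * X2) Y2 (Y1 + of_int k * Y2) = abs_pts X1 (- X2) Y1 Y2"
    using abs_pts_change_basis[of 0 k 1 1 X1 "- X2" Y1 Y2] by simp
  then show ?thesis using abs_pts_reflect(1)[of "- X2" "X1 - of_int k * X2"] by simp
qed

text \<open>
Exchanging the two axes exchanges the roles of the two basis vectors and so reverses the
staircase.
\<close>

lemma abs_pts_mirror: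
  "(p, q) \<in> abs_pts Y2 (- Y1) X2 X1 \<longleftrightarrow> (q, p) \<in> abs_pts X1 (- X2) Y1 Y2"
proof -
  have "abs_pts Y2 (- Y1) (- X2) (- X1) = abs_pts Y1 Y2 X1 (- X2)"
    using abs_pts_change_basis[of 0 0 1 "- 1" Y1 Y2 X1 "- X2"] by simp
  then have "abs_pts Y2 (- Y1) X2 X1 = abs_pts Y1 Y2 X1 (- X2)"
    using abs_pts_reflect(2)[of Y2 "- Y1" X2 X1] by simp
  then show ?thesis using abs_pts_swap[of p q Y1 Y2 X1 "- X2"] by simp
qed

text \<open>
With coefficients of equal signs the ordinates add up, with opposite signs the abscissas do.
\<close>

lemma abs_pts_reduced:
  assumes nn: "0 \<le> X1" "0 \<le> X2" "0 \<le> Y1" "0 \<le> Y2"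
    and "(p, q) \<in> abs_pts X1 (- X2) Y1 Y2"
  shows "X1 \<le> p \<or> Y2 \<le> q"
proof -
  obtain m n :: int where mn: "(m, n) \<noteq> (0, 0)"
    and p: "p = \<bar>of_int m * X1 + of_int n * (- X2)\<bar>" and q: "q = \<bar>of_int m * Y1 + of_int n * Y2\<bar>"
    using assms(5) unfolding abs_pts_def by blast
  have ge: "of_int k * z \<ge> z" if "k \<ge> 1" "z \<ge> 0" for k :: int and z :: real
    using mult_right_mono[of 1 "of_int k" z] that by simp
  have le: "of_int k * z \<le> - z" if "k \<le> -1" "z \<ge> 0" for k :: int and z :: real
    using mult_right_mono[of "of_int k" "-1" z] that by simp
  consider "m \<ge> 1" "n \<ge> 1" | "m \<le> -1" "n \<le> -1" | "m \<ge> 1" "n \<le> 0" | "m \<le> -1" "n \<ge> 0"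
    | "m = 0" "n \<ge> 1" | "m = 0" "n \<le> -1"
    using mn by force
  then show ?thesis
  proof cases
    case 1 then show ?thesis unfolding p q using ge[of m Y1] ge[of n Y2] nn by linarith
  next
    case 2 then show ?thesis unfolding p q using le[of m Y1] le[of n Y2] nn by linarith
  next
    case 3 then show ?thesis unfolding p q
      using ge[of m X1] mult_nonpos_nonneg[of "of_int n" X2] nn by simp
  next
    case 4 then show ?thesis unfolding p q
      using le[of m X1] mult_nonneg_nonneg[of "of_int n" X2] nn by (simp, linarith)
  next
    case 5 then show ?thesis unfolding p q using ge[of n Y2] nn by simp
  next
    case 6 then show ?thesis unfolding p q using le[of n Y2] nn by simp
  qed
qed

text \<open>
Dirichlet's approximation theorem: every vertical strip around the axis contains nonzero
lattice points.
\<close>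

lemma abs_pts_small:
  fixes a b x :: real
  assumes "0 < x"
  shows "\<exists>m n :: int. (m, n) \<noteq> (0, 0) \<and> \<bar>of_int m * a + of_int n * b\<bar> \<le> x"
proof (cases "b = 0")
  case True
  then have "(0, 1) \<noteq> (0 :: int, 0 :: int) \<and> \<bar>of_int 0 * a + of_int 1 * b\<bar> \<le> x" using assms by simp
  then show ?thesis by blast
next
  case False
  obtain N :: nat where N: "\<bar>b\<bar> / x < real N" using reals_Archimedean2 by blast
  then have "N > 0" using assms by (metis abs_ge_zero divide_nonneg_pos gr0I not_le of_nat_0)
  then obtain h k where hk: "0 < k" "\<bar>of_int k * (a / b) - of_int h\<bar> < 1 / real N"
    using Dirichlet_approx[of N "a / b"] by blast
  have "\<bar>of_int k * a + of_int (- h) * b\<bar> = \<bar>b\<bar> * \<bar>of_int k * (a / b) - of_int h\<bar>"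
    using False by (simp flip: abs_mult add: field_simps)
  also have "\<dots> \<le> \<bar>b\<bar> * (1 / real N)" using hk by (intro mult_left_mono) auto
  also have "\<dots> \<le> x" using N assms \<open>N > 0\<close> by (simp add: field_simps)
  finally have "(k, - h) \<noteq> (0, 0) \<and> \<bar>of_int k * a + of_int (- h) * b\<bar> \<le> x" using hk(1) by simp
  then show ?thesis by blast
qed

text \<open>
By Cramer's rule the coefficients of a lattice point are bounded in terms of its coordinates.
\<close>

lemma abs_pts_discrete:
  assumes "\<bar>a * d - b * c\<bar> = (1::real)"
  shows "finite {(m::int, n::int). \<bar>of_int m * a + of_int n * b\<bar> \<le> x \<and> \<bar>of_int m * c + of_int n * d\<bar> \<le> y}"
proof -
  define K where "K = \<lceil>\<bar>d\<bar> * x + \<bar>b\<bar> * y + \<bar>c\<bar> * x + \<bar>a\<bar> * y\<rceil>"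
  have "m \<in> {-K..K} \<and> n \<in> {-K..K}"
    if h: "\<bar>of_int m * a + of_int n * b\<bar> \<le> x" "\<bar>of_int m * c + of_int n * d\<bar> \<le> y" for m n :: int
  proof -
    let ?p = "of_int m * a + of_int n * b" and ?q = "of_int m * c + of_int n * d"
    have "\<bar>of_int m :: real\<bar> = \<bar>of_int m * (a * d - b * c)\<bar>" using assms by (simp add: abs_mult)
    also have "of_int m * (a * d - b * c) = d * ?p - b * ?q" by algebra
    also have "\<bar>\<dots>\<bar> \<le> \<bar>d\<bar> * \<bar>?p\<bar> + \<bar>b\<bar> * \<bar>?q\<bar>" unfolding abs_mult[symmetric] by linarith
    also have "\<dots> \<le> \<bar>d\<bar> * x + \<bar>b\<bar> * y" using h by (intro add_mono mult_left_mono) auto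
    finally have 1: "\<bar>of_int m :: real\<bar> \<le> \<bar>d\<bar> * x + \<bar>b\<bar> * y" .
    have "\<bar>of_int n :: real\<bar> = \<bar>of_int n * (a * d - b * c)\<bar>" using assms by (simp add: abs_mult)
    also have "of_int n * (a * d - b * c) = a * ?q - c * ?p" by algebra
    also have "\<bar>\<dots>\<bar> \<le> \<bar>a\<bar> * \<bar>?q\<bar> + \<bar>c\<bar> * \<bar>?p\<bar>" unfolding abs_mult[symmetric] by linarith
    also have "\<dots> \<le> \<bar>a\<bar> * y + \<bar>c\<bar> * x" using h by (intro add_mono mult_left_mono) auto
    finally have 2: "\<bar>of_int n :: real\<bar> \<le> \<bar>a\<bar> * y + \<bar>c\<bar> * x" .
    have "0 \<le> x" "0 \<le> y" using h by linarith+
    then have nn: "0 \<le> \<bar>d\<bar> * x" "0 \<le> \<bar>b\<bar> * y" "0 \<le> \<bar>c\<bar> * x" "0 \<le> \<bar>a\<bar> * y" by auto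
    have "\<bar>of_int m :: real\<bar> \<le> of_int K" "\<bar>of_int n :: real\<bar> \<le> of_int K"
      using 1 2 nn unfolding K_def by linarith+
    then have "\<bar>m\<bar> \<le> K" "\<bar>n\<bar> \<le> K" by (metis of_int_abs of_int_le_iff)+
    then show ?thesis by auto
  qed
  then show ?thesis by (intro finite_subset[OF _ finite_cartesian_product[of "{-K..K}" "{-K..K}"]]) auto
qed

definition empty_box :: "(real \<times> real) set \<Rightarrow> real \<Rightarrow> real \<Rightarrow> bool" where
  "empty_box T x y \<longleftrightarrow> 0 < x \<and> 0 < y \<and> (\<forall>p q. (p, q) \<in> T \<longrightarrow> x < p \<or> y < q)"

definition kappa :: "(real \<times> real) set \<Rightarrow> ereal" where
  "kappa T = Sup {ereal (x * y) | x y. empty_box T x y}"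

lemma det_vector_2: "det (vector [A, B] :: real^2^2) = A $ 1 * B $ 2 - A $ 2 * B $ 1"
  by (simp add: det_2 vector_2 mult.commute)

lemma mordell_gruber_const_eq_kappa:
  fixes A B :: "real^2"
  assumes det: "\<bar>det (vector [A, B] :: real^2^2)\<bar> = 1"
  shows "mordell_gruber_const {of_int m *\<^sub>R A + of_int n *\<^sub>R B | m n :: int. True}
           = kappa (abs_pts (A $ 1) (B $ 1) (A $ 2) (B $ 2))"
proof -
  let ?L = "{of_int m *\<^sub>R A + of_int n *\<^sub>R B | m n :: int. True}"
  have box: "p \<in> cbox (vector [-x, -y]) (vector [x, y]) \<longleftrightarrow> \<bar>p $ 1\<bar> \<le> x \<and> \<bar>p $ 2\<bar> \<le> y"
    for p :: "real^2" and x y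
    by (auto simp: mem_box_cart forall_2)
  have nz: "A $ 1 * B $ 2 - A $ 2 * B $ 1 \<noteq> 0" using det by (auto simp: det_vector_2)
  have inj: "m = 0 \<and> n = 0" if "of_int m *\<^sub>R A + of_int n *\<^sub>R B = 0" for m n :: int
  proof -
    have "of_int m * A $ 1 + of_int n * B $ 1 = 0" "of_int m * A $ 2 + of_int n * B $ 2 = 0"
      using that by (auto simp: vec_eq_iff forall_2)
    then have "of_int m * (A $ 1 * B $ 2 - A $ 2 * B $ 1) = 0"
      "of_int n * (A $ 1 * B $ 2 - A $ 2 * B $ 1) = 0" by algebra+
    with nz show ?thesis by auto
  qed
  have "admissible_rectangle ?L x y \<longleftrightarrow> empty_box (abs_pts (A $ 1) (B $ 1) (A $ 2) (B $ 2)) x y" for x y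
  proof (cases "0 < x \<and> 0 < y")
    case True
    have "cbox (vector [-x, -y]) (vector [x, y]) \<inter> ?L = {0} \<longleftrightarrow>
       (\<forall>m n :: int. (m, n) \<noteq> (0, 0) \<longrightarrow>
           \<not> (\<bar>of_int m * A $ 1 + of_int n * B $ 1\<bar> \<le> x \<and> \<bar>of_int m * A $ 2 + of_int n * B $ 2\<bar> \<le> y))"
      (is "?l \<longleftrightarrow> ?r")
    proof
      assume l: ?l
      show ?r
      proof (intro allI impI notI)
        fix m n :: int assume "(m, n) \<noteq> (0, 0)"
          "\<bar>of_int m * A $ 1 + of_int n * B $ 1\<bar> \<le> x \<and> \<bar>of_int m * A $ 2 + of_int n * B $ 2\<bar> \<le> y"
        then have "of_int m *\<^sub>R A + of_int n *\<^sub>R B \<in> cbox (vector [-x, -y]) (vector [x, y])"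
          unfolding box by simp
        moreover have "of_int m *\<^sub>R A + of_int n *\<^sub>R B \<in> ?L" by blast
        ultimately have "of_int m *\<^sub>R A + of_int n *\<^sub>R B = 0" using l by blast
        with inj \<open>(m, n) \<noteq> (0, 0)\<close> show False by blast
      qed
    next
      assume r: ?r
      have "0 \<in> ?L" by (auto intro!: exI[of _ 0])
      moreover have "0 \<in> cbox (vector [-x, -y]) (vector [x, y] :: real^2)"
        unfolding box using True by simp
      moreover have "p = 0" if "p \<in> cbox (vector [-x, -y]) (vector [x, y]) \<inter> ?L" for p
      proof -
        have "p \<in> ?L" using that by blast
        then obtain m n :: int where p: "p = of_int m *\<^sub>R A + of_int n *\<^sub>R B"
          unfolding mem_Collect_eq by (elim exE conjE)
        have "p \<in> cbox (vector [-x, -y]) (vector [x, y])" using that by blast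
        then have "\<bar>of_int m * A $ 1 + of_int n * B $ 1\<bar> \<le> x \<and> \<bar>of_int m * A $ 2 + of_int n * B $ 2\<bar> \<le> y"
          unfolding box p by simp
        then have "(m, n) = (0, 0)" using r by blast
        then show ?thesis using p by auto
      qed
      ultimately show ?l by blast
    qed
    also have "?r \<longleftrightarrow> (\<forall>p q. (p, q) \<in> abs_pts (A $ 1) (B $ 1) (A $ 2) (B $ 2) \<longrightarrow> x < p \<or> y < q)"
      unfolding abs_pts_def by (auto simp: not_le)
    finally show ?thesis using True unfolding admissible_rectangle_def empty_box_def by simp
  qed (auto simp: admissible_rectangle_def empty_box_def)
  then show ?thesis unfolding mordell_gruber_const_def kappa_def by simp
qed

text \<open>
The closed box with corner \<open>(X, Y)\<close> itself contains lattice points in the application; the bound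
comes from the boxes that are slightly smaller.
\<close>

lemma kappa_ge:
  assumes "0 < X" "0 < Y" and T: "\<And>p q. (p, q) \<in> T \<Longrightarrow> X \<le> p \<or> Y \<le> q"
  shows "ereal (X * Y) \<le> kappa T"
proof (rule ereal_le_mult_one_interval)
  show "kappa T \<noteq> - \<infinity>"
  proof -
    have "empty_box T (X/2) (Y/2)" unfolding empty_box_def using assms by force
    then have "ereal (X/2 * (Y/2)) \<le> kappa T" unfolding kappa_def by (intro Sup_upper) blast
    then show ?thesis by auto
  qed
  fix z :: ereal assume z: "0 < z" "z < 1"
  then obtain r where r: "z = ereal r" "0 < r" "r < 1" by (cases z) (auto simp: one_ereal_def)
  have "empty_box T (sqrt r * X) (sqrt r * Y)"
    unfolding empty_box_def using assms(1,2) r T by (smt (verit) mult_less_cancel_right2 mult_pos_pos real_sqrt_gt_zero real_sqrt_lt_1_iff)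
  then have "ereal (sqrt r * X * (sqrt r * Y)) \<le> kappa T" unfolding kappa_def by (intro Sup_upper) blast
  moreover have "sqrt r * X * (sqrt r * Y) = r * (X * Y)" using r by (simp add: algebra_simps)
  ultimately show "z * ereal (X * Y) \<le> kappa T" using r by simp
qed

lemma kappa_swap: "kappa (abs_pts c d a b) = kappa (abs_pts a b c d)"
proof -
  have "empty_box (abs_pts c d a b) x y \<longleftrightarrow> empty_box (abs_pts a b c d) y x" for x y
    unfolding empty_box_def by (auto simp: abs_pts_swap[of _ _ a b c d])
  then have "{ereal (x * y) | x y. empty_box (abs_pts c d a b) x y} =
      {ereal (x * y) | x y. empty_box (abs_pts a b c d) x y}"
    by (intro Collect_cong) (metis mult.commute)
  then show ?thesis unfolding kappa_def by simp
qed

section \<open>Reduced bases and Minkowski's bound\<close>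

lemma minimum_exists_if_finite_sublevel:
  fixes g :: "'a \<Rightarrow> real"
  assumes w0: "w0 \<in> S" and fin: "finite {w \<in> S. g w \<le> g w0}"
  shows "\<exists>w\<in>S. \<forall>w'\<in>S. g w \<le> g w'"
proof -
  let ?A = "{w \<in> S. g w \<le> g w0}"
  have "Min (g ` ?A) \<in> g ` ?A" using w0 fin by (intro Min_in) auto
  then obtain w where w: "w \<in> ?A" "g w = Min (g ` ?A)" by force
  have "g w \<le> g w'" if "w' \<in> ?A" for w' unfolding w(2) using fin that by (intro Min_le) auto
  then have "g w \<le> g w'" if "w' \<in> S" for w' using that w(1) by force
  then show ?thesis using w(1) by blast
qed

text \<open>
The vector \<open>v\<close> is chosen as a lowest lattice point of the strip of half-width \<open>x\<close>, and \<open>u\<close> as a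
point closest to the vertical axis among those below \<open>v\<close>.  The box spanned by \<open>u\<close> and \<open>v\<close> is then
empty, which forces the sign pattern, because otherwise \<open>v - u\<close> or \<open>v + u\<close> would be inside, and the
basis property, because every lattice point can be reduced modulo \<open>u\<close> and \<open>v\<close> into half of the box.
The hypothesis on the horizontal axis ensures that \<open>v\<close> does not lie on it, so that there are points
lower than \<open>v\<close>.
\<close>

lemma reduced_basis_exists:
  assumes det: "\<bar>a * d - b * c\<bar> = (1::real)" and x: "0 < x"
    and axis: "\<And>p. (p, 0) \<in> abs_pts a b c d \<Longrightarrow> x < p"
  obtains X1 X2 Y1 Y2 where "0 \<le> X2" "X2 \<le> x" "x < X1" "0 \<le> Y1" "Y1 < Y2"
    "X1 * Y2 + X2 * Y1 = 1" "abs_pts a b c d = abs_pts X1 (- X2) Y1 Y2"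
proof -
  define \<xi> where "\<xi> = (\<lambda>(m::int, n::int). of_int m * a + of_int n * b)"
  define \<eta> where "\<eta> = (\<lambda>(m::int, n::int). of_int m * c + of_int n * d)"
  have fin: "finite {w. \<bar>\<xi> w\<bar> \<le> h \<and> \<bar>\<eta> w\<bar> \<le> k}" for h k
    using abs_pts_discrete[OF det, of h k] by (simp add: \<xi>_def \<eta>_def case_prod_unfold)
  have neg: "\<xi> (- w) = - \<xi> w" "\<eta> (- w) = - \<eta> w" for w
    by (simp_all add: \<xi>_def \<eta>_def case_prod_unfold)
  have comb: "\<xi> (i * m + j * m', i * n + j * n') = of_int i * \<xi> (m, n) + of_int j * \<xi> (m', n')"
    "\<eta> (i * m + j * m', i * n + j * n') = of_int i * \<eta> (m, n) + of_int j * \<eta> (m', n')" for i j m n m' n'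
    by (simp_all add: \<xi>_def \<eta>_def algebra_simps)
  \<comment> \<open>A lowest nonzero lattice point \<open>v\<close> of the strip; the sign is chosen so that it lies above the axis.\<close>
  let ?S = "{w. w \<noteq> (0, 0) \<and> \<bar>\<xi> w\<bar> \<le> x}"
  obtain v0 where v0: "v0 \<in> ?S" using abs_pts_small[OF x, of a b] by (auto simp: \<xi>_def)
  have "\<exists>w\<in>?S. \<forall>w'\<in>?S. \<bar>\<eta> w\<bar> \<le> \<bar>\<eta> w'\<bar>"
    by (rule minimum_exists_if_finite_sublevel[OF v0]) (rule finite_subset[OF _ fin[of x "\<bar>\<eta> v0\<bar>"]], auto)
  then obtain v1 where v1: "v1 \<in> ?S" "\<And>w. w \<in> ?S \<Longrightarrow> \<bar>\<eta> v1\<bar> \<le> \<bar>\<eta> w\<bar>" by blast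
  have "\<eta> v1 \<noteq> 0"
  proof
    assume "\<eta> v1 = 0"
    then have "(\<bar>\<xi> v1\<bar>, 0) \<in> abs_pts a b c d"
      using v1(1) by (intro abs_ptsI[of "fst v1" "snd v1"]) (auto simp: \<xi>_def \<eta>_def case_prod_unfold)
    then show False using axis v1(1) by force
  qed
  have "\<exists>v. v \<in> ?S \<and> 0 < \<eta> v \<and> (\<forall>w\<in>?S. \<eta> v \<le> \<bar>\<eta> w\<bar>)"
  proof (cases "0 < \<eta> v1")
    case True
    moreover have "\<forall>w\<in>?S. \<bar>\<eta> v1\<bar> \<le> \<bar>\<eta> w\<bar>" using v1(2) by blast
    ultimately show ?thesis using v1(1) by (intro exI[of _ v1]) simp
  next
    case False
    then have "\<eta> (- v1) = \<bar>\<eta> v1\<bar>" "0 < \<eta> (- v1)" using \<open>\<eta> v1 \<noteq> 0\<close> by (simp_all add: neg)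
    moreover have "- v1 \<in> ?S" using v1(1) by (simp add: neg zero_prod_def[symmetric])
    moreover have "\<forall>w\<in>?S. \<bar>\<eta> v1\<bar> \<le> \<bar>\<eta> w\<bar>" using v1(2) by blast
    ultimately show ?thesis by (intro exI[of _ "- v1"]) simp
  qed
  then obtain v where v: "v \<in> ?S" "0 < \<eta> v" "\<And>w. w \<in> ?S \<Longrightarrow> \<eta> v \<le> \<bar>\<eta> w\<bar>" by blast
  obtain mv nv where mnv: "v = (mv, nv)" by (cases v)
  note v = v[unfolded mnv]
  \<comment> \<open>Among the points lower than \<open>v\<close>, the closest one \<open>u\<close> to the vertical axis.  To see that there are
    such points, a lattice point outside the line through \<open>v\<close> is reduced modulo \<open>v\<close>.\<close>
  let ?R = "{w. w \<noteq> (0, 0) \<and> \<bar>\<eta> w\<bar> < \<eta> (mv, nv)}"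
  have "\<exists>w. w \<in> ?R"
  proof -
    obtain e1 e2 :: int where e: "e1 * nv - e2 * mv \<noteq> 0"
    proof (cases "nv = 0")
      case True
      then show ?thesis using v(1) that[of 0 1] by auto
    next
      case False
      then show ?thesis using that[of 1 0] by auto
    qed
    define k where "k = round (\<eta> (e1, e2) / \<eta> (mv, nv))"
    have "\<bar>of_int k - \<eta> (e1, e2) / \<eta> (mv, nv)\<bar> \<le> 1/2" unfolding k_def by (rule of_int_round_abs_le)
    then have "\<bar>of_int k - \<eta> (e1, e2) / \<eta> (mv, nv)\<bar> * \<eta> (mv, nv) \<le> 1/2 * \<eta> (mv, nv)"
      using v(2) by (intro mult_right_mono) auto
    also have "\<bar>of_int k - \<eta> (e1, e2) / \<eta> (mv, nv)\<bar> * \<eta> (mv, nv)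
        = \<bar>(of_int k - \<eta> (e1, e2) / \<eta> (mv, nv)) * \<eta> (mv, nv)\<bar>"
      using v(2) by (simp add: abs_mult)
    also have "(of_int k - \<eta> (e1, e2) / \<eta> (mv, nv)) * \<eta> (mv, nv) = of_int k * \<eta> (mv, nv) - \<eta> (e1, e2)"
      using v(2) by (simp add: field_simps)
    finally have "\<bar>\<eta> (1 * e1 + (- k) * mv, 1 * e2 + (- k) * nv)\<bar> < \<eta> (mv, nv)"
      unfolding comb using v(2) by (simp add: abs_minus_commute)
    moreover have "(1 * e1 + (- k) * mv, 1 * e2 + (- k) * nv) \<noteq> (0, 0)"
    proof
      assume "(1 * e1 + (- k) * mv, 1 * e2 + (- k) * nv) = (0, 0)"
      then have "e1 = k * mv" "e2 = k * nv" by auto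
      then show False using e by simp
    qed
    ultimately show ?thesis by blast
  qed
  then obtain u0 where u0: "u0 \<in> ?R" by blast
  have "\<exists>w\<in>?R. \<forall>w'\<in>?R. \<bar>\<xi> w\<bar> \<le> \<bar>\<xi> w'\<bar>"
    by (rule minimum_exists_if_finite_sublevel[OF u0]) (rule finite_subset[OF _ fin[of "\<bar>\<xi> u0\<bar>" "\<eta> (mv, nv)"]], auto)
  then obtain u1 where u1: "u1 \<in> ?R" "\<And>w. w \<in> ?R \<Longrightarrow> \<bar>\<xi> u1\<bar> \<le> \<bar>\<xi> w\<bar>" by blast
  have "x < \<bar>\<xi> u1\<bar>"
  proof (rule ccontr)
    assume "\<not> x < \<bar>\<xi> u1\<bar>"
    then have "u1 \<in> ?S" using u1(1) by auto
    then show False using v(3)[of u1] u1(1) by simp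
  qed
  have "\<exists>u. u \<in> ?R \<and> x < \<xi> u \<and> (\<forall>w\<in>?R. \<xi> u \<le> \<bar>\<xi> w\<bar>)"
  proof (cases "0 < \<xi> u1")
    case True
    moreover have "\<forall>w\<in>?R. \<bar>\<xi> u1\<bar> \<le> \<bar>\<xi> w\<bar>" using u1(2) by blast
    ultimately show ?thesis using u1(1) \<open>x < \<bar>\<xi> u1\<bar>\<close> by (intro exI[of _ u1]) simp
  next
    case False
    then have "\<xi> (- u1) = \<bar>\<xi> u1\<bar>" by (simp add: neg)
    moreover have "- u1 \<in> ?R" using u1(1) by (simp add: neg zero_prod_def[symmetric])
    moreover have "\<forall>w\<in>?R. \<bar>\<xi> u1\<bar> \<le> \<bar>\<xi> w\<bar>" using u1(2) by blast
    ultimately show ?thesis using \<open>x < \<bar>\<xi> u1\<bar>\<close> by (intro exI[of _ "- u1"]) simp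
  qed
  then obtain u where u: "u \<in> ?R" "x < \<xi> u" "\<And>w. w \<in> ?R \<Longrightarrow> \<xi> u \<le> \<bar>\<xi> w\<bar>" by blast
  obtain mu nu where mnu: "u = (mu, nu)" by (cases u)
  note u = u[unfolded mnu]
  let ?xu = "\<xi> (mu, nu)" and ?yu = "\<eta> (mu, nu)" and ?xv = "\<xi> (mv, nv)" and ?yv = "\<eta> (mv, nv)"
  have empty: "w = (0, 0)" if "\<bar>\<xi> w\<bar> < ?xu" "\<bar>\<eta> w\<bar> < ?yv" for w
    using u(3)[of w] that by auto
  have xv: "\<bar>?xv\<bar> \<le> x" and yu: "\<bar>?yu\<bar> < ?yv" using u(1) v(1) by auto
  \<comment> \<open>With equal signs of \<open>?xv\<close> and \<open>?yu\<close> the point \<open>v - u\<close> or \<open>v + u\<close> would lie in the empty box.\<close>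
  have s1: "\<not> (0 < ?xv \<and> 0 < ?yu)"
  proof
    assume h: "0 < ?xv \<and> 0 < ?yu"
    have "(1 * mv + (- 1) * mu, 1 * nv + (- 1) * nu) = (0, 0)"
      by (rule empty) (use h xv yu u(2) in \<open>unfold comb, auto\<close>)
    then have "mu = mv" "nu = nv" by auto
    then show False using xv u(2) by simp
  qed
  have s2: "\<not> (?xv < 0 \<and> ?yu < 0)"
  proof
    assume h: "?xv < 0 \<and> ?yu < 0"
    have "(1 * mv + 1 * mu, 1 * nv + 1 * nu) = (0, 0)"
      by (rule empty) (use h xv yu u(2) in \<open>unfold comb, auto\<close>)
    then have "mu = - mv" "nu = - nv" by auto
    then show False using xv u(2) neg(1)[of "(mv, nv)"] by simp
  qed
  define N where "N = mu * nv - nu * mv"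
  have D: "?xu * ?yv - ?xv * ?yu = of_int N * (a * d - b * c)"
    unfolding \<xi>_def \<eta>_def N_def by (simp add: algebra_simps)
  have Dpos: "0 < ?xu * ?yv - ?xv * ?yu"
  proof -
    have "?xv * ?yu \<le> 0" using s1 s2 by (auto simp: mult_le_0_iff not_less)
    moreover have "0 < ?xu * ?yv" using u(2) x v(2) by simp
    ultimately show ?thesis by linarith
  qed
  then have "N \<noteq> 0" using D by auto
  \<comment> \<open>Rounding the real coordinates with respect to \<open>u\<close> and \<open>v\<close> leaves a remainder in the empty box.\<close>
  have basis: "\<exists>i j. m = i * mu + j * mv \<and> n = i * nu + j * nv" for m n
  proof -
    define s where "s = of_int (m * nv - n * mv) / (of_int N :: real)"
    define t where "t = of_int (mu * n - nu * m) / (of_int N :: real)"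
    have m: "of_int m = s * of_int mu + t * of_int mv" and n: "of_int n = s * of_int nu + t * of_int nv"
      using \<open>N \<noteq> 0\<close> unfolding s_def t_def
      by (simp_all add: field_simps flip: of_int_mult of_int_add of_int_diff) (simp_all add: N_def algebra_simps)
    define i j where "i = round s" and "j = round t"
    let ?w = "(1 * m + (- 1) * (i * mu + j * mv), 1 * n + (- 1) * (i * nu + j * nv))"
    have ij: "\<bar>s - of_int i\<bar> \<le> 1/2" "\<bar>t - of_int j\<bar> \<le> 1/2"
      unfolding i_def j_def using of_int_round_abs_le by (auto simp: abs_minus_commute)
    have "\<xi> ?w = (s - of_int i) * ?xu + (t - of_int j) * ?xv"
      "\<eta> ?w = (s - of_int i) * ?yu + (t - of_int j) * ?yv"
      unfolding comb unfolding \<xi>_def \<eta>_def by (simp_all add: m n algebra_simps)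
    moreover have "\<bar>(s - of_int i) * z + (t - of_int j) * z'\<bar> \<le> 1/2 * \<bar>z\<bar> + 1/2 * \<bar>z'\<bar>" for z z'
      using mult_right_mono[OF ij(1), of "\<bar>z\<bar>"] mult_right_mono[OF ij(2), of "\<bar>z'\<bar>"]
        abs_triangle_ineq[of "(s - of_int i) * z" "(t - of_int j) * z'"]
      unfolding abs_mult by linarith
    ultimately have "\<bar>\<xi> ?w\<bar> \<le> 1/2 * \<bar>?xu\<bar> + 1/2 * \<bar>?xv\<bar>" "\<bar>\<eta> ?w\<bar> \<le> 1/2 * \<bar>?yu\<bar> + 1/2 * \<bar>?yv\<bar>" by simp_all
    then have "?w = (0, 0)" by (intro empty) (use xv yu u(2) in linarith)+
    then have "m = i * mu + j * mv \<and> n = i * nu + j * nv" by simp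
    then show ?thesis by blast
  qed
  \<comment> \<open>The integral base change from \<open>u\<close>, \<open>v\<close> to the unit vectors inverts that of determinant \<open>N\<close>.\<close>
  obtain i1 j1 where 1: "1 = i1 * mu + j1 * mv" "0 = i1 * nu + j1 * nv" using basis[of 1 0] by blast
  obtain i2 j2 where 2: "0 = i2 * mu + j2 * mv" "1 = i2 * nu + j2 * nv" using basis[of 0 1] by blast
  have "(i1 * j2 - j1 * i2) * N = (i1 * mu + j1 * mv) * (i2 * nu + j2 * nv) - (i1 * nu + j1 * nv) * (i2 * mu + j2 * mv)"
    unfolding N_def by algebra
  also have "\<dots> = 1" by (simp flip: 1 2)
  finally have N1: "\<bar>N\<bar> = 1" by (metis abs_zmult_eq_1 abs_1 mult.commute)
  have D1: "?xu * ?yv - ?xv * ?yu = 1"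
    using arg_cong[OF D, of abs] Dpos N1 det by (simp add: abs_mult flip: of_int_abs)
  have T: "abs_pts ?xu ?xv ?yu ?yv = abs_pts a b c d"
    using abs_pts_change_basis[of mu nv nu mv a b c d] N1 by (simp add: N_def \<xi>_def \<eta>_def)
  consider "?xv \<le> 0" "0 \<le> ?yu" | "0 \<le> ?xv" "?yu \<le> 0" using s1 s2 by linarith
  then show ?thesis
  proof cases
    case 1
    then show ?thesis using that[of "- ?xv" ?xu ?yu ?yv] xv yu u(2) D1 T by simp
  next
    case 2
    have "abs_pts ?xu (- ?xv) (- ?yu) ?yv = abs_pts ?xu ?xv ?yu ?yv"
      using abs_pts_change_basis[of 1 "- 1" 0 0 ?xu ?xv ?yu ?yv] abs_pts_reflect(2)[of ?xu "- ?xv" ?yu "- ?yv"]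
      by simp
    then show ?thesis using that[of ?xv ?xu "- ?yu" ?yv] 2 xv yu u(2) D1 T by simp
  qed
qed

text \<open>
Minkowski's bound for boxes.  The reduced basis at the half-width \<open>x\<close> of an empty box has a corner
that dominates the box, and the product of the coordinates of the corner is at most the determinant.
\<close>

lemma kappa_le_one:
  assumes det: "\<bar>a * d - b * c\<bar> = (1::real)"
  shows "kappa (abs_pts a b c d) \<le> 1"
  unfolding kappa_def
proof (rule Sup_least, clarify)
  fix x y assume e: "empty_box (abs_pts a b c d) x y"
  then have x: "0 < x" and y: "0 < y" unfolding empty_box_def by auto
  have "x < p" if "(p, 0) \<in> abs_pts a b c d" for p
    using e that y unfolding empty_box_def by force
  then obtain X1 X2 Y1 Y2 where r: "0 \<le> X2" "X2 \<le> x" "x < X1" "0 \<le> Y1" "Y1 < Y2"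
    "X1 * Y2 + X2 * Y1 = 1" "abs_pts a b c d = abs_pts X1 (- X2) Y1 Y2"
    using reduced_basis_exists[OF det x] by metis
  have "(X2, Y2) \<in> abs_pts a b c d"
    unfolding r(7) by (rule abs_ptsI[of 0 1]) (use r in auto)
  then have "y < Y2" using e r(2) unfolding empty_box_def by force
  then have "x * y \<le> X1 * Y2" using r x y by (intro mult_mono) auto
  also have "\<dots> \<le> 1" using r by (smt (verit) mult_nonneg_nonneg)
  finally show "ereal (x * y) \<le> 1" by simp
qed

text \<open>
Let \<open>r\<close> be the distance from the origin to a primitive lattice point on the horizontal axis.  As the
determinant is 1, the lattice lies on horizontal lines with spacing \<open>1 / r\<close>, so the box with corner
\<open>(r, 1 / r)\<close> is empty inside and attains Minkowski's bound.
\<close>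

lemma kappa_horizontal_axis_point:
  assumes det: "\<bar>a * d - b * c\<bar> = (1::real)" and p: "(p, 0) \<in> abs_pts a b c d"
  shows "kappa (abs_pts a b c d) = 1"
proof (rule antisym)
  show "kappa (abs_pts a b c d) \<le> 1" using kappa_le_one[OF det] .
  obtain m n :: int where mn: "(m, n) \<noteq> (0, 0)" "of_int m * c + of_int n * d = 0"
    using p unfolding abs_pts_def by auto
  \<comment> \<open>Pass to a primitive point of the axis; its distance to the origin is the absolute value of \<open>?x\<close>.\<close>
  define g where "g = gcd m n"
  have "g \<noteq> 0" using mn(1) by (auto simp: g_def)
  obtain m0 n0 where m0: "m = m0 * g" "n = n0 * g" "coprime m0 n0"
    using gcd_coprime_exists[of m n] \<open>g \<noteq> 0\<close> unfolding g_def by auto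
  have "of_int g * (of_int m0 * c + of_int n0 * d) = 0"
    using mn(2) by (simp add: m0 algebra_simps)
  then have v: "of_int m0 * c + of_int n0 * d = 0" using \<open>g \<noteq> 0\<close> by simp
  let ?e = "a * d - b * c" and ?x = "of_int m0 * a + of_int n0 * b"
  have cd: "c * ?x = - of_int n0 * ?e" "d * ?x = of_int m0 * ?e"
    using v by algebra+
  have "?x \<noteq> 0"
  proof
    assume "?x = 0"
    then have "n0 = 0" "m0 = 0" using cd det by auto
    then show False using m0(3) by simp
  qed
  have "ereal (\<bar>?x\<bar> * (1 / \<bar>?x\<bar>)) \<le> kappa (abs_pts a b c d)"
  proof (rule kappa_ge)
    fix p q assume "(p, q) \<in> abs_pts a b c d"
    then obtain m n :: int where kl: "(m, n) \<noteq> (0, 0)" "p = \<bar>of_int m * a + of_int n * b\<bar>"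
      "q = \<bar>of_int m * c + of_int n * d\<bar>" unfolding abs_pts_def by blast
    have "(of_int m * c + of_int n * d) * ?x = of_int m * (c * ?x) + of_int n * (d * ?x)" by algebra
    also have "\<dots> = of_int (n * m0 - m * n0) * ?e" unfolding cd by (simp add: algebra_simps)
    finally have q: "q * \<bar>?x\<bar> = \<bar>of_int (n * m0 - m * n0)\<bar>"
      unfolding kl abs_mult[symmetric] using det by (simp add: abs_mult)
    show "\<bar>?x\<bar> \<le> p \<or> 1 / \<bar>?x\<bar> \<le> q"
    proof (cases "n * m0 = m * n0")
      case False
      then have "1 \<le> \<bar>n * m0 - m * n0\<bar>" by simp
      then have "(1::real) \<le> \<bar>of_int (n * m0 - m * n0)\<bar>" by linarith
      then show ?thesis using q \<open>?x \<noteq> 0\<close> by (simp add: field_simps)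
    next
      case True
      have "m0 dvd m" using True m0(3) by (metis coprime_dvd_mult_left_iff dvd_triv_right)
      then obtain k where k: "m = k * m0" by (metis dvdE mult.commute)
      have "n0 dvd n" using True m0(3) by (metis coprime_dvd_mult_left_iff coprime_commute dvd_triv_right)
      then obtain l where l: "n = l * n0" by (metis dvdE mult.commute)
      have "\<exists>j. m = j * m0 \<and> n = j * n0"
      proof (cases "m0 = 0 \<or> n0 = 0")
        case True
        then show ?thesis using k l by auto
      next
        case False
        then show ?thesis using k l True by auto
      qed
      then obtain j where j: "m = j * m0" "n = j * n0" by blast
      then have "1 \<le> \<bar>j\<bar>" using kl(1) by auto
      then have "1 \<le> \<bar>real_of_int j\<bar>" by linarith
      moreover have "p = \<bar>of_int j\<bar> * \<bar>?x\<bar>" unfolding kl j by (simp flip: abs_mult add: algebra_simps)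
      ultimately show ?thesis by (simp add: mult_right_mono mult_le_cancel_right1)
    qed
  qed (use \<open>?x \<noteq> 0\<close> in auto)
  then show "1 \<le> kappa (abs_pts a b c d)" using \<open>?x \<noteq> 0\<close> by (simp add: one_ereal_def)
qed

lemma kappa_vertical_axis_point:
  assumes det: "\<bar>a * d - b * c\<bar> = (1::real)" and p: "(0, p) \<in> abs_pts a b c d"
  shows "kappa (abs_pts a b c d) = 1"
  using kappa_horizontal_axis_point[of c b d a p] assms abs_pts_swap[of p 0 c d a b] kappa_swap[of c d a b]
  by (simp add: abs_minus_commute mult.commute)

section \<open>The staircase of a lattice\<close>

text \<open>
The staircase of a lattice to the right: \<open>X n\<close> and \<open>Y n\<close> are the absolute coordinates of the
\<open>n\<close>-th point, and \<open>s\<close> lists the multipliers of the Euclidean steps.  Defining \<open>X\<close> by the ratios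
\<open>X (Suc n) / X n\<close>, which are the tails of a continued fraction, makes positivity evident; the
three-term recursion for \<open>X\<close> is then a consequence.  The case \<open>Y 0 = 0\<close> is needed for convergents.
\<close>

locale cf_chain =
  fixes s :: "nat \<Rightarrow> nat" and X Y :: "nat \<Rightarrow> real"
  assumes s1: "\<And>i. s i \<ge> 1"
    and X0: "0 < X 0" and X_Suc: "\<And>n. X (Suc n) = X n * cf (\<lambda>i. s (n + i))"
    and Y0: "0 \<le> Y 0" and Y1: "0 < Y 1"
    and Y_Suc_Suc: "\<And>n. Y (Suc (Suc n)) = Y n + real (s n) * Y (Suc n)"
begin

lemma cf_shift: "cf (\<lambda>i. s (n + i)) = 1 / (real (s n) + cf (\<lambda>i. s (Suc n + i)))"
  "0 < cf (\<lambda>i. s (n + i))" "cf (\<lambda>i. s (n + i)) < 1"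
  using cf_rec[of "\<lambda>i. s (n + i)"] s1 by auto

lemma X_pos: "0 < X n"
  by (induction n) (simp_all only: X0 X_Suc mult_pos_pos cf_shift(2))

lemma X_less: "X (Suc n) < X n"
  unfolding X_Suc using X_pos cf_shift(3) by simp

lemma X_Suc_Suc: "X (Suc (Suc n)) = X n - real (s n) * X (Suc n)"
proof -
  let ?u = "cf (\<lambda>i. s (n + i))" and ?v = "cf (\<lambda>i. s (Suc n + i))"
  have "?u * (real (s n) + ?v) = 1"
    using cf_shift(1)[of n] cf_shift(2)[of n] by (metis divide_eq_0_iff less_irrefl nonzero_eq_divide_eq)
  then have "X n * ?u * ?v = X n - real (s n) * (X n * ?u)" by algebra
  then show ?thesis unfolding X_Suc .
qed

lemma Y_nonneg: "0 \<le> Y n \<and> 0 < Y (Suc n)"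
proof (induction n)
  case (Suc n)
  have "0 < real (s n) * Y (Suc n)" using Suc s1[of n] by (intro mult_pos_pos) auto
  with Suc show ?case unfolding Y_Suc_Suc by linarith
qed (use Y0 Y1 in simp)

lemma ratio_Suc: "Y (Suc n) / Y (Suc (Suc n)) = 1 / (real (s n) + Y n / Y (Suc n))"
  unfolding Y_Suc_Suc using Y_nonneg[of n] by (simp add: field_simps)

lemma det_eq: "X n * Y (Suc n) + X (Suc n) * Y n = X 0 * Y 1 + X 1 * Y 0"
proof (induction n)
  case (Suc n)
  have "X (Suc n) * Y (Suc (Suc n)) + X (Suc (Suc n)) * Y (Suc n) = X n * Y (Suc n) + X (Suc n) * Y n"
    unfolding Y_Suc_Suc X_Suc_Suc by algebra
  with Suc show ?case by simp
qed simp

lemma abs_pts_eq: "abs_pts (X n) (- X (Suc n)) (Y n) (Y (Suc n)) = abs_pts (X 0) (- X 1) (Y 0) (Y 1)"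
proof (induction n)
  case (Suc n)
  show ?case
    unfolding Y_Suc_Suc X_Suc_Suc Suc[symmetric]
    using abs_pts_step[of "X (Suc n)" "X n" "int (s n)" "Y (Suc n)" "Y n"] by simp
qed simp

lemma X_half: "X (Suc (Suc n)) \<le> X n / 2"
proof -
  have "1 * X (Suc n) \<le> real (s n) * X (Suc n)"
    using s1[of n] X_pos[of "Suc n"] by (intro mult_right_mono) auto
  then show ?thesis using X_Suc_Suc[of n] X_less[of "Suc n"] by linarith
qed

lemma X_antimono: "m \<le> n \<Longrightarrow> X n \<le> X m"
  by (rule lift_Suc_antimono_le[of X]) (rule less_imp_le[OF X_less])

lemma X_tendsto_0: "X \<longlonglongrightarrow> 0"
proof -
  have pow: "X (2 * n) \<le> X 0 * (1/2) ^ n" for n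
  proof (induction n)
    case (Suc n)
    then show ?case using X_half[of "2 * n"] by simp
  qed simp
  show ?thesis
  proof (rule LIMSEQ_I)
    fix e :: real assume "0 < e"
    then obtain n where "(1/2::real) ^ n < e / X 0"
      using real_arch_pow_inv[of "e / X 0" "1/2"] X0 by auto
    then have "X 0 * (1/2) ^ n < e" using X0 by (simp only: pos_less_divide_eq mult.commute)
    then have "X (2 * n) < e" using pow[of n] by linarith
    then have "\<bar>X k\<bar> < e" if "k \<ge> 2 * n" for k
      using X_antimono[OF that] X_pos[of k] by simp
    then show "\<exists>no. \<forall>n\<ge>no. norm (X n - 0) < e" by auto
  qed
qed

lemma point: "(X n, Y n) \<in> abs_pts (X 0) (- X 1) (Y 0) (Y 1)"
  unfolding abs_pts_eq[of n, symmetric]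
  by (rule abs_ptsI[of 1 0]) (use X_pos[of n] Y_nonneg[of n] in auto)

lemma point_large:
  assumes "(p, q) \<in> abs_pts (X 0) (- X 1) (Y 0) (Y 1)"
  shows "X n \<le> p \<or> Y (Suc n) \<le> q"
  using abs_pts_reduced[of "X n" "X (Suc n)" "Y n" "Y (Suc n)" p q]
    X_pos[of n] X_pos[of "Suc n"] Y_nonneg[of n] assms abs_pts_eq[of n] by simp

text \<open>
Division of the invariant \<open>X n * Y (Suc n) + X (Suc n) * Y n = 1\<close> by the corner product.
\<close>

lemma corner_value:
  assumes "X 0 * Y 1 + X 1 * Y 0 = 1"
  shows "X n * Y (Suc n) = 1 / (1 + cf (\<lambda>i. s (n + i)) * (Y n / Y (Suc n)))"
proof -
  have Y: "0 < Y (Suc n)" and X: "0 < X n" using Y_nonneg X_pos by auto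
  have "X n * Y (Suc n) * (1 + cf (\<lambda>i. s (n + i)) * (Y n / Y (Suc n)))
      = X n * Y (Suc n) + X (Suc n) * Y n"
    unfolding X_Suc using Y by (simp add: field_simps)
  also have "\<dots> = 1" using det_eq assms by simp
  finally have "X n * Y (Suc n) * (1 + cf (\<lambda>i. s (n + i)) * (Y n / Y (Suc n))) = 1" .
  then show ?thesis by (metis mult_zero_right nonzero_eq_divide_eq zero_neq_one)
qed

end

lemma cf_chain_exists:
  fixes s :: "nat \<Rightarrow> nat"
  assumes "\<And>i. s i \<ge> 1" "0 < x0" "0 \<le> y0" "0 < (y1 :: real)"
  obtains X Y where "cf_chain s X Y" "X 0 = x0" "X 1 = x0 * cf s" "Y 0 = y0" "Y 1 = y1"
proof -
  define X where "X = rec_nat x0 (\<lambda>n x. x * cf (\<lambda>i. s (n + i)))"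
  define Z where "Z = rec_nat (y0, y1) (\<lambda>n (u, v). (v, u + real (s n) * v))"
  define Y where "Y = (\<lambda>n. fst (Z n))"
  have X: "X 0 = x0" "X (Suc n) = X n * cf (\<lambda>i. s (n + i))" for n by (simp_all add: X_def)
  have Z: "Z 0 = (y0, y1)" "Z (Suc n) = (snd (Z n), fst (Z n) + real (s n) * snd (Z n))" for n
    by (simp_all add: Z_def case_prod_unfold)
  have Y: "Y 0 = y0" "Y (Suc 0) = y1" "Y (Suc (Suc n)) = Y n + real (s n) * Y (Suc n)" for n
    by (simp_all add: Y_def Z)
  show ?thesis
  proof (rule that[of X Y])
    show "cf_chain s X Y" by unfold_locales (use assms X Y in auto)
    show "X 1 = x0 * cf s" using X(2)[of 0] X(1) by simp
  qed (use X Y in auto)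
qed

lemma corner_eq_perron_value:
  assumes a: "\<And>i. a i \<ge> (1::nat)" and chain: "cf_chain (\<lambda>n. a (int n)) X Y"
    and Y: "Y 0 = Y 1 * cf (\<lambda>i. a (- 1 - int i))" and det: "X 0 * Y 1 + X 1 * Y 0 = 1"
  shows "X n * Y (Suc n) = perron_value a (int n)"
proof -
  interpret cf_chain "\<lambda>n. a (int n)" X Y by (fact chain)
  have ratio: "Y n / Y (Suc n) = cf (\<lambda>i. a (int n - 1 - int i))" for n
  proof (induction n)
    case 0 then show ?case using Y Y1 by simp
  next
    case (Suc n)
    have "Y (Suc n) / Y (Suc (Suc n)) = 1 / (real (a (int n)) + Y n / Y (Suc n))"
      by (rule ratio_Suc)
    also have "\<dots> = cf (\<lambda>i. a (int n - int i))"
      unfolding Suc using cf_rec(1)[of "\<lambda>i. a (int n - int i)"] a by (simp add: algebra_simps)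
    finally show ?case by simp
  qed
  show ?thesis unfolding corner_value[OF det] perron_value_def ratio by simp
qed

text \<open>
The right half of the staircase.  If an empty box is narrower than the starting point, then the
staircase passes its half-width at some step from \<open>X n\<close> to \<open>X (Suc n)\<close>; the box does not contain the
point \<open>(X (Suc n), Y (Suc n))\<close> and hence lies below the corner \<open>(X n, Y (Suc n))\<close>.
\<close>

lemma kappa_right_half:
  assumes a: "\<And>i. a i \<ge> (1::nat)" and pos: "0 < X1" "0 < Y2"
    and X2_eq: "X2 = X1 * cf (\<lambda>i. a (int i))" and Y1_eq: "Y1 = Y2 * cf (\<lambda>i. a (- 1 - int i))"
    and det: "X1 * Y2 + X2 * Y1 = 1"
  shows "ereal (perron_value a (int n)) \<le> kappa (abs_pts X1 (- X2) Y1 Y2)"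
    and "empty_box (abs_pts X1 (- X2) Y1 Y2) x y \<Longrightarrow> x < X1 \<Longrightarrow> \<exists>n. x * y < perron_value a (int n)"
proof -
  have "0 < cf (\<lambda>i. a (- 1 - int i))" using cf_rec(2)[of "\<lambda>i. a (- 1 - int i)"] a by simp
  then have "0 \<le> Y1" unfolding Y1_eq using pos by simp
  then obtain X Y where chain: "cf_chain (\<lambda>n. a (int n)) X Y"
    and eqs: "X 0 = X1" "X 1 = X1 * cf (\<lambda>n. a (int n))" "Y 0 = Y1" "Y 1 = Y2"
    using cf_chain_exists[of "\<lambda>n. a (int n)" X1 Y1 Y2] a pos by blast
  interpret cf_chain "\<lambda>n. a (int n)" X Y by (fact chain)
  have T: "abs_pts X1 (- X2) Y1 Y2 = abs_pts (X 0) (- X 1) (Y 0) (Y 1)" unfolding eqs X2_eq ..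
  have "Y 0 = Y 1 * cf (\<lambda>i. a (- 1 - int i))" "X 0 * Y 1 + X 1 * Y 0 = 1"
    unfolding eqs using Y1_eq det unfolding X2_eq by blast+
  then have corner: "X n * Y (Suc n) = perron_value a (int n)" for n
    using corner_eq_perron_value[of a X Y n] a chain by blast
  show "ereal (perron_value a (int n)) \<le> kappa (abs_pts X1 (- X2) Y1 Y2)"
    unfolding corner[symmetric] T
    using kappa_ge[of "X n" "Y (Suc n)"] X_pos Y_nonneg point_large by blast
  assume e: "empty_box (abs_pts X1 (- X2) Y1 Y2) x y" and x: "x < X1"
  then have xy: "0 < x" "0 < y" unfolding empty_box_def by auto
  have "\<exists>n. X (Suc n) \<le> x"
  proof -
    have "\<forall>\<^sub>F n in sequentially. X (Suc n) < x"
      using LIMSEQ_Suc[OF X_tendsto_0] xy(1) by (rule order_tendstoD(2))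
    then show ?thesis by (meson eventually_happens sequentially_bot less_imp_le)
  qed
  define n where "n = (LEAST n. X (Suc n) \<le> x)"
  have n: "X (Suc n) \<le> x" unfolding n_def by (rule LeastI_ex) fact
  have "x < X n"
  proof (cases n)
    case 0 then show ?thesis using x eqs by simp
  next
    case (Suc k)
    then show ?thesis using not_less_Least[of k "\<lambda>n. X (Suc n) \<le> x"] by (auto simp: n_def)
  qed
  moreover have "y < Y (Suc n)"
    using e point[of "Suc n"] n unfolding T empty_box_def by force
  ultimately have "x * y < X n * Y (Suc n)" using xy by (intro mult_strict_mono) auto
  then show "\<exists>n. x * y < perron_value a (int n)" unfolding corner by blast
qed

text \<open>
A box that is at least as wide as the starting point \<open>(X1, Y1)\<close> is lower than this point, and
hence narrow after the two axes are exchanged; such boxes are covered by the left half of the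
staircase, which is the right half for the reversed sequence.
\<close>

lemma kappa_eq_SUP:
  assumes a: "\<And>i. a i \<ge> (1::nat)" and pos: "0 < X1" "0 < Y2"
    and X2: "X2 = X1 * cf (\<lambda>i. a (int i))" and Y1: "Y1 = Y2 * cf (\<lambda>i. a (- 1 - int i))"
    and det: "X1 * Y2 + X2 * Y1 = 1"
  shows "kappa (abs_pts X1 (- X2) Y1 Y2) = (SUP k. ereal (perron_value a k))"
proof -
  let ?T = "abs_pts X1 (- X2) Y1 Y2" and ?T' = "abs_pts Y2 (- Y1) X2 X1"
  let ?a' = "\<lambda>i. a (- 1 - i)"
  have X2': "X2 = X1 * cf (\<lambda>i. ?a' (- 1 - int i))" using X2 by simp
  have det': "Y2 * X1 + Y1 * X2 = 1" using det by (simp only: mult.commute)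
  note mirror = kappa_right_half[of ?a' Y2 X1 Y1 X2, OF a pos(2,1) Y1 X2' det']
  note half = kappa_right_half[of a X1 Y2 X2 Y1, OF a pos X2 Y1 det]
  have box: "empty_box ?T' y x \<longleftrightarrow> empty_box ?T x y" for x y
    unfolding empty_box_def using abs_pts_mirror[of _ _ Y2 Y1 X2 X1] by blast
  have "{ereal (x * y) | x y. empty_box ?T' x y} = {ereal (x * y) | x y. empty_box ?T x y}"
    unfolding box[symmetric] by (intro Collect_cong) (metis mult.commute)
  then have kappa': "kappa ?T' = kappa ?T" unfolding kappa_def by simp
  show ?thesis
  proof (rule antisym)
    show "kappa ?T \<le> (SUP k. ereal (perron_value a k))"
      unfolding kappa_def
    proof (rule Sup_least, clarify)
      fix x y assume e: "empty_box ?T x y"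
      have "\<exists>k. x * y < perron_value a k"
      proof (cases "x < X1")
        case True
        then show ?thesis using half(2)[OF e] by blast
      next
        case False
        have "0 < cf (\<lambda>i. a (- 1 - int i))" "cf (\<lambda>i. a (- 1 - int i)) < 1"
          using cf_rec(2,3)[of "\<lambda>i. a (- 1 - int i)"] a by auto
        then have Y: "0 \<le> Y1" "Y1 < Y2" unfolding Y1 using pos by auto
        have "(X1, Y1) \<in> ?T" by (rule abs_ptsI[of 1 0]) (use pos Y in auto)
        then have "y < Y1" using e False unfolding empty_box_def by force
        then have "\<exists>n. y * x < perron_value ?a' (int n)" using mirror(2)[of y x] e Y box by simp
        then show ?thesis unfolding perron_value_reverse by (auto simp: mult.commute)
      qed
      then obtain k where "x * y < perron_value a k" by blast
      then show "ereal (x * y) \<le> (SUP k. ereal (perron_value a k))" by (intro SUP_upper2[of k]) auto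
    qed
    show "(SUP k. ereal (perron_value a k)) \<le> kappa ?T"
    proof (rule SUP_least)
      fix k
      show "ereal (perron_value a k) \<le> kappa ?T"
      proof (cases "0 \<le> k")
        case True then show ?thesis using half(1)[of "nat k"] by simp
      next
        case False
        then show ?thesis using mirror(1)[of "nat (- k)"] unfolding perron_value_reverse kappa' by simp
      qed
    qed
  qed
qed

section \<open>The Mordell-Gruber spectrum\<close>

text \<open>
The common description of the Mordell-Gruber spectrum and of the Perron spectrum of suprema; the
value 1 is contributed by lattices with points on an axis and by terminating sequences.
\<close>

definition perron_sups :: "real set" where
  "perron_sups = insert 1 {m. \<exists>a :: int \<Rightarrow> nat. (\<forall>i. a i \<ge> 1) \<and> (SUP k. ereal (perron_value a k)) = ereal m}"

text \<open>
If \<open>X2 / X1\<close> or \<open>Y1 / Y2\<close> were rational, a suitable integer combination of the reduced basis would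
lie on a coordinate axis.
\<close>

lemma mordell_gruber_spectrum_eq: "mordell_gruber_spectrum = perron_sups"
proof (intro equalityI subsetI)
  fix m assume "m \<in> mordell_gruber_spectrum"
  then obtain A B :: "real^2" where det: "\<bar>det (vector [A, B] :: real^2^2)\<bar> = 1"
    and m: "mordell_gruber_const {of_int m *\<^sub>R A + of_int n *\<^sub>R B | m n :: int. True} = ereal m"
    unfolding mordell_gruber_spectrum_def unimodular_lattice_def by blast
  let ?T = "abs_pts (A $ 1) (B $ 1) (A $ 2) (B $ 2)"
  have kappa: "kappa ?T = ereal m" using m unfolding mordell_gruber_const_eq_kappa[OF det] .
  have det': "\<bar>A $ 1 * B $ 2 - B $ 1 * A $ 2\<bar> = 1"
    using det by (simp add: det_vector_2 mult.commute)
  show "m \<in> perron_sups"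
  proof (cases "\<exists>p. (p, 0) \<in> ?T \<or> (0, p) \<in> ?T")
    case True
    then have "kappa ?T = 1" using kappa_horizontal_axis_point[OF det'] kappa_vertical_axis_point[OF det'] by blast
    then have "m = 1" using kappa by simp
    then show ?thesis unfolding perron_sups_def by simp
  next
    case False
    then obtain X1 X2 Y1 Y2 where r: "0 \<le> X2" "X2 \<le> 1" "1 < X1" "0 \<le> Y1" "Y1 < Y2"
      "X1 * Y2 + X2 * Y1 = 1" "?T = abs_pts X1 (- X2) Y1 Y2"
      using reduced_basis_exists[OF det', of 1] by (metis zero_less_one)
    have X: "X2 / X1 \<notin> \<rat>"
    proof
      assume "X2 / X1 \<in> \<rat>"
      then obtain i j :: int where ij: "j > 0" "X2 / X1 = of_int i / of_int j"
        by (metis Rats_cases')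
      have "(0, \<bar>of_int i * Y1 + of_int j * Y2\<bar>) \<in> abs_pts X1 (- X2) Y1 Y2"
        by (rule abs_ptsI[of i j]) (use ij r(3) in \<open>auto simp: field_simps\<close>)
      then show False using False r(7) by auto
    qed
    have Y: "Y1 / Y2 \<notin> \<rat>"
    proof
      assume "Y1 / Y2 \<in> \<rat>"
      then obtain i j :: int where ij: "j > 0" "Y1 / Y2 = of_int i / of_int j"
        by (metis Rats_cases')
      have "(\<bar>of_int j * X1 + of_int (- i) * (- X2)\<bar>, 0) \<in> abs_pts X1 (- X2) Y1 Y2"
        by (rule abs_ptsI[of j "- i"]) (use ij r(4,5) in \<open>auto simp: field_simps\<close>)
      then show False using False r(7) by auto
    qed
    have "X2 \<noteq> 0" "Y1 \<noteq> 0" using X Y by auto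
    obtain s where s: "\<And>i. s i \<ge> (1::nat)" "cf s = X2 / X1"
      using irrational_eq_cf[OF X] r \<open>X2 \<noteq> 0\<close> by auto
    obtain t where t: "\<And>i. t i \<ge> (1::nat)" "cf t = Y1 / Y2"
      using irrational_eq_cf[OF Y] r \<open>Y1 \<noteq> 0\<close> by auto
    define a where "a = (\<lambda>i::int. if i \<ge> 0 then s (nat i) else t (nat (- 1 - i)))"
    have "kappa (abs_pts X1 (- X2) Y1 Y2) = (SUP k. ereal (perron_value a k))"
    proof (rule kappa_eq_SUP)
      show "X2 = X1 * cf (\<lambda>i. a (int i))" "Y1 = Y2 * cf (\<lambda>i. a (- 1 - int i))"
        using s t r by (simp_all add: a_def)
    qed (use r s t in \<open>auto simp: a_def\<close>)
    then have "(SUP k. ereal (perron_value a k)) = ereal m" using kappa r(7) by simp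
    moreover have "\<forall>i. a i \<ge> 1" using s t by (simp add: a_def)
    ultimately show ?thesis unfolding perron_sups_def by blast
  qed
next
  fix m assume "m \<in> perron_sups"
  then consider "m = 1" | a :: "int \<Rightarrow> nat" where "\<And>i. a i \<ge> 1" "(SUP k. ereal (perron_value a k)) = ereal m"
    unfolding perron_sups_def by blast
  then have "\<exists>A B :: real^2. \<bar>det (vector [A, B] :: real^2^2)\<bar> = 1
      \<and> kappa (abs_pts (A $ 1) (B $ 1) (A $ 2) (B $ 2)) = ereal m"
  proof cases
    case 1
    have "(1, 0) \<in> abs_pts 1 0 0 1" by (rule abs_ptsI[of 1 0]) auto
    then have "kappa (abs_pts 1 0 0 1) = 1" by (intro kappa_horizontal_axis_point) auto
    then show ?thesis using 1
      by (intro exI[of _ "vector [1, 0]"] exI[of _ "vector [0, 1]"]) (simp add: det_vector_2)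
  next
    case 2
    let ?\<alpha> = "cf (\<lambda>i. a (int i))" and ?\<beta> = "cf (\<lambda>i. a (- 1 - int i))"
    have pos: "0 < ?\<alpha>" "0 < ?\<beta>" using cf_rec(2) 2 by auto
    \<comment> \<open>The scaling that makes the lattice with the prescribed ratios unimodular.\<close>
    define w where "w = 1 / sqrt (1 + ?\<alpha> * ?\<beta>)"
    have "0 < 1 + ?\<alpha> * ?\<beta>" using pos by (simp add: add_pos_pos)
    then have w: "0 < w" "w * w * (1 + ?\<alpha> * ?\<beta>) = 1"
      unfolding w_def by (simp_all add: real_sqrt_mult_self)
    have det: "w * w + (w * ?\<alpha>) * (w * ?\<beta>) = 1" using w(2) by algebra
    have "kappa (abs_pts w (- (w * ?\<alpha>)) (w * ?\<beta>) w) = ereal m"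
      using kappa_eq_SUP[of a w w "w * ?\<alpha>" "w * ?\<beta>"] 2 w(1) det by simp
    then show ?thesis using det
      by (intro exI[of _ "vector [w, w * ?\<beta>]"] exI[of _ "vector [- (w * ?\<alpha>), w]"])
        (simp add: det_vector_2 algebra_simps)
  qed
  then obtain A B :: "real^2" where "\<bar>det (vector [A, B] :: real^2^2)\<bar> = 1"
      "kappa (abs_pts (A $ 1) (B $ 1) (A $ 2) (B $ 2)) = ereal m" by blast
  then show "m \<in> mordell_gruber_spectrum"
    unfolding mordell_gruber_spectrum_def unimodular_lattice_def
    using mordell_gruber_const_eq_kappa[of A B] by auto
qed

lemma perron_halfD:
  assumes "perron_half s"
  shows "s 0 \<noteq> None" "s (Suc i) \<noteq> None \<Longrightarrow> s i \<noteq> None" "s i = Some (enat m) \<Longrightarrow> s (Suc i) \<noteq> None"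
    "s i = Some e \<Longrightarrow> e \<ge> 1"
proof -
  consider (fin) "\<And>i. \<exists>m\<ge>1. s i = Some (enat m)"
    | (inf) N where "\<And>i. i < N \<Longrightarrow> \<exists>m\<ge>1. s i = Some (enat m)" "s N = Some \<infinity>" "\<And>i. i > N \<Longrightarrow> s i = None"
    using assms unfolding perron_half_def by metis
  then have "s 0 \<noteq> None \<and> (s (Suc i) \<noteq> None \<longrightarrow> s i \<noteq> None) \<and>
      (s i = Some (enat m) \<longrightarrow> s (Suc i) \<noteq> None) \<and> (s i = Some e \<longrightarrow> e \<ge> 1)"
  proof cases
    case fin
    obtain m' where "s i = Some (enat m')" "m' \<ge> 1" using fin by blast
    then show ?thesis using fin[of 0] fin[of "Suc i"] by (auto simp: one_enat_def)
  next
    case inf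
    have "s j \<noteq> None \<longleftrightarrow> j \<le> N" for j using inf(1)[of j] inf(2) inf(3)[of j]
      by (cases j N rule: linorder_cases) auto
    moreover have "s i = Some (enat m) \<Longrightarrow> i < N" using inf(2) inf(3)[of i]
      by (cases i N rule: linorder_cases) auto
    moreover have "s i = Some e \<Longrightarrow> e \<ge> 1" using inf(1)[of i] inf(2) inf(3)[of i]
      by (cases i N rule: linorder_cases) (auto simp: one_enat_def)
    ultimately show ?thesis by auto
  qed
  then show "s 0 \<noteq> None" "s (Suc i) \<noteq> None \<Longrightarrow> s i \<noteq> None"
    "s i = Some (enat m) \<Longrightarrow> s (Suc i) \<noteq> None" "s i = Some e \<Longrightarrow> e \<ge> 1" by auto
qed

lemma perron_seq_reverse: "perron_seq a \<Longrightarrow> perron_seq (\<lambda>i. a (- 1 - i))"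
  unfolding perron_seq_def by simp

text \<open>
To the right of a defined position all terms are defined and at least 1 up to the first
infinite one, also when the position is negative: terms towards the origin are always defined.
\<close>

lemma perron_seq_right_in_unit:
  assumes a: "perron_seq a" and k: "a k \<noteq> None"
  shows "cfrac (\<lambda>i. the (a (k + int i))) \<in> {0..1}"
proof (rule cfrac_in_unit)
  note half = a[unfolded perron_seq_def]
  have ge1: "e \<ge> 1" if "a p = Some e" for p e
  proof (cases "p \<ge> 0")
    case True
    then show ?thesis using perron_halfD(4)[OF half[THEN conjunct1], of "nat p" e] that by simp
  next
    case False
    then show ?thesis using perron_halfD(4)[OF half[THEN conjunct2], of "nat (- 1 - p)" e] that by simp
  qed
  have succ: "a (p + 1) \<noteq> None" if "a p = Some (enat m)" for p m
  proof -
    consider "p \<ge> 0" | "p = -1" | "p < -1" by linarith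
    then show ?thesis
    proof cases
      case 1
      define j where "j = nat p"
      have p: "int j = p" "int (Suc j) = p + 1" using 1 by (auto simp: j_def)
      show ?thesis using that perron_halfD(3)[OF half[THEN conjunct1], of j m] unfolding p by simp
    next
      case 2 then show ?thesis using perron_halfD(1)[OF half[THEN conjunct1]] by simp
    next
      case 3
      define j where "j = nat (- 2 - p)"
      have p: "- 1 - int j = p + 1" "- 1 - int (Suc j) = p" using 3 by (auto simp: j_def)
      show ?thesis using that perron_halfD(2)[OF half[THEN conjunct2], of j] unfolding p by simp
    qed
  qed
  have def: "a (k + int i) \<noteq> None" if "\<And>j. j < i \<Longrightarrow> the (a (k + int j)) \<noteq> \<infinity>" for i
    using that
  proof (induction i)
    case (Suc i)
    have "a (k + int i) \<noteq> None" using Suc by auto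
    then obtain e where e: "a (k + int i) = Some e" by auto
    with Suc.prems[of i] obtain m where "e = enat m" by (cases e) auto
    with succ[of "k + int i" m] e show ?case by (simp add: algebra_simps)
  qed (use k in simp)
  fix i assume "\<And>j. j < i \<Longrightarrow> the (a (k + int j)) \<noteq> \<infinity>"
  then have "a (k + int i) \<noteq> None" by (rule def)
  then show "1 \<le> the (a (k + int i))" using ge1 by auto
qed

lemma perron_seq_alpha_beta:
  assumes a: "perron_seq a" and k: "k \<in> perron_dom a"
  shows "alpha a (k - 1) \<in> {0..1}" "beta a k \<in> {0..1}"
proof -
  have d: "a k \<noteq> None" "a (k - 1) \<noteq> None" using k unfolding perron_dom_def by auto
  show "alpha a (k - 1) \<in> {0..1}" using perron_seq_right_in_unit[OF a d(1)] by (simp add: alpha_def)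
  have shift: "- 1 - (- k + int i) = k - 1 - int i" for i by simp
  have "a (- 1 - - k) \<noteq> None" using d(2) by simp
  then show "beta a k \<in> {0..1}"
    using perron_seq_right_in_unit[OF perron_seq_reverse[OF a], of "- k"] unfolding shift beta_def by blast
qed

text \<open>
Next to an infinite term there is a position at which \<open>\<alpha>\<close> or \<open>\<beta>\<close> vanishes, and the formula takes its
maximal value 1 there.
\<close>

lemma SUP_perron_terminating:
  fixes f :: "real \<times> real \<Rightarrow> real"
  assumes f: "\<And>\<alpha> \<beta>. \<alpha> \<in> {0..1} \<Longrightarrow> \<beta> \<in> {0..1} \<Longrightarrow> f (\<alpha>, \<beta>) = 1 / (1 + \<alpha> * \<beta>)"
    and a: "perron_seq a" and inf: "a p = Some \<infinity>"
  shows "(SUP k\<in>perron_dom a. ereal (perron f a k)) = 1"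
proof (rule antisym)
  have val: "perron f a k = 1 / (1 + alpha a (k - 1) * beta a k)" if "k \<in> perron_dom a" for k
    unfolding perron_def using f perron_seq_alpha_beta[OF a that] by blast
  show "(SUP k\<in>perron_dom a. ereal (perron f a k)) \<le> 1"
  proof (rule SUP_least)
    fix k assume k: "k \<in> perron_dom a"
    then have "0 \<le> alpha a (k - 1) * beta a k" using perron_seq_alpha_beta[OF a k] by simp
    then show "ereal (perron f a k) \<le> 1" unfolding val[OF k] by simp
  qed
  note half = a[unfolded perron_seq_def]
  have "\<exists>k\<in>perron_dom a. alpha a (k - 1) = 0 \<or> beta a k = 0"
  proof (cases "p \<ge> 0")
    case True
    have "a (p - 1) \<noteq> None"
    proof (cases "p = 0")
      case True
      then show ?thesis using perron_halfD(1)[OF half[THEN conjunct2]] by simp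
    next
      case False
      define j where "j = nat (p - 1)"
      have p: "int j = p - 1" "int (Suc j) = p" using False \<open>p \<ge> 0\<close> by (auto simp: j_def)
      show ?thesis using inf perron_halfD(2)[OF half[THEN conjunct1], of j] unfolding p by simp
    qed
    then have "p \<in> perron_dom a" using inf unfolding perron_dom_def by auto
    moreover have "alpha a (p - 1) = 0" unfolding alpha_def by (rule cfrac_infinity_first) (simp add: inf)
    ultimately show ?thesis by blast
  next
    case False
    have "a (p + 1) \<noteq> None"
    proof (cases "p = -1")
      case True
      then show ?thesis using perron_halfD(1)[OF half[THEN conjunct1]] by simp
    next
      case F: False
      define j where "j = nat (- 2 - p)"
      have p: "- 1 - int j = p + 1" "- 1 - int (Suc j) = p" using F False by (auto simp: j_def)
      show ?thesis using inf perron_halfD(2)[OF half[THEN conjunct2], of j] unfolding p by simp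
    qed
    then have "p + 1 \<in> perron_dom a" using inf unfolding perron_dom_def by auto
    moreover have "beta a (p + 1) = 0" unfolding beta_def by (rule cfrac_infinity_first) (simp add: inf)
    ultimately show ?thesis by blast
  qed
  then obtain k where k: "k \<in> perron_dom a" "alpha a (k - 1) = 0 \<or> beta a k = 0" by blast
  then have "perron f a k = 1" using val by auto
  then show "1 \<le> (SUP k\<in>perron_dom a. ereal (perron f a k))"
    using k(1) by (intro SUP_upper2[of k]) (auto simp: one_ereal_def)
qed

lemma perron_eq_perron_value:
  fixes f :: "real \<times> real \<Rightarrow> real"
  assumes f: "\<And>\<alpha> \<beta>. \<alpha> \<in> {0..1} \<Longrightarrow> \<beta> \<in> {0..1} \<Longrightarrow> f (\<alpha>, \<beta>) = 1 / (1 + \<alpha> * \<beta>)"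
    and b: "\<And>i. b i \<ge> (1::nat)"
  shows "perron f (\<lambda>i. Some (enat (b i))) k = perron_value b k"
  using f[OF cf_in_unit[of "\<lambda>i. b (k + int i)"] cf_in_unit[of "\<lambda>i. b (k - 1 - int i)"]] b
  unfolding perron_def alpha_def beta_def perron_value_def cf_def by simp

lemma sigma_sup_eq:
  fixes f :: "real \<times> real \<Rightarrow> real"
  assumes f: "\<And>\<alpha> \<beta>. \<alpha> \<in> {0..1} \<Longrightarrow> \<beta> \<in> {0..1} \<Longrightarrow> f (\<alpha>, \<beta>) = 1 / (1 + \<alpha> * \<beta>)"
  shows "sigma_sup f = perron_sups"
proof (intro equalityI subsetI)
  fix m assume "m \<in> sigma_sup f"
  then obtain a where a: "perron_seq a" and m: "(SUP k\<in>perron_dom a. ereal (perron f a k)) = ereal m"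
    unfolding sigma_sup_def by blast
  show "m \<in> perron_sups"
  proof (cases "\<exists>p. a p = Some \<infinity>")
    case True
    then have "m = 1" using SUP_perron_terminating[OF f a] m by auto
    then show ?thesis unfolding perron_sups_def by simp
  next
    case False
    then have fin: "\<exists>m\<ge>1. a (int i) = Some (enat m)" "\<exists>m\<ge>1. a (- 1 - int i) = Some (enat m)" for i
      using a unfolding perron_seq_def perron_half_def by auto
    have "\<exists>m. m \<ge> 1 \<and> a p = Some (enat m)" for p
      using fin(1)[of "nat p"] fin(2)[of "nat (- 1 - p)"] by (cases "p \<ge> 0") auto
    then obtain b where b: "\<And>p. b p \<ge> 1" "\<And>p. a p = Some (enat (b p))" by metis
    have "a = (\<lambda>i. Some (enat (b i)))" using b(2) by blast
    then have "perron f a k = perron_value b k" for k using perron_eq_perron_value[of f b k] f b(1) by simp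
    moreover have "perron_dom a = UNIV" using b(2) by (auto simp: perron_dom_def)
    ultimately have "(SUP k. ereal (perron_value b k)) = ereal m" using m by simp
    then show ?thesis using b(1) unfolding perron_sups_def by blast
  qed
next
  fix m assume "m \<in> perron_sups"
  then consider "m = 1" | b :: "int \<Rightarrow> nat" where "\<And>i. b i \<ge> 1" "(SUP k. ereal (perron_value b k)) = ereal m"
    unfolding perron_sups_def by blast
  then show "m \<in> sigma_sup f"
  proof cases
    case 1
    let ?a = "\<lambda>i::int. if i = 0 \<or> i = - 1 then Some \<infinity> else None :: enat option"
    have "perron_seq ?a" unfolding perron_seq_def perron_half_def by auto
    then have "perron_seq ?a \<and> (SUP k\<in>perron_dom ?a. ereal (perron f ?a k)) = ereal m"
      using SUP_perron_terminating[OF f, of ?a 0] 1 by (simp add: one_ereal_def)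
    then show ?thesis unfolding sigma_sup_def by blast
  next
    case 2
    let ?a = "\<lambda>i. Some (enat (b i))"
    have "perron_seq ?a" unfolding perron_seq_def perron_half_def using 2(1) by auto
    moreover have "perron_dom ?a = UNIV" by (auto simp: perron_dom_def)
    moreover have "perron f ?a k = perron_value b k" for k using perron_eq_perron_value[of f b k] f 2(1) by simp
    ultimately have "perron_seq ?a \<and> (SUP k\<in>perron_dom ?a. ereal (perron f ?a k)) = ereal m"
      using 2(2) by simp
    then show ?thesis unfolding sigma_sup_def by blast
  qed
qed

section \<open>The Dirichlet spectrum\<close>

text \<open>
The common description of the Dirichlet spectrum and of the Perron spectrum of limits superior.
\<close>

definition perron_limsups :: "real set" where
  "perron_limsups = {m. \<exists>a :: int \<Rightarrow> nat. (\<forall>i. a i \<ge> 1) \<and> limsup_is sequentially (\<lambda>n. perron_value a (int n)) m}"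

text \<open>
In one direction, the larger of the two one-sided limits superior is moved to the right by
reversing the sequence.  In the other direction, the right half is reflected, which makes both
one-sided limits superior equal.
\<close>

lemma sigma_limsup'_eq:
  fixes f :: "real \<times> real \<Rightarrow> real"
  assumes f: "\<And>\<alpha> \<beta>. \<alpha> \<in> {0..1} \<Longrightarrow> \<beta> \<in> {0..1} \<Longrightarrow> f (\<alpha>, \<beta>) = 1 / (1 + \<alpha> * \<beta>)"
  shows "sigma_limsup' f = perron_limsups"
proof -
  have val: "Limsup (filtercomap abs at_top) (\<lambda>k::int. ereal (perron f (\<lambda>i. Some (enat (a i))) k)) = ereal m
      \<longleftrightarrow> limsup_is (filtercomap abs at_top) (perron_value a) m" if "\<forall>i. a i \<ge> 1" for a m
    using perron_eq_perron_value[of f a] f that by (simp add: Limsup_ereal_eq_iff)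
  have "(\<exists>a :: int \<Rightarrow> nat. (\<forall>i. a i \<ge> 1) \<and> limsup_is (filtercomap abs at_top) (perron_value a) m) \<longleftrightarrow>
        (\<exists>a :: int \<Rightarrow> nat. (\<forall>i. a i \<ge> 1) \<and> limsup_is sequentially (\<lambda>n. perron_value a (int n)) m)"
    (is "(\<exists>a. ?P a) \<longleftrightarrow> (\<exists>a. ?Q a)") for m
  proof
    assume "\<exists>a. ?P a"
    then obtain a where a: "\<forall>i. a i \<ge> 1" "limsup_is (filtercomap abs at_top) (perron_value a) m" by blast
    from limsup_is_abs_at_top_cases[OF a(2)] show "\<exists>a. ?Q a"
    proof
      assume "limsup_is sequentially (\<lambda>n. perron_value a (int n)) m"
      then show ?thesis using a(1) by (intro exI[of _ a]) simp
    next
      assume "limsup_is sequentially (\<lambda>n. perron_value a (- int n)) m"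
      then have "?Q (\<lambda>i. a (- 1 - i))" unfolding perron_value_reverse using a(1) by simp
      then show ?thesis by (rule exI[of ?Q "\<lambda>i. a (- 1 - i)"])
    qed
  next
    assume "\<exists>a. ?Q a"
    then obtain a where a: "\<forall>i. a i \<ge> 1" "limsup_is sequentially (\<lambda>n. perron_value a (int n)) m" by blast
    define b where "b = (\<lambda>i. if i \<ge> 0 then a i else a (- 1 - i))"
    have b1: "\<forall>i. b i \<ge> 1" using a(1) by (simp add: b_def)
    have "(\<lambda>i. b (- 1 - i)) = b" by (auto simp: b_def)
    then have sym: "perron_value b (- k) = perron_value b k" for k using perron_value_reverse[of b k] by simp
    have close: "\<bar>perron_value b (int n) - perron_value a (int n)\<bar> \<le> 2 * (1/4) ^ (n div 2)" for n
      by (rule perron_value_close) (use a(1) b1 in \<open>auto simp: b_def\<close>)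
    have "(\<lambda>n. perron_value b (int n) - perron_value a (int n)) \<longlonglongrightarrow> 0"
      by (rule Lim_null_comparison[OF _ geometric_rate]) (use close in auto)
    from limsup_is_cong_tendsto[OF this] have "limsup_is sequentially (\<lambda>n. perron_value b (int n)) m"
      using a(2) by simp
    moreover have "limsup_is (filtercomap abs at_top) (perron_value b) m \<longleftrightarrow> limsup_is sequentially (\<lambda>n. perron_value b (int n)) m"
      by (rule limsup_is_cong) (simp add: eventual_bound_abs_at_top sym)
    ultimately have "?P b" using b1 by simp
    then show "\<exists>a. ?P a" by (rule exI[of ?P b])
  qed
  then show ?thesis unfolding sigma_limsup'_def perron_limsups_def using val
    by (intro Collect_cong) blast
qed

definition best_approx :: "real \<Rightarrow> nat \<Rightarrow> real" where
  "best_approx \<alpha> t = Inf {\<bar>of_int q * \<alpha> - of_int p\<bar> | p q :: int. 0 < q \<and> q \<le> int t}"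

text \<open>
The staircase that starts at the axis point \<open>(1, 0)\<close> of the lattice of the points
\<open>(q * \<alpha> - p, q)\<close>: \<open>Y n\<close> are the denominators of the convergents and \<open>X n\<close> their approximation errors.
\<close>

locale convergent_chain = cf_chain +
  fixes \<alpha> :: real
  assumes start: "X 0 = 1" "X 1 = frac \<alpha>" "Y 0 = 0" "Y 1 = 1"
begin

lemma abs_pts_start: "(p, q) \<in> abs_pts (X 0) (- X 1) (Y 0) (Y 1) \<longleftrightarrow>
    (\<exists>m n :: int. (m, n) \<noteq> (0, 0) \<and> p = \<bar>of_int n * \<alpha> - of_int m\<bar> \<and> q = \<bar>of_int n\<bar>)"
proof
  assume "(p, q) \<in> abs_pts (X 0) (- X 1) (Y 0) (Y 1)"
  then obtain m n :: int where mn: "(m, n) \<noteq> (0, 0)" "p = \<bar>of_int m * 1 + of_int n * (- frac \<alpha>)\<bar>"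
    "q = \<bar>of_int m * 0 + of_int n * 1\<bar>"
    unfolding start abs_pts_def by blast
  have "p = \<bar>of_int n * \<alpha> - of_int (m + n * \<lfloor>\<alpha>\<rfloor>)\<bar>"
    unfolding mn(2) frac_def by (simp add: algebra_simps)
  moreover have "(m + n * \<lfloor>\<alpha>\<rfloor>, n) \<noteq> (0, 0)" using mn(1) by auto
  ultimately show "\<exists>m n :: int. (m, n) \<noteq> (0, 0) \<and> p = \<bar>of_int n * \<alpha> - of_int m\<bar> \<and> q = \<bar>of_int n\<bar>"
    using mn(3) by (intro exI[of _ "m + n * \<lfloor>\<alpha>\<rfloor>"] exI[of _ n]) simp
next
  assume "\<exists>m n :: int. (m, n) \<noteq> (0, 0) \<and> p = \<bar>of_int n * \<alpha> - of_int m\<bar> \<and> q = \<bar>of_int n\<bar>"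
  then obtain m n :: int where mn: "(m, n) \<noteq> (0, 0)" "p = \<bar>of_int n * \<alpha> - of_int m\<bar>" "q = \<bar>of_int n\<bar>"
    by blast
  show "(p, q) \<in> abs_pts (X 0) (- X 1) (Y 0) (Y 1)"
    unfolding start
  proof (rule abs_ptsI[of "m - n * \<lfloor>\<alpha>\<rfloor>" n])
    show "(m - n * \<lfloor>\<alpha>\<rfloor>, n) \<noteq> (0, 0)" using mn(1) by auto
    show "p = \<bar>of_int (m - n * \<lfloor>\<alpha>\<rfloor>) * 1 + of_int n * - frac \<alpha>\<bar>"
      unfolding mn(2) frac_def by (simp add: algebra_simps)
  qed (simp add: mn)
qed

lemma Y_nat: "\<exists>y y'. Y n = real y \<and> Y (Suc n) = real y'"
proof (induction n)
  case 0
  show ?case using start by (intro exI[of _ "0::nat"] exI[of _ "1::nat"]) simp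
next
  case (Suc n)
  then obtain y y' where "Y n = real y" "Y (Suc n) = real y'" by blast
  then have "Y (Suc n) = real y'" "Y (Suc (Suc n)) = real (y + s n * y')" unfolding Y_Suc_Suc by simp_all
  then show ?case by blast
qed

lemma Y_ge: "Y n + Y (Suc n) \<le> Y (Suc (Suc n))"
  unfolding Y_Suc_Suc using mult_right_mono[of 1 "real (s n)" "Y (Suc n)"] s1[of n] Y_nonneg[of n] by simp

lemma Y_mono: "m \<le> n \<Longrightarrow> Y m \<le> Y n"
proof (rule lift_Suc_mono_le[of Y])
  show "Y k \<le> Y (Suc k)" for k
    using Y_ge[of "k - 1"] Y_nonneg[of "k - 1"] start by (cases k) auto
qed

lemma Y_growth: "real n \<le> Y (Suc n)"
proof (induction n)
  case (Suc n)
  have "1 \<le> Y (Suc n)" using Y_mono[of 1 "Suc n"] start by simp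
  show ?case
  proof (cases n)
    case 0
    then show ?thesis using Y_ge[of 0] start by simp
  next
    case (Suc k)
    have "1 \<le> Y n" using Y_mono[of 1 n] start Suc by simp
    then show ?thesis using Y_ge[of n] Suc.IH by simp
  qed
qed (use Y_nonneg in \<open>simp add: less_imp_le\<close>)

text \<open>
The convergents are best approximations: the error \<open>X k\<close> is not beaten before the next denominator
is reached.
\<close>

lemma best_approx_ge:
  assumes "1 \<le> t" "real t < Y (Suc k)"
  shows "X k \<le> best_approx \<alpha> t"
  unfolding best_approx_def
proof (rule cInf_greatest)
  have "\<bar>of_int 1 * \<alpha> - of_int 0\<bar> \<in> {\<bar>of_int q * \<alpha> - of_int p\<bar> | p q :: int. 0 < q \<and> q \<le> int t}"
    using assms(1) by (intro CollectI exI[of _ "0::int"] exI[of _ "1::int"]) simp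
  then show "{\<bar>of_int q * \<alpha> - of_int p\<bar> | p q :: int. 0 < q \<and> q \<le> int t} \<noteq> {}" by blast
  fix x assume "x \<in> {\<bar>of_int q * \<alpha> - of_int p\<bar> | p q :: int. 0 < q \<and> q \<le> int t}"
  then obtain p q :: int where pq: "x = \<bar>of_int q * \<alpha> - of_int p\<bar>" "0 < q" "q \<le> int t" by blast
  then have "(p, q) \<noteq> (0, 0)" by simp
  then have "(x, \<bar>of_int q\<bar>) \<in> abs_pts (X 0) (- X 1) (Y 0) (Y 1)" unfolding abs_pts_start using pq(1) by blast
  then have "X k \<le> x \<or> Y (Suc k) \<le> \<bar>of_int q\<bar>" by (rule point_large)
  moreover have "real_of_int q \<le> real t" using pq(3) by linarith
  ultimately show "X k \<le> x" using assms(2) pq(2) by auto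
qed

lemma best_approx_le:
  assumes "1 \<le> k" "Y k \<le> real t"
  shows "best_approx \<alpha> t \<le> X k"
proof -
  obtain m n :: int where mn: "X k = \<bar>of_int n * \<alpha> - of_int m\<bar>" "Y k = \<bar>of_int n\<bar>"
    using point[of k] unfolding abs_pts_start by blast
  have "0 < Y k" using assms(1) Y_nonneg[of "k - 1"] by simp
  then have "n \<noteq> 0" using mn(2) by auto
  have "X k = \<bar>of_int \<bar>n\<bar> * \<alpha> - of_int (sgn n * m)\<bar>"
    unfolding mn(1) using \<open>n \<noteq> 0\<close> by (cases "n > 0") (auto simp: abs_minus_commute)
  moreover have "\<bar>n\<bar> \<le> int t" using mn(2) assms(2) by linarith
  ultimately have "X k \<in> {\<bar>of_int q * \<alpha> - of_int p\<bar> | p q :: int. 0 < q \<and> q \<le> int t}"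
    using \<open>n \<noteq> 0\<close> by (intro CollectI exI[of _ "sgn n * m"] exI[of _ "\<bar>n\<bar>"]) simp
  moreover have "bdd_below {\<bar>of_int q * \<alpha> - of_int p\<bar> | p q :: int. 0 < q \<and> q \<le> int t}"
    by (rule bdd_belowI[of _ 0]) auto
  ultimately show ?thesis unfolding best_approx_def by (rule cInf_lower)
qed

text \<open>
Between two consecutive denominators the minimal error is constantly \<open>X k\<close>, and \<open>t\<close> stays below
\<open>Y (Suc k)\<close> but comes within distance 1 of it.  The difference is at most \<open>X k\<close>, a null sequence.
\<close>

lemma eventual_bound_best_approx:
  "eventual_bound sequentially (\<lambda>t. real t * best_approx \<alpha> t) m \<longleftrightarrow>
   eventual_bound sequentially (\<lambda>k. X k * Y (Suc k)) m"
  unfolding eventual_bound_def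
proof (intro iffI allI impI)
  fix e :: real assume e: "0 < e"
  assume "\<forall>e>0. \<forall>\<^sub>F t in sequentially. real t * best_approx \<alpha> t < m + e"
  then have "\<forall>\<^sub>F t in sequentially. real t * best_approx \<alpha> t < m + e/2" using e by simp
  then obtain t0 where t0: "\<And>t. t \<ge> t0 \<Longrightarrow> real t * best_approx \<alpha> t < m + e/2"
    unfolding eventually_sequentially by blast
  have "\<forall>\<^sub>F k in sequentially. X k < e/2" using X_tendsto_0 e by (intro order_tendstoD(2)) auto
  moreover have "\<forall>\<^sub>F k in sequentially. t0 + 2 \<le> k" by (rule eventually_ge_at_top)
  ultimately show "\<forall>\<^sub>F k in sequentially. X k * Y (Suc k) < m + e"
  proof eventually_elim
    case (elim k)
    obtain y where y: "Y (Suc k) = real y" using Y_nat by blast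
    have "k \<le> y" using Y_growth[of k] y by simp
    then have t: "t0 \<le> y - 1" "1 \<le> y - 1" "real (y - 1) = real y - 1" using elim by auto
    \<comment> \<open>The last \<open>t\<close> before the next denominator.\<close>
    have "real (y - 1) * X k \<le> real (y - 1) * best_approx \<alpha> (y - 1)"
      by (intro mult_left_mono best_approx_ge) (use t y in auto)
    then have "(real y - 1) * X k < m + e/2" using t0[OF t(1)] t(3) by simp
    then show ?case using elim(1) unfolding y by (simp add: algebra_simps)
  qed
next
  fix e :: real assume e: "0 < e"
  assume "\<forall>e>0. \<forall>\<^sub>F k in sequentially. X k * Y (Suc k) < m + e"
  then obtain K where K: "\<And>k. k \<ge> K \<Longrightarrow> X k * Y (Suc k) < m + e"
    using e unfolding eventually_sequentially by blast
  have "\<forall>\<^sub>F t in sequentially. Y K \<le> real t"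
    by (metis eventually_sequentiallyI filterlim_at_top filterlim_real_sequentially)
  moreover have "\<forall>\<^sub>F t in sequentially. 1 \<le> t" by (rule eventually_ge_at_top)
  ultimately show "\<forall>\<^sub>F t in sequentially. real t * best_approx \<alpha> t < m + e"
  proof eventually_elim
    case (elim t)
    define k where "k = (LEAST k. real t < Y (Suc k))"
    have "\<exists>k. real t < Y (Suc k)" using Y_growth[of "Suc t"] by (intro exI[of _ "Suc t"]) simp
    then have k: "real t < Y (Suc k)" unfolding k_def by (rule LeastI_ex)
    have "k \<noteq> 0" using k elim(2) start by (intro notI) simp
    then obtain k' where k': "k = Suc k'" by (cases k) auto
    have "Y k \<le> real t" using not_less_Least[of k' "\<lambda>k. real t < Y (Suc k)"] k' by (simp add: k_def)
    have "K \<le> k"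
    proof (rule ccontr)
      assume "\<not> K \<le> k"
      then have "Y (Suc k) \<le> Y K" by (intro Y_mono) simp
      then show False using k elim(1) by simp
    qed
    have "real t * best_approx \<alpha> t \<le> Y (Suc k) * X k"
      using k best_approx_le[of k t] \<open>k \<noteq> 0\<close> \<open>Y k \<le> real t\<close> X_pos[of k] best_approx_ge[of t k] elim(2) by (intro mult_mono) auto
    then show ?case using K[OF \<open>K \<le> k\<close>] by (simp add: mult.commute)
  qed
qed

text \<open>
The quotient \<open>Y k / Y (Suc k)\<close> is the finite continued fraction of the terms read backwards from
\<open>k - 1\<close> to the start, and has about \<open>k\<close> terms in common with the left expansion in \<open>a\<close>.
\<close>

lemma corner_close_perron_value:
  assumes a: "\<And>i. a i \<ge> (1::nat)" "\<And>i. a (int i) = s i"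
  shows "\<bar>X k * Y (Suc k) - perron_value a (int k)\<bar> \<le> 2 * (1/4) ^ (k div 2)"
proof -
  define N where "N = k div 2"
  have unit: "Y n / Y (Suc n) \<in> {0..1}" for n
    using Y_mono[of n "Suc n"] Y_nonneg[of n] by simp
  have "\<bar>Y (k - 0) / Y (Suc (k - 0)) - cf (\<lambda>j. a (int k - 1 - int (0 + j)))\<bar> \<le> (1/4) ^ N"
  proof (rule cf_contraction[of N "\<lambda>i. s (k - 1 - i)" "\<lambda>i. Y (k - i) / Y (Suc (k - i))"
        "\<lambda>i. cf (\<lambda>j. a (int k - 1 - int (i + j)))"])
    fix i
    show "1 \<le> s (k - 1 - i)" by (rule s1)
    show "Y (k - i) / Y (Suc (k - i)) \<in> {0..1}" by (rule unit)
    show "cf (\<lambda>j. a (int k - 1 - int (i + j))) \<in> {0..1}" by (rule cf_in_unit) (rule a(1))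
    assume "i < 2 * N"
    then have i: "i < k" unfolding N_def by auto
    then have eqs: "k - i = Suc (k - 1 - i)" "k - Suc i = k - 1 - i" by auto
    show "Y (k - i) / Y (Suc (k - i)) = 1 / (real (s (k - 1 - i)) + Y (k - Suc i) / Y (Suc (k - Suc i)))"
      unfolding eqs by (rule ratio_Suc)
    have "int k - 1 - int i = int (k - 1 - i)" using i by linarith
    then have "a (int k - 1 - int (i + 0)) = s (k - 1 - i)" using a(2)[of "k - 1 - i"] by simp
    moreover have "cf (\<lambda>j. a (int k - 1 - int (i + j))) =
        1 / (real (a (int k - 1 - int (i + 0))) + cf (\<lambda>j. a (int k - 1 - int (i + Suc j))))"
      by (rule cf_rec(1)[of "\<lambda>j. a (int k - 1 - int (i + j))"]) (rule a(1))
    ultimately show "cf (\<lambda>j. a (int k - 1 - int (i + j))) =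
        1 / (real (s (k - 1 - i)) + cf (\<lambda>j. a (int k - 1 - int (Suc i + j))))" by simp
  qed
  then have close: "\<bar>Y k / Y (Suc k) - cf (\<lambda>j. a (int k - 1 - int j))\<bar> \<le> (1/4) ^ N" by simp
  have shift: "cf (\<lambda>i. s (k + i)) = cf (\<lambda>i. a (int k + int i))"
    by (simp flip: a(2))
  have det: "X 0 * Y 1 + X 1 * Y 0 = 1" unfolding start by simp
  have "\<bar>X k * Y (Suc k) - perron_value a (int k)\<bar> \<le> \<bar>cf (\<lambda>i. a (int k + int i)) - cf (\<lambda>i. a (int k + int i))\<bar>
      + \<bar>Y k / Y (Suc k) - cf (\<lambda>j. a (int k - 1 - int j))\<bar>"
    unfolding corner_value[OF det] perron_value_def shift
    by (rule recip_product_lipschitz) (rule unit cf_in_unit a(1))+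
  then show ?thesis using close zero_le_power[of "1/4::real" N] unfolding N_def by linarith
qed

lemma dirichlet_const_iff:
  assumes a: "\<And>i. a i \<ge> (1::nat)" "\<And>i. a (int i) = s i"
  shows "dirichlet_const \<alpha> = ereal m \<longleftrightarrow> limsup_is sequentially (\<lambda>n. perron_value a (int n)) m"
proof -
  have "(\<lambda>k. X k * Y (Suc k) - perron_value a (int k)) \<longlonglongrightarrow> 0"
    by (rule Lim_null_comparison[OF _ geometric_rate]) (use corner_close_perron_value[of a] a in auto)
  then have "limsup_is sequentially (\<lambda>n. perron_value a (int n)) m \<longleftrightarrow> limsup_is sequentially (\<lambda>k. X k * Y (Suc k)) m"
    by (rule limsup_is_cong_tendsto)
  also have "\<dots> \<longleftrightarrow> limsup_is sequentially (\<lambda>t. real t * best_approx \<alpha> t) m"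
    by (rule limsup_is_cong) (simp add: eventual_bound_best_approx)
  also have "\<dots> \<longleftrightarrow> dirichlet_const \<alpha> = ereal m"
    unfolding dirichlet_const_def best_approx_def Limsup_ereal_eq_iff ..
  finally show ?thesis by blast
qed

text \<open>
For rational \<open>\<alpha>\<close> the positive errors would be bounded below by the reciprocal of its denominator.
\<close>

lemma irrational: "\<alpha> \<notin> \<rat>"
proof
  assume "\<alpha> \<in> \<rat>"
  then obtain i j :: int where ij: "j > 0" "\<alpha> = of_int i / of_int j" by (metis Rats_cases')
  have "1 / of_int j \<le> X k" for k
  proof -
    obtain m n :: int where mn: "X k = \<bar>of_int n * \<alpha> - of_int m\<bar>"
      using point[of k] unfolding abs_pts_start by blast
    then have X: "X k * of_int j = \<bar>of_int (n * i - m * j)\<bar>"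
      using ij by (simp add: field_simps abs_mult)
    have "0 < X k * of_int j" using X_pos ij(1) by simp
    then have "n * i - m * j \<noteq> 0" unfolding X by (metis abs_zero less_irrefl of_int_0)
    then have "1 \<le> \<bar>n * i - m * j\<bar>" by linarith
    then have "1 \<le> \<bar>real_of_int (n * i - m * j)\<bar>" by linarith
    then show ?thesis using X ij(1) by (simp add: field_simps)
  qed
  then have "1 / of_int j \<le> (0::real)" by (intro LIMSEQ_le_const[OF X_tendsto_0]) auto
  then show False using ij(1) by simp
qed

end

lemma convergent_chain_exists:
  assumes "\<And>i. s i \<ge> (1::nat)" "cf s = frac \<alpha>"
  obtains X Y where "convergent_chain s X Y \<alpha>"
proof -
  obtain X Y where c: "cf_chain s X Y" "X 0 = 1" "X 1 = 1 * cf s" "Y 0 = 0" "Y 1 = 1"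
    using cf_chain_exists[of s 1 0 1] assms(1) by auto
  then have "convergent_chain s X Y \<alpha>"
    unfolding convergent_chain_def convergent_chain_axioms_def using assms(2) by simp
  then show ?thesis by (rule that)
qed

text \<open>
All two-sided prolongations of the sequence of partial quotients of \<open>\<alpha>\<close> have the same limit
superior to the right, namely the Dirichlet constant of \<open>\<alpha>\<close>.
\<close>

lemma dirichlet_spectrum_eq: "dirichlet_spectrum = perron_limsups"
proof (intro equalityI subsetI)
  fix m assume "m \<in> dirichlet_spectrum"
  then obtain \<alpha> where \<alpha>: "\<alpha> \<notin> \<rat>" "dirichlet_const \<alpha> = ereal m" unfolding dirichlet_spectrum_def by blast
  have irr: "frac \<alpha> \<notin> \<rat>"
  proof
    assume "frac \<alpha> \<in> \<rat>"
    then have "frac \<alpha> + of_int \<lfloor>\<alpha>\<rfloor> \<in> \<rat>" by (intro Rats_add) auto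
    then show False using \<alpha>(1) by (simp add: frac_def)
  qed
  then have "frac \<alpha> \<noteq> 0" by (metis Rats_0)
  then have "0 < frac \<alpha>" using frac_ge_0[of \<alpha>] by linarith
  then obtain s where s: "\<And>i. s i \<ge> (1::nat)" "cf s = frac \<alpha>"
    using irrational_eq_cf[OF irr] frac_lt_1 by metis
  obtain X Y where "convergent_chain s X Y \<alpha>" using convergent_chain_exists s by blast
  then interpret convergent_chain s X Y \<alpha> .
  define a where "a = (\<lambda>i::int. if i \<ge> 0 then s (nat i) else 1)"
  have a: "a i \<ge> 1" "a (int j) = s j" for i j using s(1) by (simp_all add: a_def)
  then have "limsup_is sequentially (\<lambda>n. perron_value a (int n)) m" using dirichlet_const_iff \<alpha>(2) by blast
  then show "m \<in> perron_limsups" unfolding perron_limsups_def using a(1) by blast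
next
  fix m assume "m \<in> perron_limsups"
  then obtain a :: "int \<Rightarrow> nat" where a: "\<And>i. a i \<ge> 1" "limsup_is sequentially (\<lambda>n. perron_value a (int n)) m"
    unfolding perron_limsups_def by blast
  let ?s = "\<lambda>i. a (int i)"
  have "frac (cf ?s) = cf ?s" using cf_rec(2,3)[of ?s] a(1) by (simp add: frac_eq)
  then obtain X Y where "convergent_chain ?s X Y (cf ?s)" using convergent_chain_exists[of ?s "cf ?s"] a(1) by metis
  then interpret convergent_chain ?s X Y "cf ?s" .
  show "m \<in> dirichlet_spectrum"
    unfolding dirichlet_spectrum_def using irrational dirichlet_const_iff[of a m] a by blast
qed

section \<open>Limits of shifted sequences\<close>

text \<open>
Compactness of the space of bounded two-sided sequences, by diagonalisation.  The bound holds
only eventually at each index, since shifts of an eventually bounded sequence are of this kind.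
\<close>

lemma pointwise_limit_exists:
  fixes c :: "nat \<Rightarrow> int \<Rightarrow> nat"
  assumes bounded: "\<And>i. \<forall>\<^sub>F n in sequentially. c n i \<le> M"
  obtains r d where "strict_mono r" "\<And>i. \<forall>\<^sub>F n in sequentially. c (r n) i = d i"
proof -
  let ?P = "\<lambda>k r. \<exists>v. \<forall>\<^sub>F n in sequentially. c (r n) (from_nat k) = v"
  interpret subseqs ?P
  proof
    fix k and s :: "nat \<Rightarrow> nat" assume s: "strict_mono s"
    let ?f = "\<lambda>n. c (s n) (from_nat k)"
    have "\<forall>\<^sub>F n in sequentially. ?f n \<le> M"
      using eventually_subseq[OF s bounded] .
    then obtain N where N: "\<And>n. n \<ge> N \<Longrightarrow> ?f n \<le> M" unfolding eventually_sequentially by blast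
    have "finite (?f ` {N..})" by (rule finite_subset[of _ "{..M}"]) (use N in auto)
    then obtain a where "infinite {n \<in> {N..}. ?f n = ?f a}"
      using pigeonhole_infinite[of "{N..}" ?f] infinite_Ici by blast
    then have inf: "infinite {n. ?f n = ?f a}" by (rule contrapos_nn) (auto elim: finite_subset[rotated])
    let ?r = "enumerate {n. ?f n = ?f a}"
    have "strict_mono ?r" by (rule strict_mono_enumerate[OF inf])
    moreover have "c ((s \<circ> ?r) n) (from_nat k) = ?f a" for n
      using enumerate_in_set[OF inf, of n] by simp
    ultimately show "\<exists>r. strict_mono r \<and> ?P k (s \<circ> r)" by (intro exI[of _ ?r] conjI exI[of _ "?f a"]) auto
  qed
  have "\<exists>v. \<forall>\<^sub>F n in sequentially. c (diagseq n) i = v" for i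
  proof -
    have "?P (to_nat i) (diagseq \<circ> ((+) (Suc (to_nat i))))"
    proof (rule diagseq_holds)
      fix r s :: "nat \<Rightarrow> nat" and n assume "strict_mono r" "?P n s"
      then show "?P n (s \<circ> r)" using eventually_subseq[of r] by auto
    qed
    then obtain v where "\<forall>\<^sub>F n in sequentially. c (diagseq (n + Suc (to_nat i))) i = v"
      by (auto simp: add.commute)
    then show ?thesis using eventually_sequentially_seg[of "\<lambda>n. c (diagseq n) i = v"] by blast
  qed
  then have "\<forall>i. \<exists>v. \<forall>\<^sub>F n in sequentially. c (diagseq n) i = v" by (rule allI)
  from choice[OF this] obtain d where "\<forall>i. \<forall>\<^sub>F n in sequentially. c (diagseq n) i = d i" by (rule exE)
  then show ?thesis by (intro that[of diagseq d] subseq_diagseq) simp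
qed

definition recurs_in :: "(int \<Rightarrow> nat) \<Rightarrow> (int \<Rightarrow> nat) \<Rightarrow> bool" where
  "recurs_in c a \<longleftrightarrow> (\<forall>L::nat. \<exists>\<^sub>F n in sequentially. \<forall>i\<in>{- int L..int L}. a (int n + i) = c i)"

text \<open>
Every window of \<open>c\<close> occurs arbitrarily far to the right in \<open>a\<close>, where the values of \<open>a\<close> exceed \<open>m\<close>
by arbitrarily little at most.
\<close>

lemma recurs_in_perron_value_le:
  assumes a: "\<And>i. a i \<ge> (1::nat)" and c: "\<And>i. c i \<ge> (1::nat)"
    and rec: "recurs_in c a" and bound: "eventual_bound sequentially (\<lambda>n. perron_value a (int n)) m"
  shows "perron_value c k \<le> m"
proof (rule field_le_epsilon)
  fix e :: real assume e: "0 < e"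
  then obtain N where N: "(1/4::real) ^ N < e / 4" using real_arch_pow_inv[of "e/4" "1/4"] by auto
  have "\<forall>\<^sub>F n in sequentially. perron_value a (int n) < m + e / 2"
    using bound e unfolding eventual_bound_def by simp
  then obtain K where K: "\<And>n. n \<ge> K \<Longrightarrow> perron_value a (int n) < m + e / 2" unfolding eventually_sequentially by blast
  define L where "L = nat \<bar>k\<bar> + 2 * N"
  have "\<exists>\<^sub>F n in sequentially. \<forall>i\<in>{- int L..int L}. a (int n + i) = c i"
    using rec unfolding recurs_in_def by blast
  then obtain n where n: "n \<ge> K + nat \<bar>k\<bar>" "\<And>i. i \<in> {- int L..int L} \<Longrightarrow> a (int n + i) = c i"
    unfolding frequently_sequentially by blast
  have "\<bar>perron_value a (int n + k) - perron_value c k\<bar> \<le> 2 * (1/4) ^ N"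
  proof (rule perron_value_close[OF a c])
    fix i assume "- int (2 * N) \<le> i" "i < int (2 * N)"
    then have "k + i \<in> {- int L..int L}" unfolding L_def by auto
    then show "a (int n + k + i) = c (k + i)" using n(2)[of "k + i"] by (simp add: add.assoc)
  qed
  moreover have "perron_value a (int n + k) < m + e / 2"
  proof -
    have "int (nat (int n + k)) = int n + k" "K \<le> nat (int n + k)" using n(1) by auto
    then show ?thesis using K[of "nat (int n + k)"] by simp
  qed
  ultimately show "perron_value c k \<le> m + e" using N by linarith
qed

text \<open>
The limit superior of \<open>a\<close> is a maximum for a suitable limit \<open>c\<close> of shifts of \<open>a\<close>, namely along
positions \<open>p j\<close> at which the values approach the limit superior.  The terms of \<open>a\<close> are bounded by
\<open>M\<close> in the long run, as the limit superior stays away from 1.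
\<close>

lemma limsup_attained_by_recurring:
  assumes a: "\<And>i. a i \<ge> (1::nat)" and lim: "limsup_is sequentially (\<lambda>n. perron_value a (int n)) m"
    and M: "m < 1 - 1 / real M" "0 < M"
  shows "\<exists>c. (\<forall>i. 1 \<le> c i \<and> c i \<le> M) \<and> recurs_in c a \<and> perron_value c 0 = m \<and> (\<forall>k. perron_value c k \<le> m)"
proof -
  have bound: "eventual_bound sequentially (\<lambda>n. perron_value a (int n)) m"
    using lim unfolding limsup_is_iff_least_eventual_bound by blast
  have "\<forall>\<^sub>F n in sequentially. perron_value a (int n) < m + (1 - 1 / real M - m)"
    using bound M(1) unfolding eventual_bound_def by (metis diff_gt_0_iff_gt)
  then obtain K where K: "\<And>n. n \<ge> K \<Longrightarrow> perron_value a (int n) < 1 - 1 / real M"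
    unfolding eventually_sequentially by auto
  have "\<exists>n\<ge>j. m - 1 / real (Suc j) < perron_value a (int n)" for j
  proof -
    have "\<exists>\<^sub>F n in sequentially. m - 1 / real (Suc j) < perron_value a (int n)"
      using lim unfolding limsup_is_def by simp
    then show ?thesis unfolding frequently_sequentially by blast
  qed
  then obtain p where p: "\<And>j. j \<le> p j" "\<And>j. m - 1 / real (Suc j) < perron_value a (int (p j))" by metis
  define c where "c = (\<lambda>j i. a (int (p j) + i))"
  have "\<forall>\<^sub>F j in sequentially. c j i \<le> M" for i
    unfolding eventually_sequentially
  proof (intro exI allI impI)
    fix j assume "K + nat \<bar>i\<bar> \<le> j"
    then have j: "int (nat (int (p j) + i)) = int (p j) + i" "K \<le> nat (int (p j) + i)" using p(1)[of j] by auto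
    then have "perron_value a (int (p j) + i) < 1 - 1 / real M" using K[OF j(2)] by simp
    then show "c j i \<le> M" unfolding c_def using perron_value_less_imp_bounded[of a] a M(2) by blast
  qed
  then obtain r d where r: "strict_mono r" and d: "\<And>i. \<forall>\<^sub>F j in sequentially. c (r j) i = d i"
    using pointwise_limit_exists by blast
  have bounded: "\<And>i. \<forall>\<^sub>F j in sequentially. c j i \<le> M" by fact
  have d1: "1 \<le> d i \<and> d i \<le> M" for i
  proof -
    have "\<forall>\<^sub>F j in sequentially. c (r j) i = d i \<and> c (r j) i \<le> M"
      using d eventually_subseq[OF r bounded] by (rule eventually_conj)
    then obtain j where "c (r j) i = d i" "c (r j) i \<le> M" by (auto dest: eventually_happens)
    then show ?thesis using a[of "int (p (r j)) + i"] unfolding c_def by metis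
  qed
  have rec: "recurs_in d a"
    unfolding recurs_in_def frequently_sequentially
  proof (intro allI)
    fix L N :: nat
    have "\<forall>\<^sub>F j in sequentially. \<forall>i\<in>{- int L..int L}. c (r j) i = d i"
      by (intro eventually_ball_finite) (auto intro: d)
    then obtain j0 where "\<And>j. j \<ge> j0 \<Longrightarrow> \<forall>i\<in>{- int L..int L}. c (r j) i = d i"
      unfolding eventually_sequentially by blast
    then have "\<forall>i\<in>{- int L..int L}. a (int (p (r (max j0 N))) + i) = d i" unfolding c_def by simp
    moreover have "N \<le> p (r (max j0 N))"
      using p(1)[of "r (max j0 N)"] strict_mono_imp_increasing[OF r, of "max j0 N"] by linarith
    ultimately show "\<exists>n\<ge>N. \<forall>i\<in>{- int L..int L}. a (int n + i) = d i" by blast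
  qed
  have le: "perron_value d k \<le> m" for k
    by (rule recurs_in_perron_value_le[OF a _ rec bound]) (use d1 in auto)
  have "m \<le> perron_value d 0"
  proof (rule LIMSEQ_le)
    have "(\<lambda>j. perron_value (c (r j)) 0) \<longlonglongrightarrow> perron_value d 0"
      by (rule perron_value_tendsto) (use a d1 d in \<open>auto simp: c_def\<close>)
    then show "(\<lambda>j. perron_value a (int (p (r j)))) \<longlonglongrightarrow> perron_value d 0" unfolding c_def perron_value_shift by simp
    have "(\<lambda>j. 1 / real (Suc (r j))) \<longlonglongrightarrow> 0"
      using LIMSEQ_subseq_LIMSEQ[OF LIMSEQ_Suc[OF lim_inverse_n'] r] by (simp add: o_def)
    then show "(\<lambda>j. m - 1 / real (Suc (r j))) \<longlonglongrightarrow> m" using tendsto_diff[OF tendsto_const[of m]] by force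
    show "\<exists>N. \<forall>n\<ge>N. m - 1 / real (Suc (r n)) \<le> perron_value a (int (p (r n)))" using p(2) less_imp_le by blast
  qed
  then have "perron_value d 0 = m" using le[of 0] by simp
  then show ?thesis using d1 rec le by blast
qed

lemma SUP_perron_value_attained:
  assumes "perron_value c 0 = m" "\<And>k. perron_value c k \<le> m"
  shows "(SUP k. ereal (perron_value c k)) = ereal m"
  by (rule antisym) (use assms in \<open>auto intro!: SUP_least SUP_upper2[of 0]\<close>)

lemma inverse_below_gap:
  assumes "m < (1::real)"
  obtains M :: nat where "0 < M" "m < 1 - 1 / real M"
proof -
  obtain M where "1 / real (Suc M) < 1 - m" using assms nat_approx_posE[of "1 - m"] by auto
  then show ?thesis using that[of "Suc M"] by simp
qed

lemma perron_limsups_le_one: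
  assumes "m \<in> perron_limsups"
  shows "m \<le> 1"
proof -
  obtain a :: "int \<Rightarrow> nat" where a: "\<And>i. a i \<ge> 1" "limsup_is sequentially (\<lambda>n. perron_value a (int n)) m"
    using assms unfolding perron_limsups_def by blast
  show ?thesis
  proof (rule field_le_epsilon)
    fix e :: real assume "0 < e"
    then have "\<exists>\<^sub>F n in sequentially. m - e < perron_value a (int n)" using a(2) unfolding limsup_is_def by blast
    then obtain n where "m - e < perron_value a (int n)" by (auto dest: frequently_ex)
    then show "m \<le> 1 + e" using perron_value_bounds(2)[of a "int n"] a(1) by simp
  qed
qed

lemma perron_limsups_subset_sups: "perron_limsups \<subseteq> perron_sups"
proof
  fix m assume m: "m \<in> perron_limsups"
  show "m \<in> perron_sups"
  proof (cases "m = 1")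
    case False
    then have "m < 1" using perron_limsups_le_one[OF m] by simp
    then obtain M :: nat where M: "0 < M" "m < 1 - 1 / real M" by (rule inverse_below_gap)
    obtain a :: "int \<Rightarrow> nat" where a: "\<And>i. a i \<ge> 1" "limsup_is sequentially (\<lambda>n. perron_value a (int n)) m"
      using m unfolding perron_limsups_def by blast
    have "\<exists>c. (\<forall>i. 1 \<le> c i \<and> c i \<le> M) \<and> recurs_in c a \<and> perron_value c 0 = m \<and> (\<forall>k. perron_value c k \<le> m)"
      by (rule limsup_attained_by_recurring) (rule a M)+
    then obtain c where c: "\<forall>i. 1 \<le> c i \<and> c i \<le> M" "recurs_in c a" "perron_value c 0 = m" "\<forall>k. perron_value c k \<le> m"
      by (elim exE conjE) (rule that)
    have "(SUP k. ereal (perron_value c k)) = ereal m" by (rule SUP_perron_value_attained) (use c in auto)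
    then show ?thesis unfolding perron_sups_def using c(1) by blast
  qed (simp add: perron_sups_def)
qed

text \<open>
Each sequence is shifted so that its supremum is almost attained at the origin; a limit of the
shifted sequences then attains the limit of the suprema.
\<close>

lemma closed_perron_sups: "closed perron_sups"
  unfolding closed_sequential_limits
proof (intro allI impI, elim conjE)
  fix x :: "nat \<Rightarrow> real" and l assume x: "\<forall>n. x n \<in> perron_sups" and lim: "x \<longlonglongrightarrow> l"
  have sup: "\<exists>c. (\<forall>i. 1 \<le> c i) \<and> (\<forall>k. perron_value c k \<le> m) \<and> m - e < perron_value c 0"
    if m: "m \<in> perron_sups" "m < 1" and e: "0 < e" for m e :: real
  proof -
    obtain a :: "int \<Rightarrow> nat" where a: "\<And>i. a i \<ge> 1" "(SUP k. ereal (perron_value a k)) = ereal m"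
      using m unfolding perron_sups_def by auto
    have le: "perron_value a k \<le> m" for k using SUP_upper[of k UNIV "\<lambda>k. ereal (perron_value a k)"] a(2) by simp
    have "ereal (m - e) < (SUP k. ereal (perron_value a k))" using e a(2) by simp
    then obtain k where k: "m - e < perron_value a k" unfolding less_SUP_iff by auto
    show ?thesis by (intro exI[of _ "\<lambda>i. a (k + i)"]) (use a(1) le k in \<open>simp add: perron_value_shift\<close>)
  qed
  have le1: "x n \<le> 1" for n
  proof (cases "x n = 1")
    case False
    then obtain a :: "int \<Rightarrow> nat" where a: "\<And>i. a i \<ge> 1" "(SUP k. ereal (perron_value a k)) = ereal (x n)"
      using x[rule_format, of n] unfolding perron_sups_def by auto
    have "(SUP k. ereal (perron_value a k)) \<le> ereal 1" using perron_value_bounds(2)[of a] a(1) by (intro SUP_least) simp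
    then show ?thesis using a(2) by simp
  qed simp
  then have "l \<le> 1" using lim by (intro LIMSEQ_le_const2) auto
  show "l \<in> perron_sups"
  proof (cases "l = 1")
    case False
    with \<open>l \<le> 1\<close> have "l < 1" by simp
    then obtain M :: nat where M: "0 < M" "l < 1 - 1 / real M" by (rule inverse_below_gap)
    obtain n0 where n0: "\<And>n. n \<ge> n0 \<Longrightarrow> x n < 1 - 1 / real M"
      using order_tendstoD(2)[OF lim M(2)] unfolding eventually_sequentially by blast
    define y where "y = (\<lambda>n. x (n + n0))"
    have y: "y n < 1 - 1 / real M" "y n \<in> perron_sups" for n using n0 x by (auto simp: y_def)
    have ylim: "y \<longlonglongrightarrow> l" unfolding y_def using lim by (rule LIMSEQ_ignore_initial_segment)
    have "y n < 1" for n using y(1)[of n] by (smt (verit) divide_nonneg_nonneg of_nat_0_le_iff)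
    then have "\<exists>c. (\<forall>i. 1 \<le> c i) \<and> (\<forall>k. perron_value c k \<le> y n) \<and> y n - 1 / real (Suc n) < perron_value c 0" for n
      using y(2) by (intro sup) auto
    then obtain c where c: "\<And>n i. 1 \<le> c n i" "\<And>n k. perron_value (c n) k \<le> y n" "\<And>n. y n - 1 / real (Suc n) < perron_value (c n) 0"
      by metis
    have bounded: "c n i \<le> M" for n i
      by (rule perron_value_less_imp_bounded) (use c(1) M(1) order_le_less_trans[OF c(2) y(1)] in auto)
    obtain r d where r: "strict_mono r" and d: "\<And>i. \<forall>\<^sub>F n in sequentially. c (r n) i = d i"
      using pointwise_limit_exists[of c M] bounded by auto
    have d1: "1 \<le> d i" for i
    proof -
      obtain n where "c (r n) i = d i" using eventually_happens[OF d[of i]] by auto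
      then show ?thesis using c(1) by metis
    qed
    have conv: "(\<lambda>n. perron_value (c (r n)) k) \<longlonglongrightarrow> perron_value d k" for k
      by (rule perron_value_tendsto) (use c(1) d1 d in auto)
    have yr: "(\<lambda>n. y (r n)) \<longlonglongrightarrow> l" using LIMSEQ_subseq_LIMSEQ[OF ylim r] by (simp add: o_def)
    have le: "perron_value d k \<le> l" for k by (rule LIMSEQ_le[OF conv yr]) (use c(2) in auto)
    have "(\<lambda>n. 1 / real (Suc (r n))) \<longlonglongrightarrow> 0"
      using LIMSEQ_subseq_LIMSEQ[OF LIMSEQ_Suc[OF lim_inverse_n'] r] by (simp add: o_def)
    then have "(\<lambda>n. y (r n) - 1 / real (Suc (r n))) \<longlonglongrightarrow> l" using tendsto_diff[OF yr] by force
    then have "l \<le> perron_value d 0" by (rule LIMSEQ_le[OF _ conv]) (use c(3) less_imp_le in blast)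
    then have "perron_value d 0 = l" using le[of 0] by simp
    then have "(SUP k. ereal (perron_value d k)) = ereal l" using le by (rule SUP_perron_value_attained)
    then show ?thesis unfolding perron_sups_def using d1 by blast
  qed (simp add: perron_sups_def)
qed

section \<open>Concatenation of blocks\<close>

text \<open>
The block number \<open>L\<close> is the part of \<open>A L\<close> between positions \<open>s L\<close> and \<open>t L\<close>, at both of which \<open>A L\<close>
looks like \<open>d\<close> around the origin within distance \<open>L\<close>.  Around any of its positions, the concatenation
of all blocks agrees with \<open>A L\<close> within distance about \<open>L\<close>: a window that sticks out of the block on the
right sees the beginning of the next block, which is the right half of a central word of \<open>d\<close>, and
the same word follows \<open>t L\<close> in \<open>A L\<close>; similarly on the left.
\<close>

locale block_concatenation =
  fixes d :: "int \<Rightarrow> nat" and A :: "nat \<Rightarrow> int \<Rightarrow> nat" and s t :: "nat \<Rightarrow> nat"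
  assumes d1: "\<And>i. d i \<ge> 1" and A1: "\<And>L i. A L i \<ge> 1"
    and at_s: "\<And>L i. \<bar>i\<bar> \<le> int L \<Longrightarrow> A L (int (s L) + i) = d i"
    and at_t: "\<And>L i. \<bar>i\<bar> \<le> int L \<Longrightarrow> A L (int (t L) + i) = d i"
    and far: "\<And>L. s L + Suc L \<le> t L"
begin

primrec start :: "nat \<Rightarrow> nat" where
  "start 0 = 0"
| "start (Suc L) = start L + (t L - s L)"

lemma start_Suc_ge: "start L + Suc L \<le> start (Suc L)"
  using far[of L] by simp

lemma start_mono: "L \<le> L' \<Longrightarrow> start L \<le> start L'"
  by (rule lift_Suc_mono_le[of start]) simp

lemma start_ge: "L \<le> start L"
proof (induction L)
  case (Suc L)
  then show ?case using start_Suc_ge[of L] by linarith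
qed simp

text \<open>
The intervals from \<open>start L\<close> to \<open>start (Suc L)\<close> partition the natural numbers, and this is the index of
the interval that contains \<open>p\<close>.
\<close>

definition block :: "nat \<Rightarrow> nat" where
  "block p = (LEAST L. p < start (Suc L))"

lemma block_eq:
  assumes "start L \<le> p" "p < start (Suc L)"
  shows "block p = L"
  unfolding block_def
proof (rule Least_equality)
  fix L' assume "p < start (Suc L')"
  then have "\<not> Suc L' \<le> L" using start_mono[of "Suc L'" L] assms(1) by linarith
  then show "L \<le> L'" by simp
qed fact

lemma block_bounds: "start (block p) \<le> p" "p < start (Suc (block p))"
proof -
  have "p < start (Suc p)" using start_ge[of "Suc p"] by linarith
  then show "p < start (Suc (block p))" unfolding block_def by (rule LeastI)
  show "start (block p) \<le> p"
  proof (cases "block p")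
    case (Suc L)
    then have "\<not> p < start (Suc L)"
      using not_less_Least[of L "\<lambda>L. p < start (Suc L)"] by (simp add: block_def)
    then show ?thesis using Suc by simp
  qed simp
qed

text \<open>
The default value 1 on negative indices keeps all terms positive.
\<close>

definition word :: "int \<Rightarrow> nat" where
  "word i = (if i < 0 then 1 else
     A (block (nat i)) (int (s (block (nat i))) + (i - int (start (block (nat i))))))"

lemma word_ge_1: "word i \<ge> 1"
  unfolding word_def using A1 by simp

lemma word_in_block:
  assumes "int (start L) \<le> i" "i < int (start (Suc L))"
  shows "word i = A L (int (s L) + (i - int (start L)))"
proof -
  have "0 \<le> i" using assms(1) by linarith
  then have "block (nat i) = L" using assms by (intro block_eq) linarith+
  then show ?thesis unfolding word_def using \<open>0 \<le> i\<close> by simp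
qed

lemma word_near_block:
  assumes "int (start L) - int L < i" "i < int (start (Suc L)) + int L"
  shows "word i = A L (int (s L) + (i - int (start L)))"
proof -
  consider "i < int (start L)" | "int (start L) \<le> i" "i < int (start (Suc L))" | "int (start (Suc L)) \<le> i"
    by linarith
  then show ?thesis
  proof cases
    case 1
    then obtain K where K: "L = Suc K" using assms(1) by (cases L) auto
    have st: "int (start L) = int (start K) + (int (t K) - int (s K))" using far[of K] unfolding K by simp
    have "word i = A K (int (s K) + (i - int (start K)))"
    proof (rule word_in_block)
      show "int (start K) \<le> i" using assms(1) st far[of K] K by linarith
      show "i < int (start (Suc K))" using 1 K by simp
    qed
    also have "int (s K) + (i - int (start K)) = int (t K) + (i - int (start L))" using st by linarith
    also have "A K \<dots> = d (i - int (start L))" by (rule at_t) (use 1 assms(1) K in linarith)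
    also have "\<dots> = A L (int (s L) + (i - int (start L)))"
      by (rule at_s[symmetric]) (use 1 assms(1) in linarith)
    finally show ?thesis .
  next
    case 2
    then show ?thesis by (rule word_in_block)
  next
    case 3
    have st: "int (start (Suc L)) = int (start L) + (int (t L) - int (s L))" using far[of L] by simp
    have "word i = A (Suc L) (int (s (Suc L)) + (i - int (start (Suc L))))"
      by (rule word_in_block) (use 3 assms(2) start_Suc_ge[of "Suc L"] in linarith)+
    also have "\<dots> = d (i - int (start (Suc L)))" by (rule at_s) (use 3 assms(2) in linarith)
    also have "\<dots> = A L (int (t L) + (i - int (start (Suc L))))"
      by (rule at_t[symmetric]) (use 3 assms(2) in linarith)
    also have "int (t L) + (i - int (start (Suc L))) = int (s L) + (i - int (start L))" using st by linarith
    finally show ?thesis .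
  qed
qed

text \<open>
The window in \<open>perron_value_close\<close> has even radius, and agreement holds strictly within distance \<open>L\<close>; this
accounts for the exponent.
\<close>

lemma perron_value_word_close:
  assumes "start L \<le> p" "p < start (Suc L)"
  shows "\<bar>perron_value word (int p) - perron_value (A L) (int (s L + (p - start L)))\<bar> \<le> 2 * (1/4) ^ ((L - 1) div 2)"
proof (cases "L = 0")
  case True
  have "\<bar>perron_value word (int p) - perron_value (A L) (int (s L + (p - start L)))\<bar> \<le> 2 * (1/4) ^ 0"
    by (rule perron_value_close[OF word_ge_1 A1]) auto
  then show ?thesis using True by simp
next
  case False
  show ?thesis
  proof (rule perron_value_close[OF word_ge_1 A1])
    fix i assume i: "- int (2 * ((L - 1) div 2)) \<le> i" "i < int (2 * ((L - 1) div 2))"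
    then have "- int L < i" "i < int L" using False by linarith+
    then have "word (int p + i) = A L (int (s L) + (int p + i - int (start L)))"
      using assms by (intro word_near_block) linarith+
    also have "int (s L) + (int p + i - int (start L)) = int (s L + (p - start L)) + i" using assms(1) by simp
    finally show "word (int p + i) = A L (int (s L + (p - start L)) + i)" .
  qed
qed

lemma perron_value_word_start_close: "\<bar>perron_value word (int (start L)) - perron_value d 0\<bar> \<le> 2 * (1/4) ^ ((L - 1) div 2)"
proof (cases "L = 0")
  case True
  have "\<bar>perron_value word (int (start L)) - perron_value d 0\<bar> \<le> 2 * (1/4) ^ 0"
    by (rule perron_value_close[OF word_ge_1 d1]) auto
  then show ?thesis using True by simp
next
  case False
  show ?thesis
  proof (rule perron_value_close[OF word_ge_1 d1])
    fix i assume i: "- int (2 * ((L - 1) div 2)) \<le> i" "i < int (2 * ((L - 1) div 2))"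
    then have i: "- int L < i" "i < int L" using False by linarith+
    then have "word (int (start L) + i) = A L (int (s L) + (int (start L) + i - int (start L)))"
      using start_Suc_ge[of L] by (intro word_near_block) linarith+
    also have "\<dots> = d (0 + i)" using i at_s[of i L] by simp
    finally show "word (int (start L) + i) = d (0 + i)" .
  qed
qed

lemma error_tendsto_0: "(\<lambda>L. 1 / real (Suc L) + 2 * (1/4::real) ^ ((L - 1) div 2)) \<longlonglongrightarrow> 0"
proof -
  have "(\<lambda>L. 2 * (1/4::real) ^ ((L - 1) div 2)) \<longlonglongrightarrow> 0"
    by (rule LIMSEQ_imp_Suc) (simp add: geometric_rate)
  then show ?thesis using tendsto_add[OF LIMSEQ_Suc[OF lim_inverse_n']] by force
qed

lemma limsup_word:
  assumes bound: "\<And>L n. s L \<le> n \<Longrightarrow> perron_value (A L) (int n) < perron_value d 0 + 1 / real (Suc L)"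
  shows "limsup_is sequentially (\<lambda>n. perron_value word (int n)) (perron_value d 0)"
  unfolding limsup_is_def
proof (intro allI impI)
  fix e :: real assume "0 < e"
  then have "\<forall>\<^sub>F L in sequentially. 1 / real (Suc L) + 2 * (1/4::real) ^ ((L - 1) div 2) < e"
    using error_tendsto_0 by (intro order_tendstoD(2)) auto
  then obtain K where K: "\<And>L. L \<ge> K \<Longrightarrow> 1 / real (Suc L) + 2 * (1/4::real) ^ ((L - 1) div 2) < e"
    unfolding eventually_sequentially by blast
  have "perron_value word (int p) < perron_value d 0 + e" if "start K \<le> p" for p
  proof -
    let ?L = "block p"
    have "\<not> Suc ?L \<le> K" using start_mono[of "Suc ?L" K] block_bounds(2)[of p] that by linarith
    then have "1 / real (Suc ?L) + 2 * (1/4::real) ^ ((?L - 1) div 2) < e" by (intro K) simp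
    moreover have "perron_value (A ?L) (int (s ?L + (p - start ?L))) < perron_value d 0 + 1 / real (Suc ?L)"
      by (rule bound) simp
    moreover have "\<bar>perron_value word (int p) - perron_value (A ?L) (int (s ?L + (p - start ?L)))\<bar>
        \<le> 2 * (1/4) ^ ((?L - 1) div 2)"
      by (rule perron_value_word_close[OF block_bounds])
    ultimately show ?thesis by linarith
  qed
  then have "\<forall>\<^sub>F n in sequentially. perron_value word (int n) < perron_value d 0 + e"
    unfolding eventually_sequentially by blast
  moreover have "\<exists>\<^sub>F n in sequentially. perron_value d 0 - e < perron_value word (int n)"
    unfolding frequently_sequentially
  proof
    fix N
    let ?L = "max K N"
    have "0 < 1 / real (Suc ?L)" by simp
    moreover have "1 / real (Suc ?L) + 2 * (1/4::real) ^ ((?L - 1) div 2) < e" by (rule K) simp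
    ultimately have "perron_value d 0 - e < perron_value word (int (start ?L))" using perron_value_word_start_close[of ?L] by linarith
    moreover have "N \<le> start ?L" using start_ge[of ?L] by simp
    ultimately show "\<exists>n\<ge>N. perron_value d 0 - e < perron_value word (int n)" by blast
  qed
  ultimately show "(\<forall>\<^sub>F n in sequentially. perron_value word (int n) < perron_value d 0 + e) \<and>
      (\<exists>\<^sub>F n in sequentially. perron_value d 0 - e < perron_value word (int n))" ..
qed

end

text \<open>
A sequence \<open>d\<close> qualifies if longer and longer central words of it recur in sequences whose limit
superior barely exceeds the value of \<open>d\<close> at the origin.
\<close>

lemma perron_limsupsI:
  assumes d: "\<And>i. d i \<ge> (1::nat)"
    and approx: "\<And>L::nat. \<exists>a :: int \<Rightarrow> nat. (\<forall>i. 1 \<le> a i) \<and>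
      (\<forall>\<^sub>F n in sequentially. perron_value a (int n) < perron_value d 0 + 1 / real (Suc L)) \<and>
      (\<exists>\<^sub>F n in sequentially. \<forall>i\<in>{- int L..int L}. a (int n + i) = d i)"
  shows "perron_value d 0 \<in> perron_limsups"
proof -
  have "\<exists>a s t. (\<forall>i. 1 \<le> a i) \<and> s + Suc L \<le> t \<and>
      (\<forall>i. \<bar>i\<bar> \<le> int L \<longrightarrow> a (int s + i) = d i) \<and> (\<forall>i. \<bar>i\<bar> \<le> int L \<longrightarrow> a (int t + i) = d i) \<and>
      (\<forall>n\<ge>s. perron_value a (int n) < perron_value d 0 + 1 / real (Suc L))" for L
  proof -
    obtain a :: "int \<Rightarrow> nat" where a: "\<forall>i. 1 \<le> a i"
      "\<forall>\<^sub>F n in sequentially. perron_value a (int n) < perron_value d 0 + 1 / real (Suc L)"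
      "\<exists>\<^sub>F n in sequentially. \<forall>i\<in>{- int L..int L}. a (int n + i) = d i"
      using approx[of L] by blast
    obtain K where K: "\<And>n. n \<ge> K \<Longrightarrow> perron_value a (int n) < perron_value d 0 + 1 / real (Suc L)"
      using a(2) unfolding eventually_sequentially by blast
    obtain s where s: "s \<ge> K" "\<forall>i\<in>{- int L..int L}. a (int s + i) = d i"
      using a(3) unfolding frequently_sequentially by blast
    obtain t where t: "t \<ge> s + Suc L" "\<forall>i\<in>{- int L..int L}. a (int t + i) = d i"
      using a(3) unfolding frequently_sequentially by blast
    have win: "i \<in> {- int L..int L}" if "\<bar>i\<bar> \<le> int L" for i using that by auto
    have "\<forall>i. \<bar>i\<bar> \<le> int L \<longrightarrow> a (int s + i) = d i" "\<forall>i. \<bar>i\<bar> \<le> int L \<longrightarrow> a (int t + i) = d i"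
      using s(2) t(2) win by blast+
    moreover have "\<forall>n\<ge>s. perron_value a (int n) < perron_value d 0 + 1 / real (Suc L)" using K s(1) by simp
    ultimately show ?thesis using a(1) t(1) by blast
  qed
  then have "\<forall>L. \<exists>a s t. (\<forall>i. 1 \<le> a i) \<and> s + Suc L \<le> t \<and>
      (\<forall>i. \<bar>i\<bar> \<le> int L \<longrightarrow> a (int s + i) = d i) \<and> (\<forall>i. \<bar>i\<bar> \<le> int L \<longrightarrow> a (int t + i) = d i) \<and>
      (\<forall>n\<ge>s. perron_value a (int n) < perron_value d 0 + 1 / real (Suc L))" by (rule allI)
  from choice[OF this] obtain A where "\<forall>L. \<exists>s t. (\<forall>i. 1 \<le> A L i) \<and> s + Suc L \<le> t \<and>
      (\<forall>i. \<bar>i\<bar> \<le> int L \<longrightarrow> A L (int s + i) = d i) \<and> (\<forall>i. \<bar>i\<bar> \<le> int L \<longrightarrow> A L (int t + i) = d i) \<and>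
      (\<forall>n\<ge>s. perron_value (A L) (int n) < perron_value d 0 + 1 / real (Suc L))" by (rule exE)
  from choice[OF this] obtain s where "\<forall>L. \<exists>t. (\<forall>i. 1 \<le> A L i) \<and> s L + Suc L \<le> t \<and>
      (\<forall>i. \<bar>i\<bar> \<le> int L \<longrightarrow> A L (int (s L) + i) = d i) \<and> (\<forall>i. \<bar>i\<bar> \<le> int L \<longrightarrow> A L (int t + i) = d i) \<and>
      (\<forall>n\<ge>s L. perron_value (A L) (int n) < perron_value d 0 + 1 / real (Suc L))" by (rule exE)
  from choice[OF this] obtain t where st: "\<forall>L. (\<forall>i. 1 \<le> A L i) \<and> s L + Suc L \<le> t L \<and>
      (\<forall>i. \<bar>i\<bar> \<le> int L \<longrightarrow> A L (int (s L) + i) = d i) \<and> (\<forall>i. \<bar>i\<bar> \<le> int L \<longrightarrow> A L (int (t L) + i) = d i) \<and>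
      (\<forall>n\<ge>s L. perron_value (A L) (int n) < perron_value d 0 + 1 / real (Suc L))" by (rule exE)
  interpret block_concatenation d A s t
    by unfold_locales (use st d in auto)
  have "limsup_is sequentially (\<lambda>n. perron_value word (int n)) (perron_value d 0)"
    by (rule limsup_word) (use st in blast)
  then show ?thesis unfolding perron_limsups_def using word_ge_1 by blast
qed

lemma one_in_perron_limsups: "1 \<in> perron_limsups"
proof -
  let ?a = "\<lambda>i::int. Suc (nat \<bar>i\<bar>)"
  have lim: "(\<lambda>n. perron_value ?a (int n)) \<longlonglongrightarrow> 1"
  proof (rule tendsto_sandwich)
    show "\<forall>\<^sub>F n in sequentially. 1 - 1 / real (Suc n) \<le> perron_value ?a (int n)"
      using perron_value_bounds(1)[of ?a "int _"] by simp
    show "\<forall>\<^sub>F n in sequentially. perron_value ?a (int n) \<le> 1" using perron_value_bounds(2)[of ?a] by simp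
    show "(\<lambda>n. 1 - 1 / real (Suc n)) \<longlonglongrightarrow> 1"
      using tendsto_diff[OF tendsto_const[of 1] LIMSEQ_Suc[OF lim_inverse_n']] by simp
  qed simp
  have "limsup_is sequentially (\<lambda>n. perron_value ?a (int n)) 1"
    unfolding limsup_is_def
  proof (intro allI impI conjI)
    fix e :: real assume "0 < e"
    then show "\<forall>\<^sub>F n in sequentially. perron_value ?a (int n) < 1 + e" using lim by (intro order_tendstoD(2)) auto
    have "\<forall>\<^sub>F n in sequentially. 1 - e < perron_value ?a (int n)" using lim \<open>0 < e\<close> by (intro order_tendstoD(1)) auto
    then show "\<exists>\<^sub>F n in sequentially. 1 - e < perron_value ?a (int n)" by (rule eventually_frequently[rotated]) simp
  qed
  then show ?thesis unfolding perron_limsups_def by (intro CollectI exI[of _ ?a]) simp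
qed

text \<open>
Two limits are taken: for each of the converging values a sequence that recurs in the one that
realises it, then a limit \<open>d\<close> of these recurring sequences.  The central words of \<open>d\<close> recur in the
original sequences, which are then combined into one.
\<close>

lemma closed_perron_limsups: "closed perron_limsups"
  unfolding closed_sequential_limits
proof (intro allI impI, elim conjE)
  fix x :: "nat \<Rightarrow> real" and l assume x: "\<forall>n. x n \<in> perron_limsups" and lim: "x \<longlonglongrightarrow> l"
  have "l \<le> 1" using lim by (rule LIMSEQ_le_const2) (use x perron_limsups_le_one in blast)
  show "l \<in> perron_limsups"
  proof (cases "l = 1")
    case False
    with \<open>l \<le> 1\<close> have "l < 1" by simp
    then obtain M :: nat where M: "0 < M" "l < 1 - 1 / real M" by (rule inverse_below_gap)
    obtain n0 where n0: "\<And>n. n \<ge> n0 \<Longrightarrow> x n < 1 - 1 / real M"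
      using order_tendstoD(2)[OF lim M(2)] unfolding eventually_sequentially by blast
    define y where "y = (\<lambda>n. x (n + n0))"
    have y: "y n < 1 - 1 / real M" "y n \<in> perron_limsups" for n using n0 x by (auto simp: y_def)
    have ylim: "y \<longlonglongrightarrow> l" unfolding y_def using lim by (rule LIMSEQ_ignore_initial_segment)
    have "\<exists>a c. (\<forall>i. 1 \<le> a i) \<and> eventual_bound sequentially (\<lambda>k. perron_value a (int k)) (y n) \<and>
        (\<forall>i. 1 \<le> c i) \<and> (\<forall>i. c i \<le> M) \<and> recurs_in c a \<and> perron_value c 0 = y n" for n
    proof -
      obtain a :: "int \<Rightarrow> nat" where a: "\<And>i. 1 \<le> a i" "limsup_is sequentially (\<lambda>k. perron_value a (int k)) (y n)"
        using y(2)[of n] unfolding perron_limsups_def by blast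
      have "\<exists>c. (\<forall>i. 1 \<le> c i \<and> c i \<le> M) \<and> recurs_in c a \<and> perron_value c 0 = y n \<and> (\<forall>k. perron_value c k \<le> y n)"
        by (rule limsup_attained_by_recurring) (rule a y M)+
      then obtain c where c: "\<forall>i. 1 \<le> c i \<and> c i \<le> M" "recurs_in c a" "perron_value c 0 = y n"
          "\<forall>k. perron_value c k \<le> y n"
        by (elim exE conjE) (rule that)
      have "eventual_bound sequentially (\<lambda>k. perron_value a (int k)) (y n)"
        using a(2) unfolding limsup_is_iff_least_eventual_bound by blast
      then show ?thesis using a(1) c by blast
    qed
    then have "\<forall>n. \<exists>a c. (\<forall>i. 1 \<le> a i) \<and> eventual_bound sequentially (\<lambda>k. perron_value a (int k)) (y n) \<and>
        (\<forall>i. 1 \<le> c i) \<and> (\<forall>i. c i \<le> M) \<and> recurs_in c a \<and> perron_value c 0 = y n" by (rule allI)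
    from choice[OF this] obtain a where "\<forall>n. \<exists>c. (\<forall>i. 1 \<le> a n i) \<and>
        eventual_bound sequentially (\<lambda>k. perron_value (a n) (int k)) (y n) \<and>
        (\<forall>i. 1 \<le> c i) \<and> (\<forall>i. c i \<le> M) \<and> recurs_in c (a n) \<and> perron_value c 0 = y n" by (rule exE)
    from choice[OF this] obtain c where ac: "\<forall>n. (\<forall>i. 1 \<le> a n i) \<and>
        eventual_bound sequentially (\<lambda>k. perron_value (a n) (int k)) (y n) \<and>
        (\<forall>i. 1 \<le> c n i) \<and> (\<forall>i. c n i \<le> M) \<and> recurs_in (c n) (a n) \<and> perron_value (c n) 0 = y n" by (rule exE)
    obtain r d where r: "strict_mono r" and d: "\<And>i. \<forall>\<^sub>F n in sequentially. c (r n) i = d i"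
      using pointwise_limit_exists[of c M] ac by auto
    have d1: "1 \<le> d i" for i
    proof -
      obtain n where "c (r n) i = d i" using eventually_happens[OF d[of i]] by auto
      then show ?thesis using ac by metis
    qed
    have yr: "(\<lambda>n. y (r n)) \<longlonglongrightarrow> l" using LIMSEQ_subseq_LIMSEQ[OF ylim r] by (simp add: o_def)
    have "(\<lambda>n. perron_value (c (r n)) 0) \<longlonglongrightarrow> perron_value d 0"
      by (rule perron_value_tendsto) (use ac d1 d in auto)
    then have "(\<lambda>n. y (r n)) \<longlonglongrightarrow> perron_value d 0" using ac by simp
    then have "perron_value d 0 = l" using yr by (rule LIMSEQ_unique)
    have "perron_value d 0 \<in> perron_limsups"
    proof (rule perron_limsupsI[OF d1])
      fix L :: nat
      let ?e = "1 / real (Suc L)"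
      have "\<forall>\<^sub>F n in sequentially. \<forall>i\<in>{- int L..int L}. c (r n) i = d i"
        by (intro eventually_ball_finite) (auto intro: d)
      moreover have "\<forall>\<^sub>F n in sequentially. y (r n) < l + ?e / 2"
        by (rule order_tendstoD(2)[OF yr]) simp
      ultimately have "\<forall>\<^sub>F n in sequentially. (\<forall>i\<in>{- int L..int L}. c (r n) i = d i) \<and> y (r n) < l + ?e / 2"
        by (rule eventually_conj)
      then obtain n where n: "\<forall>i\<in>{- int L..int L}. c (r n) i = d i" "y (r n) < l + ?e / 2"
        by (auto dest: eventually_happens)
      let ?a = "a (r n)"
      have "\<forall>\<^sub>F k in sequentially. perron_value ?a (int k) < y (r n) + ?e / 2"
        using ac unfolding eventual_bound_def by simp
      then have "\<forall>\<^sub>F k in sequentially. perron_value ?a (int k) < perron_value d 0 + ?e"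
        by (rule eventually_mono) (use n(2) \<open>perron_value d 0 = l\<close> in linarith)
      moreover have "\<exists>\<^sub>F k in sequentially. \<forall>i\<in>{- int L..int L}. ?a (int k + i) = d i"
      proof -
        have "\<exists>\<^sub>F k in sequentially. \<forall>i\<in>{- int L..int L}. ?a (int k + i) = c (r n) i"
          using ac unfolding recurs_in_def by blast
        then show ?thesis by (rule frequently_elim1) (use n(1) in simp)
      qed
      ultimately show "\<exists>a :: int \<Rightarrow> nat. (\<forall>i. 1 \<le> a i) \<and>
          (\<forall>\<^sub>F k in sequentially. perron_value a (int k) < perron_value d 0 + ?e) \<and>
          (\<exists>\<^sub>F k in sequentially. \<forall>i\<in>{- int L..int L}. a (int k + i) = d i)"
        using ac by (intro exI[of _ ?a]) simp
    qed
    then show ?thesis using \<open>perron_value d 0 = l\<close> by simp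
  qed (simp add: one_in_perron_limsups)
qed

section \<open>The spectra of the Perron formula\<close>

lemma good_continuity_recip:
  fixes f :: "real \<times> real \<Rightarrow> real"
  assumes f: "\<And>\<alpha> \<beta>. \<alpha> \<in> {0..1} \<Longrightarrow> \<beta> \<in> {0..1} \<Longrightarrow> f (\<alpha>, \<beta>) = 1 / (1 + \<alpha> * \<beta>)"
  shows "good_continuity f"
proof -
  have "continuous_on ({0..1} \<times> {0..1}) (\<lambda>z :: real \<times> real. 1 / (1 + fst z * snd z))"
  proof (intro continuous_intros ballI)
    fix z :: "real \<times> real" assume "z \<in> {0..1} \<times> {0..1}"
    then have "0 \<le> fst z * snd z" by auto
    then show "1 + fst z * snd z \<noteq> 0" by linarith
  qed
  moreover have "1 / (1 + fst z * snd z) = f z" if "z \<in> {0..1} \<times> {0..1}" for z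
    using f[of "fst z" "snd z"] that by auto
  ultimately show ?thesis unfolding good_continuity_def by (simp cong: continuous_on_cong_simp)
qed

theorem corollary48:
  fixes f :: "real \<times> real \<Rightarrow> real"
  assumes f: "\<And>\<alpha> \<beta>. \<alpha> \<in> {0..1} \<Longrightarrow> \<beta> \<in> {0..1} \<Longrightarrow> f (\<alpha>, \<beta>) = 1 / (1 + \<alpha> * \<beta>)"
  shows "good_continuity f \<and>
         dirichlet_spectrum = sigma_limsup' f \<and>
         mordell_gruber_spectrum = sigma_sup f \<and>
         dirichlet_spectrum \<subseteq> mordell_gruber_spectrum \<and>
         closed dirichlet_spectrum \<and>
         closed mordell_gruber_spectrum"
proof -
  have "good_continuity f" by (rule good_continuity_recip) (rule f)
  moreover have "sigma_limsup' f = perron_limsups" by (rule sigma_limsup'_eq) (rule f)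
  moreover have "sigma_sup f = perron_sups" by (rule sigma_sup_eq) (rule f)
  ultimately show ?thesis
    using perron_limsups_subset_sups closed_perron_limsups closed_perron_sups
    by (simp only: dirichlet_spectrum_eq mordell_gruber_spectrum_eq simp_thms)
qed

end
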